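(* Let $\mathbb K$ be an algebraically closed field of characteristic zero equipped with a unital ring homomorphism $\Bbbk\to\mathbb K$, and suppose $A_{\mathbb K}=\mathbb K\otimes_\Bbbk A$ is a finite-dimensional semisimple $\mathbb K$-superalgebra. Then for all $n,d\ge0$, every $\mathbb K$-linear map $\phi:V_{n,\mathbb K}^{\otimes d}\to V_{n,\mathbb K}^{\otimes d}$ satisfying $\phi(\xi v)=\xi\phi(v)$ for all $\xi\in S^A(n,d)_{\mathbb K}$, $v\in V_{n,\mathbb K}^{\otimes d}$ is of the form $v\mapsto v\cdot w$ for some $w\in\mathfrak S_d\wr A_{\mathbb K}$; i.e. the natural map $\mathfrak S_d\wr A_{\mathbb K}\to\mathrm{End}_{S^A(n,d)_{\mathbb K}}(V_{n,\mathbb K}^{\otimes d})$ is surjective.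
   Context: $\Bbbk$ is an integral domain of characteristic zero and $A$ a $\Bbbk$-superalgebra with a finite set $I$ of orthogonal even idempotents summing to $1$, free as a $\Bbbk$-module with homogeneous bases of each $jAi$ (part of a good pair $(A,a)_I$). $V_n=A^{\oplus n}$ is viewed as column vectors; $M_n(A)$ acts on it on the left by matrix multiplication and $A$ on the right by multiplication. On $V_n^{\otimes d}$: $M_n(A)^{\otimes d}$ acts on the left factorwise with Koszul signs, $(m_1\otimes\cdots\otimes m_d)(v_1\otimes\cdots\otimes v_d)=(-1)^{\sum_{r>s}\bar m_r\bar v_s}m_1v_1\otimes\cdots\otimes m_dv_d$; the wreath product superalgebra $\mathfrak S_d\wr A=\Bbbk\mathfrak S_d\otimes A^{\otimes d}$ acts on the right, with $A^{\otimes d}$ acting diagonally by right multiplication (Koszul signs) and $\mathfrak S_d$ by signed place permutations $(v_1\otimes\cdots\otimes v_d)\cdot\tau=(-1)^{\langle\tau;(v)\rangle}v_{\tau(1)}\otimes\cdots\otimes v_{\tau(d)}$, $\langle\tau;(v)\rangle=\sum_{r<s,\tau(r)>\tau(s)}\bar v_r\bar v_s$. $S^A(n,d)=(M_n(A)^{\otimes d})^{\mathfrak S_d}$, the invariants under the analogous signed place permutation action, acts on the left and its action commutes with the right action of $\mathfrak S_d\wr A$. Subscript $\mathbb K$ denotes base change $\mathbb K\otimes_\Bbbk-$.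
   Formalization: The sign exponent of the signed place permutation is taken as the sum over r<s, τ(r)>τ(s) of the parities of v_{τ(r)} and v_{τ(s)} multiplied, instead of those of v_r and v_s, since the latter formula does not define a right action of the symmetric group. *)

theory Defs
  imports "HOL-Computational_Algebra.Polynomial" "HOL-Combinatorics.Permutations"
begin

definition alg_closed :: "'a::field itself \<Rightarrow> bool" where
  "alg_closed _ \<longleftrightarrow> (\<forall>q :: 'a poly. degree q > 0 \<longrightarrow> (\<exists>x. poly q x = 0))"

definition unital_ring_hom :: "('a::ring_1 \<Rightarrow> 'b::ring_1) \<Rightarrow> bool" where
  "unital_ring_hom h \<longleftrightarrow> h 1 = 1 \<and> (\<forall>x y. h (x + y) = h x + h y \<and> h (x * y) = h x * h y)"

section \<open>Superalgebras free on a finite homogeneous basis 'b (elements = coordinate functions)\<close>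

definition bvec :: "'b \<Rightarrow> 'b \<Rightarrow> 'a::zero_neq_one" where
  "bvec b = (\<lambda>c. if c = b then 1 else 0)"

(* m a b c = coefficient of basis element c in the product of basis elements a and b *)
definition amul :: "('b::finite \<Rightarrow> 'b \<Rightarrow> 'b \<Rightarrow> 'a::comm_ring_1) \<Rightarrow> ('b \<Rightarrow> 'a) \<Rightarrow> ('b \<Rightarrow> 'a) \<Rightarrow> ('b \<Rightarrow> 'a)" where
  "amul m x y = (\<lambda>c. \<Sum>a\<in>UNIV. \<Sum>b\<in>UNIV. x a * y b * m a b c)"

(* associative unital superalgebra, free on basis 'b, with parity p (True = odd) of basis elements *)
definition super_algebra :: "('b::finite \<Rightarrow> 'b \<Rightarrow> 'b \<Rightarrow> 'a::comm_ring_1) \<Rightarrow> ('b \<Rightarrow> 'a) \<Rightarrow> ('b \<Rightarrow> bool) \<Rightarrow> bool" where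
  "super_algebra m u p \<longleftrightarrow>
     (\<forall>x y z. amul m (amul m x y) z = amul m x (amul m y z)) \<and>
     (\<forall>x. amul m u x = x \<and> amul m x u = x) \<and>
     (\<forall>a b c. m a b c \<noteq> 0 \<longrightarrow> p c = (p a \<noteq> p b)) \<and>
     (\<forall>c. u c \<noteq> 0 \<longrightarrow> \<not> p c)"

(* finite set I of orthogonal even idempotents summing to 1, basis homogeneous and
   compatible with the decomposition A = (+) jAi : basis element b lies in (fst (blk b)) A (snd (blk b)) *)
definition idempotent_decomp :: "('b::finite \<Rightarrow> 'b \<Rightarrow> 'b \<Rightarrow> 'a::comm_ring_1) \<Rightarrow> ('b \<Rightarrow> 'a) \<Rightarrow> ('b \<Rightarrow> bool)
     \<Rightarrow> 'i set \<Rightarrow> ('i \<Rightarrow> 'b \<Rightarrow> 'a) \<Rightarrow> ('b \<Rightarrow> 'i \<times> 'i) \<Rightarrow> bool" where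
  "idempotent_decomp m u p I e blk \<longleftrightarrow>
     finite I \<and>
     (\<forall>i\<in>I. \<forall>j\<in>I. amul m (e i) (e j) = (if i = j then e i else (\<lambda>c. 0))) \<and>
     (\<forall>i\<in>I. \<forall>c. p c \<longrightarrow> e i c = 0) \<and>
     (\<lambda>c. \<Sum>i\<in>I. e i c) = u \<and>
     (\<forall>b. blk b \<in> I \<times> I \<and> amul m (e (fst (blk b))) (amul m (bvec b) (e (snd (blk b)))) = bvec b)"

definition left_ideal :: "('b::finite \<Rightarrow> 'b \<Rightarrow> 'b \<Rightarrow> 'a::comm_ring_1) \<Rightarrow> ('b \<Rightarrow> 'a) set \<Rightarrow> bool" where
  "left_ideal m L \<longleftrightarrow> (\<lambda>c. 0) \<in> L \<and> (\<forall>x\<in>L. \<forall>y\<in>L. (\<lambda>c. x c + y c) \<in> L) \<and>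
     (\<forall>s. \<forall>x\<in>L. (\<lambda>c. s * x c) \<in> L) \<and> (\<forall>a. \<forall>x\<in>L. amul m a x \<in> L)"

definition graded :: "('b \<Rightarrow> bool) \<Rightarrow> ('b \<Rightarrow> 'a::zero) set \<Rightarrow> bool" where
  "graded p L \<longleftrightarrow> (\<forall>x\<in>L. (\<lambda>c. if p c then 0 else x c) \<in> L)"

(* semisimple superalgebra: semisimple as a supermodule over itself, i.e. every graded left
   ideal has a graded left ideal complement *)
definition semisimple_super :: "('b::finite \<Rightarrow> 'b \<Rightarrow> 'b \<Rightarrow> 'a::field) \<Rightarrow> ('b \<Rightarrow> bool) \<Rightarrow> bool" where
  "semisimple_super m p \<longleftrightarrow>
     (\<forall>L. left_ideal m L \<and> graded p L \<longrightarrow>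
        (\<exists>L'. left_ideal m L' \<and> graded p L' \<and> L \<inter> L' = {\<lambda>c. 0} \<and>
              (\<forall>x. \<exists>y\<in>L. \<exists>z\<in>L'. x = (\<lambda>c. y c + z c))))"

(* basis tensors of V_n^{\<otimes>d}: lists of (row, basis element of A) *)
definition Tidx :: "nat \<Rightarrow> nat \<Rightarrow> (nat \<times> 'b) list set" where
  "Tidx n d = {ts. length ts = d \<and> (\<forall>x\<in>set ts. fst x < n)}"

(* basis tensors of M_n(A)^{\<otimes>d}: lists of (i, j, b) = matrix unit E_ij with entry b *)
definition Midx :: "nat \<Rightarrow> nat \<Rightarrow> (nat \<times> nat \<times> 'b) list set" where
  "Midx n d = {ms. length ms = d \<and> (\<forall>x\<in>set ms. fst x < n \<and> fst (snd x) < n)}"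

definition Bidx :: "nat \<Rightarrow> 'b list set" where
  "Bidx d = {bs. length bs = d}"

definition supported :: "'x set \<Rightarrow> ('x \<Rightarrow> 'a::zero) set" where
  "supported X = {f. \<forall>x. x \<notin> X \<longrightarrow> f x = 0}"

definition plist :: "(nat \<Rightarrow> nat) \<Rightarrow> 'x list \<Rightarrow> 'x list" where
  "plist \<tau> xs = map (\<lambda>r. xs ! \<tau> r) [0..<length xs]"

(* Koszul sign exponent of the place permutation x_1..x_d \<mapsto> x_{\<tau> 1} .. x_{\<tau> d} *)
definition pinv :: "('x \<Rightarrow> bool) \<Rightarrow> (nat \<Rightarrow> nat) \<Rightarrow> 'x list \<Rightarrow> nat" where
  "pinv p \<tau> xs = card {(r, s). r < s \<and> s < length xs \<and> \<tau> s < \<tau> r \<and> p (xs ! \<tau> r) \<and> p (xs ! \<tau> s)}"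

(* signed place permutation acting (on the right) on coordinate functions *)
definition place_act :: "('x \<Rightarrow> bool) \<Rightarrow> 'x list set \<Rightarrow> (nat \<Rightarrow> nat) \<Rightarrow> ('x list \<Rightarrow> 'a::comm_ring_1) \<Rightarrow> ('x list \<Rightarrow> 'a)" where
  "place_act p X \<tau> f = (\<lambda>ys. \<Sum>xs\<in>X. if ys = plist \<tau> xs then (-1) ^ pinv p \<tau> xs * f xs else 0)"

(* S^A(n,d) = (M_n(A)^{\<otimes>d})^{S_d}, over the base ring *)
definition schur_alg :: "('b \<Rightarrow> bool) \<Rightarrow> nat \<Rightarrow> nat \<Rightarrow> ((nat \<times> nat \<times> 'b) list \<Rightarrow> 'a::comm_ring_1) set" where
  "schur_alg p n d = {\<xi>. \<xi> \<in> supported (Midx n d) \<and>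
      (\<forall>\<tau>. \<tau> permutes {..<d} \<longrightarrow> place_act (\<lambda>x. p (snd (snd x))) (Midx n d) \<tau> \<xi> = \<xi>)}"

(* coefficient of out in (basis tensor ms) \<cdot> (basis tensor ts), Koszul signs *)
definition lcoef :: "('b \<Rightarrow> 'b \<Rightarrow> 'b \<Rightarrow> 'a::comm_ring_1) \<Rightarrow> ('b \<Rightarrow> bool) \<Rightarrow> (nat \<times> nat \<times> 'b) list
     \<Rightarrow> (nat \<times> 'b) list \<Rightarrow> (nat \<times> 'b) list \<Rightarrow> 'a" where
  "lcoef m p ms ts out =
     (if (\<forall>r<length ms. fst (snd (ms ! r)) = fst (ts ! r) \<and> fst (ms ! r) = fst (out ! r))
      then (-1) ^ card {(r, s). s < r \<and> r < length ms \<and> p (snd (snd (ms ! r))) \<and> p (snd (ts ! s))}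
           * (\<Prod>r<length ms. m (snd (snd (ms ! r))) (snd (ts ! r)) (snd (out ! r)))
      else 0)"

definition lact :: "('b \<Rightarrow> 'b \<Rightarrow> 'b \<Rightarrow> 'a::comm_ring_1) \<Rightarrow> ('b \<Rightarrow> bool) \<Rightarrow> nat \<Rightarrow> nat
     \<Rightarrow> ((nat \<times> nat \<times> 'b) list \<Rightarrow> 'a) \<Rightarrow> ((nat \<times> 'b) list \<Rightarrow> 'a) \<Rightarrow> ((nat \<times> 'b) list \<Rightarrow> 'a)" where
  "lact m p n d \<xi> v = (\<lambda>out. if out \<in> Tidx n d
      then \<Sum>ms\<in>Midx n d. \<Sum>ts\<in>Tidx n d. \<xi> ms * v ts * lcoef m p ms ts out else 0)"

(* coefficient of out in (basis tensor ts) \<cdot> (b_1 \<otimes> ... \<otimes> b_d), Koszul signs *)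
definition rcoef :: "('b \<Rightarrow> 'b \<Rightarrow> 'b \<Rightarrow> 'a::comm_ring_1) \<Rightarrow> ('b \<Rightarrow> bool) \<Rightarrow> 'b list
     \<Rightarrow> (nat \<times> 'b) list \<Rightarrow> (nat \<times> 'b) list \<Rightarrow> 'a" where
  "rcoef m p bs ts out =
     (if (\<forall>r<length bs. fst (ts ! r) = fst (out ! r))
      then (-1) ^ card {(r, s). r < s \<and> s < length bs \<and> p (bs ! r) \<and> p (snd (ts ! s))}
           * (\<Prod>r<length bs. m (snd (ts ! r)) (bs ! r) (snd (out ! r)))
      else 0)"

definition ract :: "('b \<Rightarrow> 'b \<Rightarrow> 'b \<Rightarrow> 'a::comm_ring_1) \<Rightarrow> ('b \<Rightarrow> bool) \<Rightarrow> nat \<Rightarrow> nat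
     \<Rightarrow> 'b list \<Rightarrow> ((nat \<times> 'b) list \<Rightarrow> 'a) \<Rightarrow> ((nat \<times> 'b) list \<Rightarrow> 'a)" where
  "ract m p n d bs v = (\<lambda>out. if out \<in> Tidx n d
      then \<Sum>ts\<in>Tidx n d. v ts * rcoef m p bs ts out else 0)"

(* right action of w = \<Sum> w(\<tau>,bs) \<tau> \<otimes> (b_1 \<otimes> ... \<otimes> b_d) \<in> S_d \<wr> A *)
definition wact :: "('b::finite \<Rightarrow> 'b \<Rightarrow> 'b \<Rightarrow> 'a::comm_ring_1) \<Rightarrow> ('b \<Rightarrow> bool) \<Rightarrow> nat \<Rightarrow> nat
     \<Rightarrow> ((nat \<Rightarrow> nat) \<times> 'b list \<Rightarrow> 'a) \<Rightarrow> ((nat \<times> 'b) list \<Rightarrow> 'a) \<Rightarrow> ((nat \<times> 'b) list \<Rightarrow> 'a)" where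
  "wact m p n d w v = (\<lambda>out. \<Sum>\<tau>\<in>{\<tau>. \<tau> permutes {..<d}}. \<Sum>bs\<in>Bidx d.
      w (\<tau>, bs) * ract m p n d bs (place_act (\<lambda>x. p (snd x)) (Tidx n d) \<tau> v) out)"

end

(* Right multiplication by the wreath product B = S_d wr A on T = V_n^{(x)d} has commutant S^A(n,d),
   and B is separable; so the statement is an instance of the double centralizer theorem.

   Separability: since A is semisimple in characteristic zero, its regular trace form is nondegenerate
   (its radical is a graded left ideal generated by an idempotent of trace, hence rank, zero).
   The form of A^{(x)d} is, up to Koszul signs, the tensor power, so it is nondegenerate too. Dual
   bases of the regular trace form give a Casimir element whose product is 1, and averaging with it
   and then over S_d turns any linear map into one commuting with B.

   Double centralizer: averaging a linear projection of End(T) onto the image W of B gives a B-linear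
   projection onto W whose matrix entries are B-endomorphisms of T, hence commute with phi. Since the
   projection fixes the identity, it fixes phi, so phi lies in W. Finally B-endomorphisms of T are
   K-combinations of elements of S^A(n,d) defined over the base ring, namely signed orbit sums. *)

theory Submission
  imports Defs "HOL-Analysis.Cartesian_Space"
begin

section \<open>Koszul signs\<close>

text \<open>The form comes from the ordinary trace of left multiplication, not the supertrace. The
  regular supertrace can vanish identically (as for 2 by 2 matrices on one even and one odd
  coordinate), while the ordinary trace of an idempotent is its rank, which characteristic zero
  detects. Left multiplication by an odd basis element has zero diagonal, so the form pairs only
  equal parities. Hence its radical is graded, as required because only graded ideals are given
  complements, and the sign in the inverse Gram matrix of a tensor power is determined.

  Signs do not obstruct the summations: structure constants respect parity, so the parity of an
  intermediate factor is forced by the outer ones, the sign leaves the sum, and the rest factors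
  over tensor positions.

  Operators are coordinate matrices acting on row vectors, so the left factor of a product is
  applied first. Division by d! happens only over the field, since the base ring need not contain
  1/d!; the invariants tested against \<phi> are therefore unnormalized signed sums over all
  permutations.\<close>

definition sign_of :: "bool \<Rightarrow> 'a::comm_ring_1" where
  "sign_of b = (if b then - 1 else 1)"

lemma prod_sign_of: "finite A \<Longrightarrow> (\<Prod>x\<in>A. sign_of (P x)) = (- 1) ^ card {x \<in> A. P x}"
  unfolding sign_of_def by (simp add: prod.If_cases Int_def)

lemma prod2_sign_of:
  fixes d :: nat
  shows "(\<Prod>r<d. \<Prod>s<d. sign_of (P r s)) = (- 1) ^ card {(r, s). r < d \<and> s < d \<and> P r s}"
proof -
  have "(\<Prod>r<d. \<Prod>s<d. sign_of (P r s)) = (\<Prod>x\<in>{..<d} \<times> {..<d}. sign_of (P (fst x) (snd x)))"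
    by (simp add: prod.cartesian_product case_prod_beta)
  also have "\<dots> = (- 1) ^ card {x \<in> {..<d} \<times> {..<d}. P (fst x) (snd x)}"
    by (rule prod_sign_of) auto
  also have "{x \<in> {..<d} \<times> {..<d}. P (fst x) (snd x)} = {(r, s). r < d \<and> s < d \<and> P r s}"
    by auto
  finally show ?thesis .
qed

text \<open>Sign for multiplying two words factorwise: letter s of the second word passes letter r
  of the first when \<open>s < r\<close>. A product over all pairs, instead of -1 to a cardinality,
  lets sign identities be checked pair by pair.\<close>

definition ksgn :: "nat \<Rightarrow> (nat \<Rightarrow> bool) \<Rightarrow> (nat \<Rightarrow> bool) \<Rightarrow> 'a::comm_ring_1" where
  "ksgn d f g = (\<Prod>r<d. \<Prod>s<d. sign_of (s < r \<and> f r \<and> g s))"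

definition psgn :: "nat \<Rightarrow> (nat \<Rightarrow> nat) \<Rightarrow> (nat \<Rightarrow> bool) \<Rightarrow> 'a::comm_ring_1" where
  "psgn d \<tau> f = (\<Prod>r<d. \<Prod>s<d. sign_of (r < s \<and> \<tau> s < \<tau> r \<and> f (\<tau> r) \<and> f (\<tau> s)))"

lemma psgn_pinv: "(- 1) ^ pinv p \<tau> xs = psgn (length xs) \<tau> (\<lambda>r. p (xs ! r))"
  unfolding psgn_def prod2_sign_of pinv_def
  by (intro arg_cong[where f = "\<lambda>A. (- 1) ^ card A"]) auto

lemma ksgn_cong:
  assumes "\<And>r. r < d \<Longrightarrow> f r = f' r" "\<And>r. r < d \<Longrightarrow> g r = g' r"
  shows "ksgn d f g = ksgn d f' g'"
  unfolding ksgn_def by (intro prod.cong refl) (simp add: assms)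

lemma psgn_cong:
  assumes "\<tau> permutes {..<d}" "\<And>r. r < d \<Longrightarrow> f r = f' r"
  shows "psgn d \<tau> f = psgn d \<tau> f'"
proof -
  have "\<tau> r < d" if "r < d" for r
    using permutes_in_image[OF assms(1), of r] that by simp
  then show ?thesis
    unfolding psgn_def by (intro prod.cong refl) (simp add: assms)
qed

lemma ksgn_xor_left: "ksgn d (\<lambda>r. f r \<noteq> f' r) g = ksgn d f g * ksgn d f' g"
  unfolding ksgn_def prod.distrib[symmetric] by (intro prod.cong refl) (auto simp: sign_of_def)

lemma ksgn_xor_right: "ksgn d f (\<lambda>r. g r \<noteq> g' r) = ksgn d f g * ksgn d f g'"
  unfolding ksgn_def prod.distrib[symmetric] by (intro prod.cong refl) (auto simp: sign_of_def)

lemma ksgn_square: "ksgn d f g * ksgn d f g = 1"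
  unfolding ksgn_def prod.distrib[symmetric] by (intro prod.neutral ballI) (auto simp: sign_of_def)

lemma ksgn_even_left: "(\<And>r. r < d \<Longrightarrow> \<not> f r) \<Longrightarrow> ksgn d f g = 1"
  unfolding ksgn_def by (intro prod.neutral ballI) (auto simp: sign_of_def)

lemma ksgn_even_right: "(\<And>r. r < d \<Longrightarrow> \<not> g r) \<Longrightarrow> ksgn d f g = 1"
  unfolding ksgn_def by (intro prod.neutral ballI) (auto simp: sign_of_def)

lemma psgn_square: "psgn d \<tau> f * psgn d \<tau> f = 1"
  unfolding psgn_def prod.distrib[symmetric] by (intro prod.neutral ballI) (auto simp: sign_of_def)

lemma psgn_id: "psgn d id f = 1"
  unfolding psgn_def by (intro prod.neutral ballI) (auto simp: sign_of_def)

lemma prod2_permute: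
  fixes F :: "nat \<Rightarrow> nat \<Rightarrow> 'a::comm_monoid_mult"
  assumes "\<tau> permutes {..<d}"
  shows "(\<Prod>r<d. \<Prod>s<d. F (\<tau> r) (\<tau> s)) = (\<Prod>r<d. \<Prod>s<d. F r s)"
proof -
  have "(\<Prod>r<d. \<Prod>s<d. F r s) = (\<Prod>r<d. \<Prod>s<d. F r (\<tau> s))"
    by (rule prod.cong[OF refl]) (subst prod.permute[OF assms], simp add: o_def)
  also have "\<dots> = (\<Prod>r<d. \<Prod>s<d. F (\<tau> r) (\<tau> s))"
    by (subst prod.permute[OF assms]) (simp add: o_def)
  finally show ?thesis by simp
qed

lemma prod2_swap: "(\<Prod>r<d. \<Prod>s<d. F r s) = (\<Prod>r<d. \<Prod>s<d. F s r)"
  by (rule prod.swap)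

text \<open>Inversions for the combined parity split into four kinds. The two pure kinds give the
  signs of \<open>f\<close> and \<open>g\<close>; the two mixed kinds concern exactly the pairs
  reordered by \<open>\<tau>\<close>, and convert the order of the values \<open>\<tau> r\<close> in
  \<open>ksgn d f g\<close> into the order of the positions \<open>r\<close>.\<close>

lemma psgn_ksgn:
  assumes \<tau>: "\<tau> permutes {..<d}"
  shows "ksgn d (\<lambda>r. f (\<tau> r)) (\<lambda>r. g (\<tau> r)) * psgn d \<tau> f * psgn d \<tau> g
       = (ksgn d f g * psgn d \<tau> (\<lambda>r. f r \<noteq> g r) :: 'a::comm_ring_1)"
proof -
  let ?c = "\<lambda>r s. r < s \<and> \<tau> s < \<tau> r"
  have inj: "\<tau> r = \<tau> s \<longleftrightarrow> r = s" for r s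
    using permutes_inj[OF \<tau>] by (auto simp: inj_def)
  have "(psgn d \<tau> (\<lambda>r. f r \<noteq> g r) :: 'a)
      = psgn d \<tau> f * psgn d \<tau> g * (\<Prod>r<d. \<Prod>s<d. sign_of (?c r s \<and> f (\<tau> r) \<and> g (\<tau> s)))
        * (\<Prod>r<d. \<Prod>s<d. sign_of (?c r s \<and> g (\<tau> r) \<and> f (\<tau> s)))"
    unfolding psgn_def prod.distrib[symmetric]
    by (intro prod.cong refl) (auto simp: sign_of_def)
  also have "(\<Prod>r<d. \<Prod>s<d. sign_of (?c r s \<and> g (\<tau> r) \<and> f (\<tau> s)) :: 'a)
      = (\<Prod>r<d. \<Prod>s<d. sign_of (?c s r \<and> g (\<tau> s) \<and> f (\<tau> r)))"
    by (rule prod2_swap)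
  finally have 1: "(psgn d \<tau> (\<lambda>r. f r \<noteq> g r) :: 'a)
      = psgn d \<tau> f * psgn d \<tau> g * ((\<Prod>r<d. \<Prod>s<d. sign_of (?c r s \<and> f (\<tau> r) \<and> g (\<tau> s)))
        * (\<Prod>r<d. \<Prod>s<d. sign_of (?c s r \<and> g (\<tau> s) \<and> f (\<tau> r))))"
    by (simp add: mult.assoc)
  have 2: "(ksgn d f g :: 'a) = (\<Prod>r<d. \<Prod>s<d. sign_of (\<tau> s < \<tau> r \<and> f (\<tau> r) \<and> g (\<tau> s)))"
    unfolding ksgn_def by (rule prod2_permute[OF \<tau>, symmetric])
  have 3: "ksgn d f g * ((\<Prod>r<d. \<Prod>s<d. sign_of (?c r s \<and> f (\<tau> r) \<and> g (\<tau> s)))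
        * (\<Prod>r<d. \<Prod>s<d. sign_of (?c s r \<and> g (\<tau> s) \<and> f (\<tau> r))))
      = (ksgn d (\<lambda>r. f (\<tau> r)) (\<lambda>r. g (\<tau> r)) :: 'a)"
    unfolding 2 unfolding ksgn_def prod.distrib[symmetric]
  proof (intro prod.cong refl)
    fix r s
    show "sign_of (\<tau> s < \<tau> r \<and> f (\<tau> r) \<and> g (\<tau> s)) * (sign_of (?c r s \<and> f (\<tau> r) \<and> g (\<tau> s)) *
          sign_of (?c s r \<and> g (\<tau> s) \<and> f (\<tau> r))) = (sign_of (s < r \<and> f (\<tau> r) \<and> g (\<tau> s)) :: 'a)"
      using inj[of r s] by (cases r s rule: linorder_cases; cases "\<tau> r" "\<tau> s" rule: linorder_cases)
        (auto simp: sign_of_def)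
  qed
  show ?thesis unfolding 1 by (simp add: 3[symmetric] mult_ac)
qed

text \<open>Reindexing by a permutation destroys a condition \<open>r < s\<close>; folding both
  orders of a pair together restores a common index set.\<close>

lemma prod2_symmetrize:
  fixes F :: "nat \<Rightarrow> nat \<Rightarrow> 'a::comm_monoid_mult"
  assumes "\<And>r. F r r = 1"
  shows "(\<Prod>r<d. \<Prod>s<d. F r s) = (\<Prod>r<d. \<Prod>s<d. if r < s then F r s * F s r else 1)"
proof -
  have "(\<Prod>r<d. \<Prod>s<d. F r s)
      = (\<Prod>r<d. \<Prod>s<d. if r < s then F r s else 1) * (\<Prod>r<d. \<Prod>s<d. if s < r then F r s else 1)"
    unfolding prod.distrib[symmetric]
    by (intro prod.cong refl) (use assms in \<open>auto simp: not_less_iff_gr_or_eq\<close>)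
  also have "(\<Prod>r<d. \<Prod>s<d. if s < r then F r s else 1) = (\<Prod>r<d. \<Prod>s<d. if r < s then F s r else 1)"
    by (rule prod2_swap)
  finally show ?thesis
    unfolding prod.distrib[symmetric] by (auto intro!: prod.cong)
qed

text \<open>A pair is inverted by the composite exactly when one of the two stages inverts it; a
  pair inverted at both stages contributes two factors -1.\<close>

lemma psgn_comp:
  assumes \<sigma>: "\<sigma> permutes {..<d}" and \<tau>: "\<tau> permutes {..<d}"
  shows "psgn d (\<tau> \<circ> \<sigma>) f = (psgn d \<tau> f * psgn d \<sigma> (\<lambda>r. f (\<tau> r)) :: 'a::comm_ring_1)"
proof -
  let ?X = "\<lambda>r. f (\<tau> (\<sigma> r))"
  have inj: "\<sigma> r = \<sigma> s \<longleftrightarrow> r = s" for r s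
    using permutes_inj[OF \<sigma>] by (auto simp: inj_def)
  have inj': "\<tau> r = \<tau> s \<longleftrightarrow> r = s" for r s
    using permutes_inj[OF \<tau>] by (auto simp: inj_def)
  have "(psgn d \<tau> f :: 'a)
      = (\<Prod>r<d. \<Prod>s<d. sign_of (\<sigma> r < \<sigma> s \<and> \<tau> (\<sigma> s) < \<tau> (\<sigma> r) \<and> ?X r \<and> ?X s))"
    unfolding psgn_def by (rule prod2_permute[OF \<sigma>, symmetric])
  also have "\<dots> = (\<Prod>r<d. \<Prod>s<d. if r < s
      then sign_of (\<sigma> r < \<sigma> s \<and> \<tau> (\<sigma> s) < \<tau> (\<sigma> r) \<and> ?X r \<and> ?X s) *
           sign_of (\<sigma> s < \<sigma> r \<and> \<tau> (\<sigma> r) < \<tau> (\<sigma> s) \<and> ?X s \<and> ?X r) else 1)"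
    by (rule prod2_symmetrize) (simp add: sign_of_def)
  finally have 1: "(psgn d \<tau> f :: 'a) = \<dots>" .
  show ?thesis
    unfolding 1 unfolding psgn_def prod.distrib[symmetric]
  proof (intro prod.cong refl)
    fix r s
    show "sign_of (r < s \<and> (\<tau> \<circ> \<sigma>) s < (\<tau> \<circ> \<sigma>) r \<and> f ((\<tau> \<circ> \<sigma>) r) \<and> f ((\<tau> \<circ> \<sigma>) s)) =
      (if r < s then sign_of (\<sigma> r < \<sigma> s \<and> \<tau> (\<sigma> s) < \<tau> (\<sigma> r) \<and> ?X r \<and> ?X s) *
           sign_of (\<sigma> s < \<sigma> r \<and> \<tau> (\<sigma> r) < \<tau> (\<sigma> s) \<and> ?X s \<and> ?X r) else 1) *
      (sign_of (r < s \<and> \<sigma> s < \<sigma> r \<and> ?X (r) \<and> ?X s) :: 'a)"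
      using inj[of r s] inj'[of "\<sigma> r" "\<sigma> s"]
      by (cases "\<sigma> r" "\<sigma> s" rule: linorder_cases;
          cases "\<tau> (\<sigma> r)" "\<tau> (\<sigma> s)" rule: linorder_cases) (auto simp: sign_of_def)
  qed
qed

section \<open>Tensor products of structure constants\<close>

definition tuples :: "'x set \<Rightarrow> nat \<Rightarrow> 'x list set" where
  "tuples S d = {xs. set xs \<subseteq> S \<and> length xs = d}"

lemma finite_tuples: "finite S \<Longrightarrow> finite (tuples S d)"
  unfolding tuples_def by (rule finite_lists_length_eq)

lemma tuples_length: "xs \<in> tuples S d \<Longrightarrow> length xs = d"
  by (simp add: tuples_def)

lemma tuples_nth: "xs \<in> tuples S d \<Longrightarrow> r < d \<Longrightarrow> xs ! r \<in> S"
  using nth_mem by (fastforce simp: tuples_def)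

lemma tuples_I: "length xs = d \<Longrightarrow> (\<And>r. r < d \<Longrightarrow> xs ! r \<in> S) \<Longrightarrow> xs \<in> tuples S d"
  by (auto simp: tuples_def in_set_conv_nth)

lemma tuples_Suc: "tuples S (Suc d) = (\<lambda>(x, xs). x # xs) ` (S \<times> tuples S d)"
  by (auto simp: tuples_def image_iff length_Suc_conv)

lemma sum_tuples_prod:
  fixes F :: "nat \<Rightarrow> 'x \<Rightarrow> 'a::comm_ring_1"
  shows "(\<Sum>xs\<in>tuples S d. \<Prod>r<d. F r (xs ! r)) = (\<Prod>r<d. \<Sum>x\<in>S. F r x)"
proof (induction d arbitrary: F)
  case 0
  have "tuples S 0 = {[]}" by (auto simp: tuples_def)
  then show ?case by simp
next
  case (Suc d)
  have inj: "inj_on (\<lambda>(x, xs). x # xs) (S \<times> tuples S d)" by (auto simp: inj_on_def)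
  have "(\<Sum>xs\<in>tuples S (Suc d). \<Prod>r<Suc d. F r (xs ! r))
      = (\<Sum>(x, xs)\<in>S \<times> tuples S d. F 0 x * (\<Prod>r<d. F (Suc r) (xs ! r)))"
    unfolding tuples_Suc sum.reindex[OF inj]
    by (intro sum.cong refl) (auto simp: prod.lessThan_Suc_shift simp del: prod.lessThan_Suc)
  also have "\<dots> = (\<Sum>x\<in>S. F 0 x) * (\<Sum>xs\<in>tuples S d. \<Prod>r<d. F (Suc r) (xs ! r))"
    by (simp add: sum.cartesian_product[symmetric] sum_product)
  also have "\<dots> = (\<Prod>r<Suc d. \<Sum>x\<in>S. F r x)"
    by (simp add: Suc.IH[of "\<lambda>r. F (Suc r)"] prod.lessThan_Suc_shift del: prod.lessThan_Suc)
  finally show ?case .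
qed

text \<open>Structure constants of the tensor power of a bilinear map with coefficients
  \<open>M\<close>. Three index types let one definition serve the product of the tensor power of A,
  its right action and the left action of matrices.\<close>

definition tensor_coeff :: "('x \<Rightarrow> bool) \<Rightarrow> ('y \<Rightarrow> bool) \<Rightarrow> ('x \<Rightarrow> 'y \<Rightarrow> 'z \<Rightarrow> 'a::comm_ring_1)
    \<Rightarrow> 'x list \<Rightarrow> 'y list \<Rightarrow> 'z list \<Rightarrow> 'a" where
  "tensor_coeff px py M xs ys zs = ksgn (length xs) (\<lambda>r. px (xs ! r)) (\<lambda>r. py (ys ! r))
      * (\<Prod>r<length xs. M (xs ! r) (ys ! r) (zs ! r))"

definition parity_additive :: "('x \<Rightarrow> bool) \<Rightarrow> ('y \<Rightarrow> bool) \<Rightarrow> ('z \<Rightarrow> bool) \<Rightarrow> ('x \<Rightarrow> 'y \<Rightarrow> 'z \<Rightarrow> 'a::zero) \<Rightarrow> bool" where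
  "parity_additive px py pz M \<longleftrightarrow> (\<forall>x y z. M x y z \<noteq> 0 \<longrightarrow> pz z = (px x \<noteq> py y))"

text \<open>If the product vanishes its sign is irrelevant; otherwise the parities of the output
  letters are determined. This dichotomy lets signs be pulled out of sums over intermediate
  words.\<close>

lemma tensor_coeff_cases:
  fixes M :: "'x \<Rightarrow> 'y \<Rightarrow> 'z \<Rightarrow> 'a::comm_ring_1"
  assumes "parity_additive px py pz M"
  obtains "(\<Prod>r<length xs. M (xs ! r) (ys ! r) (zs ! r)) = 0"
  | "\<And>r. r < length xs \<Longrightarrow> pz (zs ! r) = (px (xs ! r) \<noteq> py (ys ! r))"
proof (cases "\<forall>r<length xs. M (xs ! r) (ys ! r) (zs ! r) \<noteq> 0")
  case True
  then show ?thesis using assms that(2) unfolding parity_additive_def by blast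
next
  case False
  then have "(\<Prod>r<length xs. M (xs ! r) (ys ! r) (zs ! r)) = 0"
    by (intro prod_zero) auto
  then show ?thesis by (rule that(1))
qed

text \<open>On nonzero terms the parity of \<open>ws\<close> is the sum of those of
  \<open>xs\<close> and \<open>ys\<close>, so the sign is a product over the three pairs of outer
  words. It does not depend on \<open>ws\<close> and is the same for the other bracketing.\<close>

lemma sum_tensor_coeff_tensor_coeff_left:
  fixes M1 :: "'x \<Rightarrow> 'y \<Rightarrow> 'w \<Rightarrow> 'a::comm_ring_1"
  assumes "parity_additive px py pw M1" and xs: "length xs = d"
  shows "(\<Sum>ws\<in>tuples S d. tensor_coeff px py M1 xs ys ws * tensor_coeff pw pz M2 ws zs os)
    = ksgn d (\<lambda>r. px (xs ! r)) (\<lambda>r. py (ys ! r)) * ksgn d (\<lambda>r. px (xs ! r)) (\<lambda>r. pz (zs ! r))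
      * ksgn d (\<lambda>r. py (ys ! r)) (\<lambda>r. pz (zs ! r))
      * (\<Prod>r<d. \<Sum>w\<in>S. M1 (xs ! r) (ys ! r) w * M2 w (zs ! r) (os ! r))" (is "_ = ?k * _")
  unfolding sum_tuples_prod[symmetric] sum_distrib_left
proof (rule sum.cong[OF refl])
  fix ws assume ws: "ws \<in> tuples S d"
  show "tensor_coeff px py M1 xs ys ws * tensor_coeff pw pz M2 ws zs os
      = ?k * (\<Prod>r<d. M1 (xs ! r) (ys ! r) (ws ! r) * M2 (ws ! r) (zs ! r) (os ! r))"
  proof (cases rule: tensor_coeff_cases[OF assms(1), of xs ys ws])
    case 1
    then show ?thesis by (simp add: tensor_coeff_def prod.distrib xs)
  next
    case 2
    have "(ksgn d (\<lambda>r. pw (ws ! r)) (\<lambda>r. pz (zs ! r)) :: 'a)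
        = ksgn d (\<lambda>r. px (xs ! r) \<noteq> py (ys ! r)) (\<lambda>r. pz (zs ! r))"
      by (rule ksgn_cong) (use 2 xs in auto)
    then show ?thesis
      unfolding tensor_coeff_def prod.distrib xs tuples_length[OF ws] ksgn_xor_left by (simp only: mult_ac)
  qed
qed

lemma sum_tensor_coeff_tensor_coeff_right:
  fixes M3 :: "'y \<Rightarrow> 'z \<Rightarrow> 'w \<Rightarrow> 'a::comm_ring_1"
  assumes "parity_additive py pz pw M3" and xs: "length xs = d" and ys: "length ys = d"
  shows "(\<Sum>ws\<in>tuples S d. tensor_coeff py pz M3 ys zs ws * tensor_coeff px pw M4 xs ws os)
    = ksgn d (\<lambda>r. px (xs ! r)) (\<lambda>r. py (ys ! r)) * ksgn d (\<lambda>r. px (xs ! r)) (\<lambda>r. pz (zs ! r))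
      * ksgn d (\<lambda>r. py (ys ! r)) (\<lambda>r. pz (zs ! r))
      * (\<Prod>r<d. \<Sum>w\<in>S. M3 (ys ! r) (zs ! r) w * M4 (xs ! r) w (os ! r))" (is "_ = ?k * _")
  unfolding sum_tuples_prod[symmetric] sum_distrib_left
proof (rule sum.cong[OF refl])
  fix ws assume ws: "ws \<in> tuples S d"
  show "tensor_coeff py pz M3 ys zs ws * tensor_coeff px pw M4 xs ws os
      = ?k * (\<Prod>r<d. M3 (ys ! r) (zs ! r) (ws ! r) * M4 (xs ! r) (ws ! r) (os ! r))"
  proof (cases rule: tensor_coeff_cases[OF assms(1), of ys zs ws])
    case 1
    then show ?thesis by (simp add: tensor_coeff_def prod.distrib ys)
  next
    case 2
    have "(ksgn d (\<lambda>r. px (xs ! r)) (\<lambda>r. pw (ws ! r)) :: 'a)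
        = ksgn d (\<lambda>r. px (xs ! r)) (\<lambda>r. py (ys ! r) \<noteq> pz (zs ! r))"
      by (rule ksgn_cong) (use 2 ys in auto)
    then show ?thesis
      unfolding tensor_coeff_def prod.distrib xs ys ksgn_xor_right by (simp only: mult_ac)
  qed
qed

lemma tensor_coeff_assoc:
  assumes "parity_additive px py pw M1" "parity_additive py pz pw' M3" "length xs = d" "length ys = d"
    and "\<And>r. r < d \<Longrightarrow> (\<Sum>w\<in>S. M1 (xs ! r) (ys ! r) w * M2 w (zs ! r) (os ! r))
                    = (\<Sum>w\<in>S'. M3 (ys ! r) (zs ! r) w * M4 (xs ! r) w (os ! r))"
  shows "(\<Sum>ws\<in>tuples S d. tensor_coeff px py M1 xs ys ws * tensor_coeff pw pz M2 ws zs os)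
       = (\<Sum>ws\<in>tuples S' d. tensor_coeff py pz M3 ys zs ws * tensor_coeff px pw' M4 xs ws os)"
  unfolding sum_tensor_coeff_tensor_coeff_left[OF assms(1,3)] sum_tensor_coeff_tensor_coeff_right[OF assms(2,3,4)]
  by (simp add: assms(5))

text \<open>Nonzero coefficients of \<open>u\<close> sit on even letters, for which every Koszul
  sign is 1.\<close>

lemma sum_unit_ksgn:
  fixes u :: "'x \<Rightarrow> 'a::comm_ring_1"
  assumes "\<And>x. u x \<noteq> 0 \<Longrightarrow> \<not> p x"
  shows "(\<Sum>us\<in>tuples S d. (\<Prod>r<d. u (us ! r)) * (ksgn d (\<lambda>r. p (us ! r)) g * (\<Prod>r<d. F r (us ! r))))
       = (\<Prod>r<d. \<Sum>x\<in>S. u x * F r x)" (is ?L)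
    and "(\<Sum>us\<in>tuples S d. (\<Prod>r<d. u (us ! r)) * (ksgn d g (\<lambda>r. p (us ! r)) * (\<Prod>r<d. F r (us ! r))))
       = (\<Prod>r<d. \<Sum>x\<in>S. u x * F r x)" (is ?R)
proof -
  have *: "(\<Prod>r<d. u (us ! r)) = 0 \<or> (\<forall>r<d. \<not> p (us ! r))" for us
  proof (cases "\<forall>r<d. u (us ! r) \<noteq> 0")
    case False
    then have "(\<Prod>r<d. u (us ! r)) = 0" by (intro prod_zero) auto
    then show ?thesis ..
  qed (use assms in blast)
  have "(\<Prod>r<d. u (us ! r)) * (ksgn d (\<lambda>r. p (us ! r)) g * (\<Prod>r<d. F r (us ! r)))
      = (\<Prod>r<d. u (us ! r) * F r (us ! r))" for us
    using *[of us] by (auto simp: prod.distrib ksgn_even_left)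
  then show ?L by (simp add: sum_tuples_prod[where F = "\<lambda>r x. u x * F r x"])
  have "(\<Prod>r<d. u (us ! r)) * (ksgn d g (\<lambda>r. p (us ! r)) * (\<Prod>r<d. F r (us ! r)))
      = (\<Prod>r<d. u (us ! r) * F r (us ! r))" for us
    using *[of us] by (auto simp: prod.distrib ksgn_even_right)
  then show ?R by (simp add: sum_tuples_prod[where F = "\<lambda>r x. u x * F r x"])
qed

lemma prod_delta_list:
  assumes "length xs = d" "length ys = d"
  shows "(\<Prod>r<d. if xs ! r = ys ! r then 1 else 0 :: 'a::comm_ring_1) = (if xs = ys then 1 else 0)"
proof (cases "xs = ys")
  case False
  then obtain r where "r < d" "xs ! r \<noteq> ys ! r"
    using assms by (auto simp: list_eq_iff_nth_eq)
  then have "(\<Prod>r<d. if xs ! r = ys ! r then 1 else 0 :: 'a) = 0"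
    by (intro prod_zero) auto
  then show ?thesis using False by simp
qed simp

section \<open>Place permutations of words and their signs\<close>

lemma length_plist [simp]: "length (plist \<tau> xs) = length xs"
  by (simp add: plist_def)

lemma nth_plist: "r < length xs \<Longrightarrow> plist \<tau> xs ! r = xs ! \<tau> r"
  by (simp add: plist_def)

lemma permutes_less: "\<tau> permutes {..<d} \<Longrightarrow> r < d \<Longrightarrow> \<tau> r < (d::nat)"
  using permutes_in_image[of \<tau> "{..<d}" r] by simp

lemma plist_tuples: "\<tau> permutes {..<d} \<Longrightarrow> xs \<in> tuples S d \<Longrightarrow> plist \<tau> xs \<in> tuples S d"
  unfolding tuples_def plist_def using permutes_less nth_mem by fastforce

lemma plist_plist:
  assumes "\<sigma> permutes {..<length xs}"
  shows "plist \<sigma> (plist \<tau> xs) = plist (\<tau> \<circ> \<sigma>) xs"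
  by (rule nth_equalityI) (simp_all add: nth_plist permutes_less[OF assms])

lemma plist_id: "plist id xs = xs"
  by (rule nth_equalityI) (simp_all add: nth_plist)

lemma plist_inv:
  assumes "\<tau> permutes {..<length xs}"
  shows "plist (inv \<tau>) (plist \<tau> xs) = xs" "plist \<tau> (plist (inv \<tau>) xs) = xs"
  using plist_plist[OF permutes_inv[OF assms], of \<tau>] plist_plist[OF assms, of "inv \<tau>"]
  by (simp_all add: permutes_inv_o[OF assms] plist_id)

lemma bij_plist:
  assumes "\<tau> permutes {..<d}"
  shows "bij_betw (plist \<tau>) (tuples S d) (tuples S d)"
  by (rule bij_betw_byWitness[where f' = "plist (inv \<tau>)"])
    (auto simp: tuples_length plist_inv assms plist_tuples permutes_inv)

definition lsgn :: "('x \<Rightarrow> bool) \<Rightarrow> (nat \<Rightarrow> nat) \<Rightarrow> 'x list \<Rightarrow> 'a::comm_ring_1" where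
  "lsgn p \<tau> xs = psgn (length xs) \<tau> (\<lambda>r. p (xs ! r))"

lemma lsgn_id: "lsgn p id xs = 1"
  by (simp add: lsgn_def psgn_id)

lemma lsgn_comp:
  assumes "\<sigma> permutes {..<length xs}" "\<tau> permutes {..<length xs}"
  shows "lsgn p (\<tau> \<circ> \<sigma>) xs = (lsgn p \<tau> xs * lsgn p \<sigma> (plist \<tau> xs) :: 'a::comm_ring_1)"
proof -
  have "(psgn (length xs) \<sigma> (\<lambda>r. p (plist \<tau> xs ! r)) :: 'a) = psgn (length xs) \<sigma> (\<lambda>r. p (xs ! \<tau> r))"
    by (rule psgn_cong[OF assms(1)]) (simp add: nth_plist)
  then show ?thesis by (simp add: lsgn_def psgn_comp[OF assms])
qed

text \<open>The unsigned product is merely reindexed by \<open>\<tau>\<close>, and the output parity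
  is the sum of the two input parities, so everything reduces to \<open>psgn_ksgn\<close>. This is
  the source of the commutation rules between place permutations and multiplication
  operators.\<close>

lemma tensor_coeff_plist:
  fixes M :: "'x \<Rightarrow> 'y \<Rightarrow> 'z \<Rightarrow> 'a::comm_ring_1"
  assumes parity_additive: "parity_additive px py pz M" and \<tau>: "\<tau> permutes {..<d}"
    and xs: "length xs = d" and ys: "length ys = d" and zs: "length zs = d"
  shows "lsgn px \<tau> xs * lsgn py \<tau> ys * tensor_coeff px py M (plist \<tau> xs) (plist \<tau> ys) (plist \<tau> zs)
       = tensor_coeff px py M xs ys zs * lsgn pz \<tau> zs"
proof -
  have "(\<Prod>r<d. M (plist \<tau> xs ! r) (plist \<tau> ys ! r) (plist \<tau> zs ! r))
      = (\<Prod>r<d. M (xs ! \<tau> r) (ys ! \<tau> r) (zs ! \<tau> r))"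
    by (rule prod.cong) (simp_all add: nth_plist xs ys zs)
  also have "\<dots> = (\<Prod>r<d. M (xs ! r) (ys ! r) (zs ! r))"
    by (rule sym, subst prod.permute[OF \<tau>]) (simp add: o_def)
  finally have p: "(\<Prod>r<d. M (plist \<tau> xs ! r) (plist \<tau> ys ! r) (plist \<tau> zs ! r)) = \<dots>" .
  have k: "(ksgn d (\<lambda>r. px (plist \<tau> xs ! r)) (\<lambda>r. py (plist \<tau> ys ! r)) :: 'a)
      = ksgn d (\<lambda>r. px (xs ! \<tau> r)) (\<lambda>r. py (ys ! \<tau> r))"
    by (rule ksgn_cong) (simp_all add: nth_plist xs ys)
  show ?thesis
  proof (cases rule: tensor_coeff_cases[OF parity_additive, of xs ys zs])
    case 1
    then show ?thesis by (simp add: tensor_coeff_def xs p)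
  next
    case 2
    have "(lsgn pz \<tau> zs :: 'a) = psgn d \<tau> (\<lambda>r. px (xs ! r) \<noteq> py (ys ! r))"
      unfolding lsgn_def zs by (rule psgn_cong[OF \<tau>]) (use 2 xs in auto)
    note z = this
    note e = psgn_ksgn[OF \<tau>, of "\<lambda>r. px (xs ! r)" "\<lambda>r. py (ys ! r)", where 'a = 'a]
    have "lsgn px \<tau> xs * lsgn py \<tau> ys * tensor_coeff px py M (plist \<tau> xs) (plist \<tau> ys) (plist \<tau> zs)
        = (ksgn d (\<lambda>r. px (xs ! \<tau> r)) (\<lambda>r. py (ys ! \<tau> r)) * psgn d \<tau> (\<lambda>r. px (xs ! r))
          * psgn d \<tau> (\<lambda>r. py (ys ! r))) * (\<Prod>r<d. M (xs ! r) (ys ! r) (zs ! r))"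
      unfolding tensor_coeff_def length_plist xs p k lsgn_def ys by (simp only: mult_ac)
    also have "\<dots> = tensor_coeff px py M xs ys zs * lsgn pz \<tau> zs"
      unfolding e z tensor_coeff_def xs by (simp only: mult_ac)
    finally show ?thesis .
  qed
qed

section \<open>The Casimir element of the regular trace form\<close>

definition reg_trace :: "'x set \<Rightarrow> ('x \<Rightarrow> 'x \<Rightarrow> 'x \<Rightarrow> 'a::comm_ring_1) \<Rightarrow> 'x \<Rightarrow> 'a" where
  "reg_trace X c a = (\<Sum>y\<in>X. c a y y)"

text \<open>Gram matrix of the form whose value on a pair is the ordinary trace of left
  multiplication by the product.\<close>

definition gram :: "'x set \<Rightarrow> ('x \<Rightarrow> 'x \<Rightarrow> 'x \<Rightarrow> 'a::comm_ring_1) \<Rightarrow> 'x \<Rightarrow> 'x \<Rightarrow> 'a" where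
  "gram X c a b = (\<Sum>w\<in>X. c a b w * reg_trace X c w)"

definition assoc_on :: "'x set \<Rightarrow> ('x \<Rightarrow> 'x \<Rightarrow> 'x \<Rightarrow> 'a::comm_ring_1) \<Rightarrow> bool" where
  "assoc_on X c \<longleftrightarrow> (\<forall>x\<in>X. \<forall>y\<in>X. \<forall>z\<in>X. \<forall>v\<in>X.
     (\<Sum>w\<in>X. c x y w * c w z v) = (\<Sum>w\<in>X. c y z w * c x w v))"

text \<open>By associativity both sides are traces of a product of two left multiplications, and
  such a trace does not depend on the order.\<close>

lemma gram_sym:
  assumes "assoc_on X c" "a \<in> X" "b \<in> X"
  shows "gram X c a b = gram X c b a"
proof -
  have *: "gram X c a b = (\<Sum>y\<in>X. \<Sum>w\<in>X. c b y w * c a w y)" if "a \<in> X" "b \<in> X" for a b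
  proof -
    have "gram X c a b = (\<Sum>y\<in>X. \<Sum>w\<in>X. c a b w * c w y y)"
      unfolding gram_def reg_trace_def sum_distrib_left by (rule sum.swap)
    also have "\<dots> = (\<Sum>y\<in>X. \<Sum>w\<in>X. c b y w * c a w y)"
      by (rule sum.cong[OF refl]) (use assms(1) that in \<open>unfold assoc_on_def, blast\<close>)
    finally show ?thesis .
  qed
  show ?thesis unfolding *[OF assms(2,3)] *[OF assms(3,2)]
    by (subst sum.swap) (simp add: mult.commute)
qed

text \<open>Both sides are the trace of left multiplication by the triple product xyz; this is
  invariance of the form.\<close>

lemma gram_assoc:
  assumes "assoc_on X c" "x \<in> X" "y \<in> X" "z \<in> X"
  shows "(\<Sum>w\<in>X. c x y w * gram X c w z) = (\<Sum>w\<in>X. c y z w * gram X c x w)"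
proof -
  have "(\<Sum>w\<in>X. c x y w * gram X c w z) = (\<Sum>v\<in>X. (\<Sum>w\<in>X. c x y w * c w z v) * reg_trace X c v)"
    unfolding gram_def sum_distrib_left sum_distrib_right by (subst sum.swap) (simp add: mult.assoc)
  also have "\<dots> = (\<Sum>v\<in>X. (\<Sum>w\<in>X. c y z w * c x w v) * reg_trace X c v)"
    using assms unfolding assoc_on_def by simp
  also have "\<dots> = (\<Sum>w\<in>X. c y z w * gram X c x w)"
    unfolding gram_def sum_distrib_left sum_distrib_right by (subst sum.swap) (simp add: mult.assoc)
  finally show ?thesis .
qed

lemma sum_mult_delta:
  fixes f :: "'x \<Rightarrow> 'a::comm_ring_1"
  assumes "finite X" "a \<in> X"
  shows "(\<Sum>x\<in>X. f x * (if x = a then 1 else 0)) = f a"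
    and "(\<Sum>x\<in>X. f x * (if a = x then 1 else 0)) = f a"
    and "(\<Sum>x\<in>X. (if x = a then 1 else 0) * f x) = f a"
    and "(\<Sum>x\<in>X. (if a = x then 1 else 0) * f x) = f a"
  using assms by (simp_all add: if_distrib[of "\<lambda>y. y * _"] if_distrib[of "\<lambda>y. _ * y"] cong: if_cong)

text \<open>Write G for the Gram matrix and g' for the transpose of \<open>g\<close>. Symmetry of G
  makes g' G the transpose of G g = 1, so g' = g' G g = g. Transposing G g = 1 then gives the left
  inverse without a rank argument.\<close>

lemma gram_left_inverse:
  assumes fin: "finite X" and as: "assoc_on X c"
    and g: "\<And>x z. x \<in> X \<Longrightarrow> z \<in> X \<Longrightarrow> (\<Sum>y\<in>X. gram X c x y * g y z) = (if x = z then 1 else 0)"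
    and x: "x \<in> X" and z: "z \<in> X"
  shows "(\<Sum>y\<in>X. g x y * gram X c y z) = (if x = z then 1 else 0 :: 'a::comm_ring_1)"
proof -
  have gs: "g a b = g b a" if a: "a \<in> X" and b: "b \<in> X" for a b
  proof -
    have "g b a = (\<Sum>x\<in>X. g x a * (if x = b then 1 else 0))"
      by (simp only: sum_mult_delta(1)[OF fin b])
    also have "\<dots> = (\<Sum>x\<in>X. g x a * (\<Sum>y\<in>X. gram X c x y * g y b))"
      using g b by simp
    also have "\<dots> = (\<Sum>y\<in>X. (\<Sum>x\<in>X. gram X c y x * g x a) * g y b)"
      unfolding sum_distrib_left sum_distrib_right
      by (subst sum.swap) (intro sum.cong refl, simp add: gram_sym[OF as] mult_ac)
    also have "\<dots> = (\<Sum>y\<in>X. (if y = a then 1 else 0) * g y b)"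
      using g a by simp
    also have "\<dots> = g a b"
      by (simp only: sum_mult_delta(3)[OF fin a])
    finally show ?thesis by simp
  qed
  have "(\<Sum>y\<in>X. g x y * gram X c y z) = (\<Sum>y\<in>X. gram X c z y * g y x)"
    using x z by (intro sum.cong refl) (simp add: gs[of x] gram_sym[OF as, of z] mult.commute)
  then show ?thesis using g[OF z x] by auto
qed

text \<open>Pairing the second leg with any w turns both sides into the coefficient of
  \<open>x'\<close> in zw, and this pairing is invertible. The identity says that the Casimir
  element, the tensor with coefficients \<open>g\<close>, commutes with z.\<close>

lemma casimir_central:
  fixes c :: "'x \<Rightarrow> 'x \<Rightarrow> 'x \<Rightarrow> 'a::comm_ring_1"
  assumes fin: "finite X" and as: "assoc_on X c"
    and g: "\<And>x z. x \<in> X \<Longrightarrow> z \<in> X \<Longrightarrow> (\<Sum>y\<in>X. gram X c x y * g y z) = (if x = z then 1 else 0)"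
    and z: "z \<in> X" and x': "x' \<in> X" and y: "y \<in> X"
  shows "(\<Sum>x\<in>X. c z x x' * g x y) = (\<Sum>y'\<in>X. g x' y' * c y' z y)"
proof -
  define F1 F2 where "F1 y = (\<Sum>x\<in>X. c z x x' * g x y)"
    and "F2 y = (\<Sum>y'\<in>X. g x' y' * c y' z y)" for y
  note g' = gram_left_inverse[OF fin as g]
  have 1: "(\<Sum>y\<in>X. F1 y * gram X c y w) = c z w x'" if w: "w \<in> X" for w
  proof -
    have "(\<Sum>y\<in>X. F1 y * gram X c y w) = (\<Sum>x\<in>X. c z x x' * (\<Sum>y\<in>X. g x y * gram X c y w))"
      unfolding F1_def sum_distrib_left sum_distrib_right by (subst sum.swap) (simp add: mult.assoc)
    also have "\<dots> = (\<Sum>x\<in>X. c z x x' * (if x = w then 1 else 0))"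
      using g' w by simp
    finally show ?thesis by (simp only: sum_mult_delta(1)[OF fin w])
  qed
  have 2: "(\<Sum>y\<in>X. F2 y * gram X c y w) = c z w x'" if w: "w \<in> X" for w
  proof -
    have "(\<Sum>y\<in>X. F2 y * gram X c y w) = (\<Sum>y'\<in>X. g x' y' * (\<Sum>y\<in>X. c y' z y * gram X c y w))"
      unfolding F2_def sum_distrib_left sum_distrib_right by (subst sum.swap) (simp add: mult.assoc)
    also have "\<dots> = (\<Sum>y'\<in>X. g x' y' * (\<Sum>v\<in>X. c z w v * gram X c y' v))"
      by (intro sum.cong refl) (simp add: gram_assoc[OF as _ z w])
    also have "\<dots> = (\<Sum>v\<in>X. c z w v * (\<Sum>y'\<in>X. g x' y' * gram X c y' v))"
      unfolding sum_distrib_left by (subst sum.swap) (simp add: mult_ac)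
    also have "\<dots> = (\<Sum>v\<in>X. c z w v * (if x' = v then 1 else 0))"
      using g' x' by simp
    finally show ?thesis by (simp only: sum_mult_delta(2)[OF fin x'])
  qed
  have cancel: "F y = (\<Sum>w\<in>X. (\<Sum>v\<in>X. F v * gram X c v w) * g w y)" for F
  proof -
    have "(\<Sum>w\<in>X. (\<Sum>v\<in>X. F v * gram X c v w) * g w y)
        = (\<Sum>v\<in>X. F v * (\<Sum>w\<in>X. gram X c v w * g w y))"
      unfolding sum_distrib_left sum_distrib_right by (subst sum.swap) (simp add: mult.assoc)
    also have "\<dots> = (\<Sum>v\<in>X. F v * (if v = y then 1 else 0))"
      using g y by simp
    also have "\<dots> = F y"
      by (simp only: sum_mult_delta(1)[OF fin y])
    finally show ?thesis by simp
  qed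
  have "F1 y = F2 y"
    unfolding cancel[of F1] cancel[of F2] using 1 2 by simp
  then show ?thesis by (simp add: F1_def F2_def)
qed

text \<open>With respect to the regular trace form, \<open>reg_trace a = \<Sum> \<langle>y\<^sub>i, a x\<^sub>i\<rangle> = reg_trace (a z)\<close> where
  \<open>z = \<Sum> x\<^sub>i y\<^sub>i\<close> is formed from dual bases, so nondegeneracy forces \<open>z = 1\<close>.\<close>

lemma casimir_unit:
  fixes c :: "'x \<Rightarrow> 'x \<Rightarrow> 'x \<Rightarrow> 'a::comm_ring_1"
  assumes fin: "finite X" and as: "assoc_on X c"
    and g: "\<And>x z. x \<in> X \<Longrightarrow> z \<in> X \<Longrightarrow> (\<Sum>y\<in>X. gram X c x y * g y z) = (if x = z then 1 else 0)"
    and unit: "\<And>a v. a \<in> X \<Longrightarrow> v \<in> X \<Longrightarrow> (\<Sum>w\<in>X. e w * c a w v) = (if a = v then 1 else 0)"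
    and w: "w \<in> X"
  shows "(\<Sum>x\<in>X. \<Sum>y\<in>X. g x y * c x y w) = e w"
proof -
  define z where "z w = (\<Sum>x\<in>X. \<Sum>y\<in>X. g x y * c x y w)" for w
  note g' = gram_left_inverse[OF fin as g]
  have 1: "(\<Sum>w\<in>X. gram X c a w * z w) = reg_trace X c a" if a: "a \<in> X" for a
  proof -
    have "(\<Sum>w\<in>X. gram X c a w * z w)
        = (\<Sum>x\<in>X. \<Sum>w\<in>X. \<Sum>y\<in>X. gram X c a w * (g x y * c x y w))"
      unfolding z_def sum_distrib_left by (rule sum.swap)
    also have "\<dots> = (\<Sum>x\<in>X. \<Sum>y\<in>X. g x y * (\<Sum>w\<in>X. c x y w * gram X c a w))"
      unfolding sum_distrib_left by (rule sum.cong[OF refl], subst sum.swap) (simp add: mult_ac)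
    also have "\<dots> = (\<Sum>x\<in>X. \<Sum>y\<in>X. g x y * (\<Sum>v\<in>X. c a x v * gram X c y v))"
    proof (intro sum.cong[OF refl])
      fix x y assume x: "x \<in> X" and y: "y \<in> X"
      have "(\<Sum>w\<in>X. c x y w * gram X c a w) = (\<Sum>v\<in>X. c a x v * gram X c v y)"
        by (rule gram_assoc[OF as a x y, symmetric])
      also have "\<dots> = (\<Sum>v\<in>X. c a x v * gram X c y v)"
        using gram_sym[OF as _ y] by simp
      finally show "g x y * (\<Sum>w\<in>X. c x y w * gram X c a w)
          = g x y * (\<Sum>v\<in>X. c a x v * gram X c y v)" by simp
    qed
    also have "\<dots> = (\<Sum>x\<in>X. \<Sum>v\<in>X. c a x v * (\<Sum>y\<in>X. g x y * gram X c y v))"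
      unfolding sum_distrib_left by (rule sum.cong[OF refl], subst sum.swap) (simp add: mult_ac)
    also have "\<dots> = (\<Sum>x\<in>X. \<Sum>v\<in>X. c a x v * (if x = v then 1 else 0))"
      using g' by simp
    also have "\<dots> = reg_trace X c a"
      unfolding reg_trace_def by (rule sum.cong[OF refl]) (simp only: sum_mult_delta(2)[OF fin])
    finally show ?thesis .
  qed
  have 2: "(\<Sum>w\<in>X. gram X c a w * e w) = reg_trace X c a" if a: "a \<in> X" for a
  proof -
    have "(\<Sum>w\<in>X. gram X c a w * e w) = (\<Sum>v\<in>X. (\<Sum>w\<in>X. e w * c a w v) * reg_trace X c v)"
      unfolding gram_def sum_distrib_left sum_distrib_right by (subst sum.swap) (simp add: mult_ac)
    also have "\<dots> = (\<Sum>v\<in>X. (if a = v then 1 else 0) * reg_trace X c v)"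
      using unit a by simp
    finally show ?thesis by (simp only: sum_mult_delta(4)[OF fin a])
  qed
  have cancel: "F w = (\<Sum>a\<in>X. g w a * (\<Sum>v\<in>X. gram X c a v * F v))" for F
  proof -
    have "(\<Sum>a\<in>X. g w a * (\<Sum>v\<in>X. gram X c a v * F v))
        = (\<Sum>v\<in>X. (\<Sum>a\<in>X. g w a * gram X c a v) * F v)"
      unfolding sum_distrib_left sum_distrib_right by (subst sum.swap) (simp add: mult.assoc)
    also have "\<dots> = (\<Sum>v\<in>X. (if w = v then 1 else 0) * F v)"
      using g' w by simp
    also have "\<dots> = F w"
      by (simp only: sum_mult_delta(4)[OF fin w])
    finally show ?thesis by simp
  qed
  have "z w = e w"
    unfolding cancel[of z] cancel[of e] using 1 2 by simp
  then show ?thesis by (simp add: z_def)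
qed

text \<open>The trace can be computed in coordinates on a basis \<open>B\<close> of the image, where
  the idempotent acts as the identity. It therefore equals the size of \<open>B\<close>, and
  characteristic zero makes \<open>B\<close> empty.\<close>

lemma idempotent_trace_zero:
  fixes P :: "'a::field_char_0 ^ 'b ^ 'b"
  assumes P: "P ** P = P" and tr0: "(\<Sum>c\<in>UNIV. P $ c $ c) = 0"
  shows "P = 0"
proof -
  have sub: "vec.subspace (range ((*v) P))"
    by (rule vec.subspace_image[OF vec.subspace_UNIV])
  obtain B where B: "finite B" "vec.independent B" "vec.span B = range ((*v) P)"
    using vec.basis_subspace_exists[OF sub] by metis
  define rp where "rp = vec.representation B"
  have sumrp: "(\<Sum>b\<in>B. rp v b *s b) = v" if "v \<in> vec.span B" for v
    unfolding rp_def by (rule vec.sum_representation_eq) (use B that in auto)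
  have col: "column c P \<in> vec.span B" for c
  proof -
    have "column c P = P *v axis c 1"
      by (simp add: vec_eq_iff matrix_vector_mult_def column_def axis_def if_distrib cong: if_cong)
    then show ?thesis unfolding B by simp
  qed
  have Pb: "P *v b = b" if "b \<in> B" for b
  proof -
    have "b \<in> range ((*v) P)" using that B(3) vec.span_base by blast
    then obtain v where "b = P *v v" by blast
    then show ?thesis by (simp only: matrix_vector_mul_assoc P)
  qed
  \<comment> \<open>Since P fixes b, the combination of columns weighted by the entries of b has
    b-coordinate 1; this is one diagonal entry of P restricted to its image.\<close>
  have rpb: "(\<Sum>c\<in>UNIV. b $ c * rp (column c P) b) = 1" if b: "b \<in> B" for b
  proof -
    have "rp (\<Sum>c\<in>UNIV. b $ c *s column c P) b = (\<Sum>c\<in>UNIV. rp (b $ c *s column c P) b)"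
      unfolding rp_def by (subst vec.representation_sum[OF B(2)]) (simp_all add: col vec.span_scale)
    also have "\<dots> = (\<Sum>c\<in>UNIV. b $ c * rp (column c P) b)"
      unfolding rp_def using vec.representation_scale[OF B(2) col] by simp
    finally have "(\<Sum>c\<in>UNIV. b $ c * rp (column c P) b) = rp (P *v b) b"
      by (simp add: matrix_mult_sum)
    also have "\<dots> = 1"
      unfolding Pb[OF b] rp_def using vec.representation_basis[OF B(2) b] by simp
    finally show ?thesis .
  qed
  have "(\<Sum>c\<in>UNIV. P $ c $ c) = (\<Sum>c\<in>UNIV. \<Sum>b\<in>B. rp (column c P) b * b $ c)"
  proof (rule sum.cong[OF refl])
    fix c
    have "P $ c $ c = (\<Sum>b\<in>B. rp (column c P) b *s b) $ c"
      unfolding sumrp[OF col] by (simp add: column_def)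
    then show "P $ c $ c = (\<Sum>b\<in>B. rp (column c P) b * b $ c)" by simp
  qed
  also have "\<dots> = (\<Sum>b\<in>B. \<Sum>c\<in>UNIV. b $ c * rp (column c P) b)"
    by (subst sum.swap) (simp add: mult.commute)
  also have "\<dots> = of_nat (card B)" using rpb by simp
  finally have "card B = 0" using tr0 by simp
  then have "range ((*v) P) = {0}" using B by simp
  then have "P *v v = 0 *v v" for v by auto
  then show "P = 0" using matrix_eq by blast
qed

section \<open>Nondegeneracy of the regular trace form\<close>

text \<open>A basis element with nonzero trace is even, because left multiplication by it has a
  nonzero diagonal entry; hence only products with an even component contribute.\<close>

lemma gram_parity_additive:
  assumes parity_additive: "parity_additive p p p c" and nz: "gram X c a b \<noteq> 0"
  shows "p a = p b"
proof -
  obtain w where w: "c a b w * reg_trace X c w \<noteq> 0"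
    using nz unfolding gram_def by (metis (mono_tags, lifting) sum.not_neutral_contains_not_neutral)
  then obtain y where "c w y y \<noteq> 0"
    unfolding reg_trace_def by (metis (mono_tags, lifting) mult_zero_right sum.not_neutral_contains_not_neutral)
  with w parity_additive show ?thesis unfolding parity_additive_def by (metis mult_zero_left)
qed

text \<open>The radical \<open>N\<close> is a graded left ideal; writing \<open>1 = y + z\<close> along a complement, \<open>N = Ny\<close> with
  \<open>y\<close> idempotent, and the trace of \<open>y\<close>, which is the rank of left multiplication by \<open>y\<close>, is zero.\<close>

lemma gram_nondegenerate:
  fixes m :: "'b::finite \<Rightarrow> 'b \<Rightarrow> 'b \<Rightarrow> 'a::field_char_0"
  assumes as: "assoc_on UNIV m" and parity_additive: "parity_additive p p p m"
    and unit: "\<And>b c. (\<Sum>x\<in>UNIV. u x * m b x c) = (if b = c then 1 else 0)"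
    and ss: "semisimple_super m p"
    and x: "\<And>b. (\<Sum>a\<in>UNIV. x a * gram UNIV m a b) = 0"
  shows "x a = 0"
proof -
  let ?G = "gram UNIV m"
  define N where "N = {x. \<forall>b. (\<Sum>a\<in>UNIV. x a * ?G a b) = 0}"
  note G_parity_additive = gram_parity_additive[OF parity_additive, of UNIV]
  have "left_ideal m N"
    unfolding left_ideal_def
  proof (intro conjI ballI allI)
    show "(\<lambda>c. 0) \<in> N" by (simp add: N_def)
    show "(\<lambda>c. x c + y c) \<in> N" if "x \<in> N" "y \<in> N" for x y
      using that by (simp add: N_def distrib_right sum.distrib)
    show "(\<lambda>c. s * x c) \<in> N" if "x \<in> N" for s x
      using that by (simp add: N_def mult.assoc sum_distrib_left[symmetric])
    \<comment> \<open>Symmetry and invariance rewrite the pairing of yx with b as the pairing of by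
      with x, which vanishes because x lies in the radical.\<close>
    show "amul m y x \<in> N" if x: "x \<in> N" for y x
      unfolding N_def
    proof (intro CollectI allI)
      fix b
      have "(\<Sum>c\<in>UNIV. amul m y x c * ?G c b)
          = (\<Sum>a'\<in>UNIV. \<Sum>b'\<in>UNIV. y a' * x b' * (\<Sum>c\<in>UNIV. m a' b' c * ?G c b))"
        unfolding amul_def sum_distrib_left sum_distrib_right mult.assoc
        by (subst sum.swap, rule sum.cong[OF refl], rule sum.swap)
      also have "\<dots> = (\<Sum>a'\<in>UNIV. \<Sum>b'\<in>UNIV. y a' * x b' * (\<Sum>v\<in>UNIV. m b a' v * ?G v b'))"
      proof (intro sum.cong[OF refl])
        fix a' b'
        have "(\<Sum>c\<in>UNIV. m a' b' c * ?G c b) = (\<Sum>c\<in>UNIV. m a' b' c * ?G b c)"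
          by (rule sum.cong[OF refl]) (simp add: gram_sym[OF as, of b])
        also have "\<dots> = (\<Sum>v\<in>UNIV. m b a' v * ?G v b')"
          by (rule gram_assoc[OF as, symmetric]) simp_all
        finally show "y a' * x b' * (\<Sum>c\<in>UNIV. m a' b' c * ?G c b)
            = y a' * x b' * (\<Sum>v\<in>UNIV. m b a' v * ?G v b')" by simp
      qed
      also have "\<dots> = (\<Sum>a'\<in>UNIV. \<Sum>v\<in>UNIV. y a' * m b a' v * (\<Sum>b'\<in>UNIV. x b' * ?G b' v))"
        unfolding sum_distrib_left
        by (rule sum.cong[OF refl], subst sum.swap) (intro sum.cong[OF refl],
          simp add: gram_sym[OF as] mult_ac)
      also have "\<dots> = 0" using x by (simp add: N_def)
      finally show "(\<Sum>c\<in>UNIV. amul m y x c * ?G c b) = 0" .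
    qed
  qed
  moreover have "graded p N"
    unfolding graded_def
  proof (intro ballI)
    fix x assume x: "x \<in> N"
    \<comment> \<open>The form pairs \<open>b\<close> only with its own parity, so truncating
      \<open>x\<close> to its even part either kills the sum or leaves it unchanged.\<close>
    have "(\<Sum>a\<in>UNIV. (if p a then 0 else x a) * ?G a b) = 0" for b
    proof (cases "p b")
      case True
      then have "(\<Sum>a\<in>UNIV. (if p a then 0 else x a) * ?G a b) = (\<Sum>a\<in>(UNIV :: 'b set). 0)"
        using G_parity_additive by (intro sum.cong[OF refl]) auto
      then show ?thesis by simp
    next
      case False
      then have "(\<Sum>a\<in>UNIV. (if p a then 0 else x a) * ?G a b) = (\<Sum>a\<in>UNIV. x a * ?G a b)"
        using G_parity_additive by (intro sum.cong[OF refl]) auto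
      then show ?thesis using x by (simp add: N_def)
    qed
    then show "(\<lambda>c. if p c then 0 else x c) \<in> N" by (simp add: N_def)
  qed
  ultimately obtain N' where N': "left_ideal m N'" "N \<inter> N' = {\<lambda>c. 0}"
    and dec: "\<And>x. \<exists>y\<in>N. \<exists>z\<in>N'. x = (\<lambda>c. y c + z c)"
    using ss unfolding semisimple_super_def by metis
  obtain y z where y: "y \<in> N" and z: "z \<in> N'" and u: "u = (\<lambda>c. y c + z c)"
    using dec by blast
  have unit': "amul m x u = x" for x
  proof
    fix c
    have "amul m x u c = (\<Sum>b\<in>UNIV. x b * (\<Sum>a\<in>UNIV. u a * m b a c))"
      by (simp add: amul_def sum_distrib_left mult_ac)
    then show "amul m x u c = x c" by (simp add: unit if_distrib cong: if_cong)
  qed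
  \<comment> \<open>The difference x - xy = xz lies both in \<open>N\<close> and in its
    complement.\<close>
  have split: "amul m x y = x" if x: "x \<in> N" for x
  proof -
    have eq: "x c = amul m x y c + amul m x z c" for c
    proof -
      have "x c = amul m x u c" by (simp add: unit')
      also have "\<dots> = amul m x y c + amul m x z c"
        unfolding u amul_def by (simp add: distrib_left distrib_right sum.distrib)
      finally show ?thesis .
    qed
    have addN: "(\<lambda>c. f c + g c) \<in> N" if "f \<in> N" "g \<in> N" for f g
      using \<open>left_ideal m N\<close> that unfolding left_ideal_def by blast
    have "amul m x y \<in> N" using \<open>left_ideal m N\<close> y unfolding left_ideal_def by blast
    then have "(\<lambda>c. (- 1) * amul m x y c) \<in> N"
      using \<open>left_ideal m N\<close> unfolding left_ideal_def by blast
    from addN[OF x this] have "(\<lambda>c. x c + (- 1) * amul m x y c) \<in> N" .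
    also have "(\<lambda>c. x c + (- 1) * amul m x y c) = amul m x z"
    proof
      fix c show "x c + (- 1) * amul m x y c = amul m x z c" using eq[of c] by simp
    qed
    finally have "amul m x z \<in> N \<inter> N'"
      using N'(1) z unfolding left_ideal_def by blast
    then have "amul m x z c = 0" for c using N'(2) by auto
    then show ?thesis using eq by (intro ext) simp
  qed
  \<comment> \<open>The matrix of left multiplication by \<open>y\<close>, with inputs indexing the
    rows.\<close>
  define E :: "'a ^ 'b ^ 'b" where "E = (\<chi> b c. \<Sum>a\<in>UNIV. y a * m a b c)"
  have yy: "(\<Sum>a'\<in>UNIV. \<Sum>a\<in>UNIV. y a' * y a * m a' a v) = y v" for v
    using fun_cong[OF split[OF y], of v] by (simp add: amul_def)
  have "E ** E = E"
  proof -
    have "(\<Sum>w\<in>UNIV. (\<Sum>a\<in>UNIV. y a * m a b w) * (\<Sum>a'\<in>UNIV. y a' * m a' w c))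
        = (\<Sum>v\<in>UNIV. y v * m v b c)" for b c
    proof -
      have "(\<Sum>w\<in>UNIV. (\<Sum>a\<in>UNIV. y a * m a b w) * (\<Sum>a'\<in>UNIV. y a' * m a' w c))
          = (\<Sum>w\<in>UNIV. \<Sum>a'\<in>UNIV. \<Sum>a\<in>UNIV. y a' * y a * (m a b w * m a' w c))"
        unfolding sum_product by (rule sum.cong[OF refl], subst sum.swap) (simp add: mult_ac)
      also have "\<dots> = (\<Sum>a'\<in>UNIV. \<Sum>a\<in>UNIV. y a' * y a * (\<Sum>w\<in>UNIV. m a b w * m a' w c))"
        unfolding sum_distrib_left by (subst sum.swap, rule sum.cong[OF refl], rule sum.swap)
      also have "\<dots> = (\<Sum>a'\<in>UNIV. \<Sum>a\<in>UNIV. y a' * y a * (\<Sum>v\<in>UNIV. m a' a v * m v b c))"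
      proof -
        have "(\<Sum>w\<in>UNIV. m a b w * m a' w c) = (\<Sum>v\<in>UNIV. m a' a v * m v b c)" for a a'
          using as unfolding assoc_on_def by (metis UNIV_I)
        then show ?thesis by simp
      qed
      also have "\<dots> = (\<Sum>v\<in>UNIV. (\<Sum>a'\<in>UNIV. \<Sum>a\<in>UNIV. y a' * y a * m a' a v) * m v b c)"
        unfolding sum_distrib_left sum_distrib_right mult.assoc
        by (rule sym, subst sum.swap, rule sum.cong[OF refl], rule sum.swap)
      finally show ?thesis by (simp add: yy)
    qed
    then show ?thesis by (simp add: matrix_matrix_mult_def E_def vec_eq_iff)
  qed
  \<comment> \<open>Since y = yy, the trace of left multiplication by y is the form at (y, y), and y
    lies in the radical.\<close>
  moreover have "(\<Sum>c\<in>UNIV. E $ c $ c) = 0"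
  proof -
    have "(\<Sum>c\<in>UNIV. E $ c $ c) = (\<Sum>v\<in>UNIV. y v * reg_trace UNIV m v)"
      unfolding E_def reg_trace_def sum_distrib_left by simp (rule sum.swap)
    also have "\<dots> = (\<Sum>v\<in>UNIV. (\<Sum>a'\<in>UNIV. \<Sum>a\<in>UNIV. y a' * y a * m a' a v) * reg_trace UNIV m v)"
      by (simp add: yy)
    also have "\<dots> = (\<Sum>a'\<in>UNIV. \<Sum>a\<in>UNIV. y a' * y a * ?G a' a)"
      unfolding gram_def sum_distrib_left sum_distrib_right mult.assoc
      by (subst sum.swap, rule sum.cong[OF refl], rule sum.swap)
    also have "\<dots> = (\<Sum>a\<in>UNIV. y a * (\<Sum>a'\<in>UNIV. y a' * ?G a' a))"
      unfolding sum_distrib_left by (subst sum.swap) (simp add: mult_ac)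
    also have "\<dots> = 0" using y by (simp add: N_def)
    finally show ?thesis .
  qed
  ultimately have "E = 0" by (rule idempotent_trace_zero)
  then have E0: "(\<Sum>a\<in>UNIV. y a * m a b c) = 0" for b c
    by (simp add: E_def vec_eq_iff)
  have y0: "amul m y v c = 0" for v c
  proof -
    have "amul m y v c = (\<Sum>b\<in>UNIV. v b * (\<Sum>a\<in>UNIV. y a * m a b c))"
      unfolding amul_def sum_distrib_left by (subst sum.swap) (simp add: mult_ac)
    then show ?thesis by (simp add: E0)
  qed
  \<comment> \<open>Left multiplication by y is zero; applied to the unit it gives y = 0, and then x
    = xy = 0 for every x in \<open>N\<close>.\<close>
  have "y = (\<lambda>c. 0)" using y0 unit'[of y] by metis
  moreover have "x \<in> N" using x by (simp add: N_def)
  ultimately show "x a = 0" using split[of x] by (simp add: amul_def fun_eq_iff) 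
qed

lemma gram_inverse_exists:
  fixes m :: "'b::finite \<Rightarrow> 'b \<Rightarrow> 'b \<Rightarrow> 'a::field_char_0"
  assumes as: "assoc_on UNIV m" and parity_additive: "parity_additive p p p m"
    and unit: "\<And>b c. (\<Sum>x\<in>UNIV. u x * m b x c) = (if b = c then 1 else 0)"
    and ss: "semisimple_super m p"
  obtains g where "\<And>a c. (\<Sum>b\<in>UNIV. gram UNIV m a b * g b c) = (if a = c then 1 else 0)"
proof -
  define H :: "'a ^ 'b ^ 'b" where "H = (\<chi> a b. gram UNIV m a b)"
  have "v = 0" if "H *v v = 0" for v
  proof -
    have "(\<Sum>a\<in>UNIV. v $ a * gram UNIV m a b) = 0" for b
    proof -
      have "(\<Sum>a\<in>UNIV. v $ a * gram UNIV m a b) = (H *v v) $ b"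
        by (simp add: H_def matrix_vector_mult_def gram_sym[OF as, of b] mult.commute)
      then show ?thesis by (simp add: that)
    qed
    then have "v $ a = 0" for a
      by (rule gram_nondegenerate[OF as parity_additive unit ss])
    then show "v = 0" by (simp add: vec_eq_iff)
  qed
  then obtain B where "B ** H = mat 1" using matrix_left_invertible_ker by blast
  then have "H ** B = mat 1" using matrix_left_right_inverse by blast
  then have "(\<Sum>b\<in>UNIV. gram UNIV m a b * B $ b $ c) = (if a = c then 1 else 0)" for a c
    by (simp add: vec_eq_iff matrix_matrix_mult_def H_def mat_def)
  then show thesis by (rule that)
qed

section \<open>The regular trace form of a tensor power\<close>

lemma assoc_on_tensor:
  fixes m :: "'b::finite \<Rightarrow> 'b \<Rightarrow> 'b \<Rightarrow> 'a::comm_ring_1"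
  assumes as: "assoc_on UNIV m" and parity_additive: "parity_additive p p p m"
  shows "assoc_on (tuples UNIV d) (tensor_coeff p p m)"
  unfolding assoc_on_def
proof (intro ballI)
  fix xs ys zs vs :: "'b list" assume "xs \<in> tuples UNIV d" "ys \<in> tuples UNIV d"
  then show "(\<Sum>w\<in>tuples UNIV d. tensor_coeff p p m xs ys w * tensor_coeff p p m w zs vs)
      = (\<Sum>w\<in>tuples UNIV d. tensor_coeff p p m ys zs w * tensor_coeff p p m xs w vs)"
    by (intro tensor_coeff_assoc[OF parity_additive parity_additive]) (use as in \<open>auto simp: tuples_length assoc_on_def\<close>)
qed

text \<open>A diagonal coefficient is nonzero only if every letter of \<open>zs\<close> is even, so
  no Koszul sign survives.\<close>

lemma reg_trace_tensor:
  fixes m :: "'b::finite \<Rightarrow> 'b \<Rightarrow> 'b \<Rightarrow> 'a::comm_ring_1"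
  assumes parity_additive: "parity_additive p p p m" and zs: "zs \<in> tuples UNIV d"
  shows "reg_trace (tuples UNIV d) (tensor_coeff p p m) zs = (\<Prod>r<d. reg_trace UNIV m (zs ! r))"
  unfolding reg_trace_def sum_tuples_prod[symmetric]
proof (rule sum.cong[OF refl])
  fix ys :: "'b list" assume "ys \<in> tuples UNIV d"
  show "tensor_coeff p p m zs ys ys = (\<Prod>r<d. m (zs ! r) (ys ! r) (ys ! r))"
  proof (cases rule: tensor_coeff_cases[OF parity_additive, of zs ys ys])
    case 1
    then show ?thesis by (simp add: tensor_coeff_def tuples_length[OF zs])
  next
    case 2
    then have "\<And>r. r < length zs \<Longrightarrow> \<not> p (zs ! r)" by blast
    then show ?thesis by (simp add: tensor_coeff_def ksgn_even_left tuples_length[OF zs])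
  qed
qed

lemma gram_tensor:
  fixes m :: "'b::finite \<Rightarrow> 'b \<Rightarrow> 'b \<Rightarrow> 'a::comm_ring_1"
  assumes parity_additive: "parity_additive p p p m" and xs: "xs \<in> tuples UNIV d"
  shows "gram (tuples UNIV d) (tensor_coeff p p m) xs ys
    = ksgn d (\<lambda>r. p (xs ! r)) (\<lambda>r. p (ys ! r)) * (\<Prod>r<d. gram UNIV m (xs ! r) (ys ! r))"
  unfolding gram_def sum_tuples_prod[symmetric] sum_distrib_left
  by (rule sum.cong[OF refl]) (simp add: reg_trace_tensor[OF parity_additive] tensor_coeff_def tuples_length[OF xs] prod.distrib mult.assoc)

text \<open>Nonzero Gram entries force \<open>xs\<close> and \<open>ys\<close> to have equal
  parities, so the sign in the Gram matrix can be written in terms of \<open>ys\<close> alone.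
  Giving the inverse that same sign makes the two cancel as a square.\<close>

lemma gram_tensor_inverse:
  fixes m :: "'b::finite \<Rightarrow> 'b \<Rightarrow> 'b \<Rightarrow> 'a::comm_ring_1"
  assumes parity_additive: "parity_additive p p p m"
    and g: "\<And>a c. (\<Sum>b\<in>UNIV. gram UNIV m a b * g b c) = (if a = c then 1 else 0)"
    and xs: "xs \<in> tuples UNIV d" and zs: "zs \<in> tuples UNIV d"
  shows "(\<Sum>ys\<in>tuples UNIV d. gram (tuples UNIV d) (tensor_coeff p p m) xs ys
      * (ksgn d (\<lambda>r. p (ys ! r)) (\<lambda>r. p (ys ! r)) * (\<Prod>r<d. g (ys ! r) (zs ! r))))
    = (if xs = zs then 1 else 0)"
proof -
  have "gram (tuples UNIV d) (tensor_coeff p p m) xs ys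
      * (ksgn d (\<lambda>r. p (ys ! r)) (\<lambda>r. p (ys ! r)) * (\<Prod>r<d. g (ys ! r) (zs ! r)))
    = (\<Prod>r<d. gram UNIV m (xs ! r) (ys ! r) * g (ys ! r) (zs ! r))" for ys
  proof (cases "\<forall>r<d. gram UNIV m (xs ! r) (ys ! r) \<noteq> 0")
    case True
    then have "\<forall>r<d. p (xs ! r) = p (ys ! r)" using gram_parity_additive[OF parity_additive] by blast
    then have "(ksgn d (\<lambda>r. p (xs ! r)) (\<lambda>r. p (ys ! r)) :: 'a)
        = ksgn d (\<lambda>r. p (ys ! r)) (\<lambda>r. p (ys ! r))"
      by (intro ksgn_cong) auto
    note e = this
    have "gram (tuples UNIV d) (tensor_coeff p p m) xs ys
      * (ksgn d (\<lambda>r. p (ys ! r)) (\<lambda>r. p (ys ! r)) * (\<Prod>r<d. g (ys ! r) (zs ! r)))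
      = (ksgn d (\<lambda>r. p (ys ! r)) (\<lambda>r. p (ys ! r)) * ksgn d (\<lambda>r. p (ys ! r)) (\<lambda>r. p (ys ! r)))
        * ((\<Prod>r<d. gram UNIV m (xs ! r) (ys ! r)) * (\<Prod>r<d. g (ys ! r) (zs ! r)))"
      unfolding gram_tensor[OF parity_additive xs] e by (simp only: mult_ac)
    then show ?thesis by (simp add: ksgn_square prod.distrib)
  next
    case False
    then have "(\<Prod>r<d. gram UNIV m (xs ! r) (ys ! r)) = 0"
      by (intro prod_zero) auto
    then show ?thesis by (simp add: gram_tensor[OF parity_additive xs] prod.distrib)
  qed
  then have "(\<Sum>ys\<in>tuples UNIV d. gram (tuples UNIV d) (tensor_coeff p p m) xs ys
      * (ksgn d (\<lambda>r. p (ys ! r)) (\<lambda>r. p (ys ! r)) * (\<Prod>r<d. g (ys ! r) (zs ! r))))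
    = (\<Prod>r<d. if xs ! r = zs ! r then 1 else 0)"
    by (simp add: sum_tuples_prod[where F = "\<lambda>r y. gram UNIV m (xs ! r) y * g y (zs ! r)"] g)
  then show ?thesis
    by (simp add: prod_delta_list[OF tuples_length[OF xs] tuples_length[OF zs]])
qed

lemma tensor_right_unit:
  fixes M :: "'x \<Rightarrow> 'b::finite \<Rightarrow> 'x \<Rightarrow> 'a::comm_ring_1"
  assumes ev: "\<And>b. u b \<noteq> 0 \<Longrightarrow> \<not> p b"
    and unit: "\<And>x y. x \<in> S \<Longrightarrow> y \<in> S \<Longrightarrow> (\<Sum>b\<in>UNIV. u b * M x b y) = (if x = y then 1 else 0)"
    and xs: "xs \<in> tuples S d" and ys: "ys \<in> tuples S d"
  shows "(\<Sum>bs\<in>tuples UNIV d. (\<Prod>r<d. u (bs ! r)) * tensor_coeff q p M xs bs ys) = (if xs = ys then 1 else 0)"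
proof -
  have "(\<Sum>bs\<in>tuples UNIV d. (\<Prod>r<d. u (bs ! r)) * tensor_coeff q p M xs bs ys)
      = (\<Prod>r<d. \<Sum>b\<in>UNIV. u b * M (xs ! r) b (ys ! r))"
    unfolding tensor_coeff_def tuples_length[OF xs] by (rule sum_unit_ksgn(2)[OF ev])
  also have "\<dots> = (\<Prod>r<d. if xs ! r = ys ! r then 1 else 0)"
    by (rule prod.cong[OF refl]) (use unit tuples_nth[OF xs] tuples_nth[OF ys] in auto)
  finally show ?thesis
    by (simp add: prod_delta_list[OF tuples_length[OF xs] tuples_length[OF ys]])
qed

section \<open>Column vectors and matrices over A in coordinates\<close>

definition rmul :: "('b \<Rightarrow> 'b \<Rightarrow> 'b \<Rightarrow> 'a::zero) \<Rightarrow> nat \<times> 'b \<Rightarrow> 'b \<Rightarrow> nat \<times> 'b \<Rightarrow> 'a" where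
  "rmul m x b y = (if fst x = fst y then m (snd x) b (snd y) else 0)"

definition lmul :: "('b \<Rightarrow> 'b \<Rightarrow> 'b \<Rightarrow> 'a::zero) \<Rightarrow> nat \<times> nat \<times> 'b \<Rightarrow> nat \<times> 'b \<Rightarrow> nat \<times> 'b \<Rightarrow> 'a" where
  "lmul m k x y = (if fst (snd k) = fst x \<and> fst k = fst y then m (snd (snd k)) (snd x) (snd y) else 0)"

abbreviation rows :: "nat \<Rightarrow> (nat \<times> 'b) set" where
  "rows n \<equiv> {..<n} \<times> UNIV"

lemma Tidx_tuples: "Tidx n d = tuples (rows n) d"
  by (auto simp: Tidx_def tuples_def)

lemma Midx_tuples: "Midx n d = tuples ({..<n} \<times> rows n) d"
  by (auto simp: Midx_def tuples_def)

lemma Bidx_tuples: "Bidx d = tuples UNIV d"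
  by (auto simp: Bidx_def tuples_def)

lemma parity_additive_rmul:
  "parity_additive p p p m \<Longrightarrow> parity_additive (\<lambda>x. p (snd x)) p (\<lambda>x. p (snd x)) (rmul m)"
  by (auto simp: parity_additive_def rmul_def)

lemma parity_additive_lmul:
  "parity_additive p p p m \<Longrightarrow> parity_additive (\<lambda>x. p (snd (snd x))) (\<lambda>x. p (snd x)) (\<lambda>x. p (snd x)) (lmul m)"
  by (auto simp: parity_additive_def lmul_def)

lemma prod_if_all:
  fixes f :: "nat \<Rightarrow> 'a::comm_ring_1"
  shows "(\<Prod>r<d. if P r then f r else 0) = (if \<forall>r<d. P r then \<Prod>r<d. f r else 0)"
proof (cases "\<forall>r<d. P r")
  case False
  then have "(\<Prod>r<d. if P r then f r else 0) = 0" by (intro prod_zero) auto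
  then show ?thesis by (simp only: False if_False)
qed simp

lemma lcoef_tensor_coeff:
  "lcoef m p ms ts out = tensor_coeff (\<lambda>x. p (snd (snd x))) (\<lambda>x. p (snd x)) (lmul m) ms ts out"
proof -
  have s: "{(r, s). s < r \<and> r < length ms \<and> p (snd (snd (ms ! r))) \<and> p (snd (ts ! s))}
     = {(r, s). r < length ms \<and> s < length ms \<and> s < r \<and> p (snd (snd (ms ! r))) \<and> p (snd (ts ! s))}"
    by auto
  show ?thesis
    unfolding lcoef_def tensor_coeff_def lmul_def prod_if_all ksgn_def prod2_sign_of s by auto
qed

lemma rcoef_tensor_coeff:
  assumes "length ts = length bs"
  shows "rcoef m p bs ts out = tensor_coeff (\<lambda>x. p (snd x)) p (rmul m) ts bs out"
proof -
  let ?A = "{(r, s). r < s \<and> s < length bs \<and> p (bs ! r) \<and> p (snd (ts ! s))}"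
  let ?B = "{(r, s). r < length bs \<and> s < length bs \<and> s < r \<and> p (snd (ts ! r)) \<and> p (bs ! s)}"
  \<comment> \<open>The action counts a pair with the position of the acting letter first;
    exchanging coordinates gives the Koszul count for multiplying \<open>ts\<close> by
    \<open>bs\<close>.\<close>
  have "?B = prod.swap ` ?A" by (auto simp: image_iff)
  then have "card ?B = card ?A" by (simp add: card_image)
  then show ?thesis
    unfolding rcoef_def tensor_coeff_def rmul_def prod_if_all ksgn_def prod2_sign_of assms by auto
qed

text \<open>Right multiplication preserves the row, so the sum over \<open>rows n\<close> collapses
  to the single row \<open>fst x\<close>, which must be in range.\<close>

lemma rmul_comp:
  fixes m :: "'b::finite \<Rightarrow> 'b \<Rightarrow> 'b \<Rightarrow> 'a::comm_ring_1"
  assumes as: "assoc_on UNIV m" and x: "fst x < n"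
  shows "(\<Sum>w\<in>rows n. rmul m x a w * rmul m w b y) = (\<Sum>c\<in>UNIV. m a b c * rmul m x c y)"
proof -
  have "(\<Sum>w\<in>rows n. rmul m x a w * rmul m w b y)
      = (\<Sum>i<n. \<Sum>c\<in>UNIV. if i = fst x then rmul m x a (i, c) * rmul m (i, c) b y else 0)"
    unfolding sum.cartesian_product by (rule sum.cong[OF refl]) (auto simp: rmul_def)
  also have "\<dots> = (\<Sum>i<n. if i = fst x then \<Sum>c\<in>UNIV. rmul m x a (i, c) * rmul m (i, c) b y else 0)"
    by (rule sum.cong[OF refl]) simp
  also have "\<dots> = (\<Sum>c\<in>UNIV. rmul m x a (fst x, c) * rmul m (fst x, c) b y)"
    using x by simp
  also have "\<dots> = (if fst x = fst y then \<Sum>c\<in>UNIV. m (snd x) a c * m c b (snd y) else 0)"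
    by (simp add: rmul_def)
  also have "(\<Sum>c\<in>UNIV. m (snd x) a c * m c b (snd y)) = (\<Sum>c\<in>UNIV. m a b c * m (snd x) c (snd y))"
    using as unfolding assoc_on_def by blast
  finally show ?thesis by (simp add: rmul_def)
qed

section \<open>Double centralizers in matrix algebras\<close>

text \<open>Entries outside \<open>X\<close> are zero, so that equality of functions is equality of
  operators. With row vectors, \<open>F\<close> is applied before \<open>G\<close>, which matches
  right actions.\<close>

definition mat_mult :: "'x set \<Rightarrow> ('x \<Rightarrow> 'x \<Rightarrow> 'a::comm_ring_1) \<Rightarrow> ('x \<Rightarrow> 'x \<Rightarrow> 'a) \<Rightarrow> 'x \<Rightarrow> 'x \<Rightarrow> 'a" where
  "mat_mult X F G = (\<lambda>x y. if x \<in> X \<and> y \<in> X then \<Sum>z\<in>X. F x z * G z y else 0)"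

definition restrict_mat :: "'x set \<Rightarrow> ('x \<Rightarrow> 'x \<Rightarrow> 'a::zero) \<Rightarrow> 'x \<Rightarrow> 'x \<Rightarrow> 'a" where
  "restrict_mat X F = (\<lambda>x y. if x \<in> X \<and> y \<in> X then F x y else 0)"

abbreviation id_mat :: "'x set \<Rightarrow> 'x \<Rightarrow> 'x \<Rightarrow> 'a::comm_ring_1" where
  "id_mat X \<equiv> restrict_mat X (\<lambda>x y. if x = y then 1 else 0)"

definition lin_comb :: "'j set \<Rightarrow> ('j \<Rightarrow> 'a) \<Rightarrow> ('j \<Rightarrow> 'x \<Rightarrow> 'x \<Rightarrow> 'a::comm_ring_1) \<Rightarrow> 'x \<Rightarrow> 'x \<Rightarrow> 'a" where
  "lin_comb J s F = (\<lambda>x y. \<Sum>j\<in>J. s j * F j x y)"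

lemma mat_mult_assoc: "mat_mult X (mat_mult X F G) H = mat_mult X F (mat_mult X G H)"
proof (intro ext)
  fix x y
  have "(\<Sum>z\<in>X. (\<Sum>w\<in>X. F x w * G w z) * H z y) = (\<Sum>w\<in>X. F x w * (\<Sum>z\<in>X. G w z * H z y))"
    unfolding sum_distrib_left sum_distrib_right by (subst sum.swap) (simp add: mult.assoc)
  then show "mat_mult X (mat_mult X F G) H x y = mat_mult X F (mat_mult X G H) x y"
    by (simp add: mat_mult_def)
qed

lemma restrict_mat_mat_mult [simp]: "restrict_mat X (mat_mult X F G) = mat_mult X F G"
  by (auto simp: restrict_mat_def mat_mult_def fun_eq_iff)

lemma restrict_mat_restrict_mat [simp]: "restrict_mat X (restrict_mat X F) = restrict_mat X F"
  by (auto simp: restrict_mat_def fun_eq_iff)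

lemma mat_mult_id_mat:
  assumes "finite X"
  shows "mat_mult X (id_mat X) F = restrict_mat X F" "mat_mult X F (id_mat X) = restrict_mat X F"
  using assms by (auto simp: mat_mult_def restrict_mat_def fun_eq_iff if_distrib[of "\<lambda>y. y * _"]
    if_distrib[of "\<lambda>y. _ * y"] cong: if_cong)

lemma mat_mult_lin_comb_left: "mat_mult X (lin_comb J s F) G = lin_comb J s (\<lambda>j. mat_mult X (F j) G)"
proof (intro ext)
  fix x y
  have "(\<Sum>z\<in>X. (\<Sum>j\<in>J. s j * F j x z) * G z y) = (\<Sum>j\<in>J. s j * (\<Sum>z\<in>X. F j x z * G z y))"
    unfolding sum_distrib_left sum_distrib_right by (subst sum.swap) (simp add: mult.assoc)
  then show "mat_mult X (lin_comb J s F) G x y = lin_comb J s (\<lambda>j. mat_mult X (F j) G) x y"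
    by (auto simp: mat_mult_def lin_comb_def)
qed

lemma mat_mult_lin_comb_right: "mat_mult X F (lin_comb J s G) = lin_comb J s (\<lambda>j. mat_mult X F (G j))"
proof (intro ext)
  fix x y
  have "(\<Sum>z\<in>X. F x z * (\<Sum>j\<in>J. s j * G j z y)) = (\<Sum>j\<in>J. s j * (\<Sum>z\<in>X. F x z * G j z y))"
    unfolding sum_distrib_left by (subst sum.swap) (simp add: mult_ac)
  then show "mat_mult X F (lin_comb J s G) x y = lin_comb J s (\<lambda>j. mat_mult X F (G j)) x y"
    by (auto simp: mat_mult_def lin_comb_def)
qed

lemma lin_comb_cong:
  assumes "\<And>j. j \<in> J \<Longrightarrow> F j = G j"
  shows "lin_comb J s F = lin_comb J s G"
  using assms by (simp add: lin_comb_def)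

lemma lin_comb_lin_comb:
  "lin_comb J s (\<lambda>j. lin_comb K (t j) (F j)) = lin_comb (J \<times> K) (\<lambda>(j, k). s j * t j k) (\<lambda>(j, k). F j k)"
  by (simp add: lin_comb_def sum_distrib_left sum.cartesian_product case_prod_beta mult.assoc)

lemma lin_comb_lin_comb_swap:
  "lin_comb J s (\<lambda>j. lin_comb K t (F j)) = lin_comb K t (\<lambda>k. lin_comb J s (\<lambda>j. F j k))"
proof (intro ext)
  fix x y
  have "(\<Sum>j\<in>J. \<Sum>k\<in>K. s j * (t k * F j k x y)) = (\<Sum>k\<in>K. \<Sum>j\<in>J. s j * (t k * F j k x y))"
    by (rule sum.swap)
  then show "lin_comb J s (\<lambda>j. lin_comb K t (F j)) x y = lin_comb K t (\<lambda>k. lin_comb J s (\<lambda>j. F j k)) x y"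
    by (simp only: lin_comb_def sum_distrib_left mult.left_commute)
qed

definition mat_span :: "'j set \<Rightarrow> ('j \<Rightarrow> 'x \<Rightarrow> 'x \<Rightarrow> 'a::comm_ring_1) \<Rightarrow> ('x \<Rightarrow> 'x \<Rightarrow> 'a) set" where
  "mat_span J F = range (\<lambda>s. lin_comb J s F)"

lemma mat_span_lin_comb:
  assumes "\<And>k. k \<in> K \<Longrightarrow> G k \<in> mat_span J F"
  shows "lin_comb K t G \<in> mat_span J F"
proof -
  obtain s where s: "\<And>k. k \<in> K \<Longrightarrow> G k = lin_comb J (s k) F"
  proof -
    have "\<forall>k\<in>K. \<exists>s. G k = lin_comb J s F" using assms unfolding mat_span_def by blast
    then show thesis using that by (metis (no_types) bchoice)
  qed
  have "lin_comb K t G = lin_comb K t (\<lambda>k. lin_comb J (s k) F)" by (rule lin_comb_cong) (rule s)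
  also have "\<dots> = lin_comb J (\<lambda>j. \<Sum>k\<in>K. t k * s k j) F"
    unfolding lin_comb_def sum_distrib_left sum_distrib_right
    by (intro ext, subst sum.swap) (simp add: mult.assoc)
  finally show ?thesis unfolding mat_span_def by blast
qed

lemma mat_span_base:
  assumes "finite J" "j \<in> J"
  shows "F j \<in> mat_span J F"
proof -
  have "F j = lin_comb J (\<lambda>i. if i = j then 1 else 0) F"
    using assms by (simp add: lin_comb_def if_distrib[of "\<lambda>y. y * _"] cong: if_cong)
  then show ?thesis unfolding mat_span_def by blast
qed

lemma mat_span_scale:
  assumes "G \<in> mat_span J F"
  shows "(\<lambda>x y. c * G x y) \<in> mat_span J F"
  using mat_span_lin_comb[of "{()}" "\<lambda>_. G" J F "\<lambda>_. c"] assms by (simp add: lin_comb_def)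

text \<open>Vectors are added one at a time. A new vector is either fixed already or leaves a
  nonzero residue \<open>f\<close>, and then a rank-one correction along \<open>f\<close> extends
  the projection.\<close>

lemma projection_exists:
  fixes R :: "'b \<Rightarrow> 'z \<Rightarrow> 'a::field"
  assumes "finite Z" "finite B"
  shows "\<exists>q. (\<forall>b\<in>B. \<forall>z\<in>Z. (\<Sum>z'\<in>Z. R b z' * q z' z) = R b z) \<and>
             (\<forall>z'\<in>Z. \<exists>w. \<forall>z\<in>Z. q z' z = (\<Sum>b\<in>B. w b * R b z))"
  using assms(2)
proof (induction B rule: finite_induct)
  case empty
  have "\<forall>z'\<in>Z. \<exists>w. \<forall>z\<in>Z. 0 = (\<Sum>b\<in>{}. w b * R b z)" by simp
  then show ?case by (intro exI[of _ "\<lambda>_ _. 0"]) simp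
next
  case (insert b0 B)
  obtain q where q: "\<And>b z. b \<in> B \<Longrightarrow> z \<in> Z \<Longrightarrow> (\<Sum>z'\<in>Z. R b z' * q z' z) = R b z"
    and "\<forall>z'\<in>Z. \<exists>w. \<forall>z\<in>Z. q z' z = (\<Sum>b\<in>B. w b * R b z)"
    using insert.IH by blast
  then obtain w where w: "\<And>z' z. z' \<in> Z \<Longrightarrow> z \<in> Z \<Longrightarrow> q z' z = (\<Sum>b\<in>B. w z' b * R b z)"
    by metis
  define f where "f z = R b0 z - (\<Sum>z'\<in>Z. R b0 z' * q z' z)" for z
  have f: "f z = R b0 z + (\<Sum>b\<in>B. - (\<Sum>z'\<in>Z. R b0 z' * w z' b) * R b z)" if "z \<in> Z" for z
  proof -
    have "(\<Sum>z'\<in>Z. R b0 z' * q z' z) = (\<Sum>b\<in>B. (\<Sum>z'\<in>Z. R b0 z' * w z' b) * R b z)"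
      using w that unfolding sum_distrib_right
      by (subst sum.swap) (simp add: sum_distrib_left mult.assoc)
    then show ?thesis by (simp add: f_def sum_negf)
  qed
  show ?case
  proof (cases "\<forall>z\<in>Z. f z = 0")
    case True
    have "\<exists>v. \<forall>z\<in>Z. q z' z = (\<Sum>b\<in>insert b0 B. v b * R b z)" if z': "z' \<in> Z" for z'
    proof (intro exI[of _ "(w z')(b0 := 0)"] ballI)
      fix z assume z: "z \<in> Z"
      have "(\<Sum>b\<in>B. ((w z')(b0 := 0)) b * R b z) = (\<Sum>b\<in>B. w z' b * R b z)"
        using insert.hyps(2) by (intro sum.cong) auto
      then show "q z' z = (\<Sum>b\<in>insert b0 B. ((w z')(b0 := 0)) b * R b z)"
        using insert.hyps by (simp add: w[OF z' z])
    qed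
    moreover have "\<forall>b\<in>insert b0 B. \<forall>z\<in>Z. (\<Sum>z'\<in>Z. R b z' * q z' z) = R b z"
      using q True by (auto simp: f_def)
    ultimately show ?thesis by blast
  next
    case False
    then obtain z0 where z0: "z0 \<in> Z" "f z0 \<noteq> 0" by blast
    \<comment> \<open>This represents the functional sending v to (v - vq)(z0) / f(z0), where z0 is
      a coordinate at which the residue is nonzero. It vanishes on the vectors already fixed and is
      1 on the new one.\<close>
    define k where "k z' = ((if z' = z0 then 1 else 0) - q z' z0) / f z0" for z'
    define q' where "q' z' z = q z' z + k z' * f z" for z' z
    have sumq': "(\<Sum>z'\<in>Z. R b z' * q' z' z)
        = (\<Sum>z'\<in>Z. R b z' * q z' z) + (R b z0 - (\<Sum>z'\<in>Z. R b z' * q z' z0)) / f z0 * f z" for b z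
    proof -
      have "(\<Sum>z'\<in>Z. R b z' * k z')
          = (\<Sum>z'\<in>Z. (R b z' * (if z' = z0 then 1 else 0) - R b z' * q z' z0) / f z0)"
        by (simp add: k_def algebra_simps)
      also have "\<dots> = ((\<Sum>z'\<in>Z. R b z' * (if z' = z0 then 1 else 0)) - (\<Sum>z'\<in>Z. R b z' * q z' z0)) / f z0"
        by (simp only: sum_divide_distrib[symmetric] sum_subtractf)
      finally have "(\<Sum>z'\<in>Z. R b z' * k z') = (R b z0 - (\<Sum>z'\<in>Z. R b z' * q z' z0)) / f z0"
        by (simp only: sum_mult_delta(1)[OF assms(1) z0(1)])
      then show ?thesis
        by (simp add: q'_def distrib_left sum.distrib mult.assoc[symmetric] sum_distrib_right[symmetric])
    qed
    have "(\<Sum>z'\<in>Z. R b z' * q' z' z) = R b z" if "b \<in> insert b0 B" "z \<in> Z" for b z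
    proof (cases "b = b0")
      case True
      have "R b0 z0 - (\<Sum>z'\<in>Z. R b0 z' * q z' z0) = f z0" by (simp add: f_def)
      then show ?thesis using z0(2) by (simp add: True sumq') (simp add: f_def)
    next
      case False
      then show ?thesis using that q z0(1) by (simp add: sumq')
    qed
    moreover have "\<exists>v. \<forall>z\<in>Z. q' z' z = (\<Sum>b\<in>insert b0 B. v b * R b z)" if z': "z' \<in> Z" for z'
    proof -
      define v where "v b = (if b = b0 then k z' else w z' b + k z' * - (\<Sum>z'\<in>Z. R b0 z' * w z' b))" for b
      have "q' z' z = (\<Sum>b\<in>insert b0 B. v b * R b z)" if z: "z \<in> Z" for z
      proof -
        have "(\<Sum>b\<in>B. v b * R b z)
            = (\<Sum>b\<in>B. w z' b * R b z + k z' * (- (\<Sum>z'\<in>Z. R b0 z' * w z' b) * R b z))"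
          using insert.hyps(2) by (intro sum.cong[OF refl]) (auto simp: v_def algebra_simps)
        also have "\<dots> = q z' z + k z' * (\<Sum>b\<in>B. - (\<Sum>z'\<in>Z. R b0 z' * w z' b) * R b z)"
          by (simp only: sum.distrib sum_distrib_left[symmetric] w[OF z' z])
        finally show ?thesis
          using insert.hyps by (simp add: q'_def f[OF z] v_def[of b0] distrib_left)
      qed
      then show ?thesis by blast
    qed
    ultimately show ?thesis by blast
  qed
qed

text \<open>\<open>F \<mapsto> \<Sum>\<^sub>j s\<^sub>j \<pi> (F X\<^sub>j) Y\<^sub>j\<close>, for a linear projection \<open>\<pi>\<close> of the matrices
  onto the span \<open>W\<close>, is a module projection onto \<open>W\<close> that fixes the identity matrix. Its matrix
  entries are averages, hence commute with \<open>\<Phi>\<close>; so its value at \<open>\<Phi>\<close> is \<open>\<Phi>\<close> itself.\<close>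

lemma double_centralizer:
  fixes R :: "'b \<Rightarrow> 'x \<Rightarrow> 'x \<Rightarrow> 'a::field"
  assumes X: "finite X" and B: "finite B" and R: "\<And>b. b \<in> B \<Longrightarrow> restrict_mat X (R b) = R b"
    and Xj: "\<And>j. j \<in> J \<Longrightarrow> Xm j \<in> mat_span B R"
    and Yj: "\<And>j F. j \<in> J \<Longrightarrow> F \<in> mat_span B R \<Longrightarrow> mat_mult X F (Ym j) \<in> mat_span B R"
    and one: "lin_comb J s (\<lambda>j. mat_mult X (Xm j) (Ym j)) = id_mat X"
    and cent: "\<And>Q. mat_mult X \<Phi> (lin_comb J s (\<lambda>j. mat_mult X (Xm j) (mat_mult X Q (Ym j))))
                  = mat_mult X (lin_comb J s (\<lambda>j. mat_mult X (Xm j) (mat_mult X Q (Ym j)))) \<Phi>"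
    and \<Phi>: "restrict_mat X \<Phi> = \<Phi>"
  shows "\<Phi> \<in> mat_span B R"
proof -
  obtain q where q1: "\<And>b z. b \<in> B \<Longrightarrow> z \<in> X \<times> X \<Longrightarrow>
        (\<Sum>z'\<in>X \<times> X. (\<lambda>(x, y). R b x y) z' * q z' z) = (\<lambda>(x, y). R b x y) z"
    and q2: "\<forall>z'\<in>X \<times> X. \<exists>w. \<forall>z\<in>X \<times> X. q z' z = (\<Sum>b\<in>B. w b * (\<lambda>(x, y). R b x y) z)"
    using projection_exists[of "X \<times> X" B "\<lambda>b (x, y). R b x y"] X B by auto
  define \<pi> where "\<pi> M = restrict_mat X (\<lambda>x y. \<Sum>z'\<in>X \<times> X. M (fst z') (snd z') * q z' (x, y))" for M
  \<comment> \<open>Right multiplication acts on each row separately, so the matrices form a direct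
    sum of copies of the row space. \<open>Q s x\<close> is the block of the projection leading from
    row s to row x, and each block is averaged.\<close>
  define Q where "Q s x = (\<lambda>y' y. q (s, y') (x, y))" for s x
  define avg where "avg Q = lin_comb J s (\<lambda>j. mat_mult X (Xm j) (mat_mult X Q (Ym j)))" for Q
  have \<pi>_lin_comb: "\<pi> (lin_comb K t F) = lin_comb K t (\<lambda>k. \<pi> (F k))" for K :: "'b set" and t F
  proof (intro ext)
    fix x y
    have "(\<Sum>z'\<in>X \<times> X. (\<Sum>j\<in>K. t j * F j (fst z') (snd z')) * q z' (x, y))
        = (\<Sum>j\<in>K. t j * (\<Sum>z'\<in>X \<times> X. F j (fst z') (snd z') * q z' (x, y)))"
      unfolding sum_distrib_left sum_distrib_right by (subst sum.swap) (simp add: mult.assoc)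
    then show "\<pi> (lin_comb K t F) x y = lin_comb K t (\<lambda>k. \<pi> (F k)) x y"
      by (auto simp: \<pi>_def restrict_mat_def lin_comb_def)
  qed
  have \<pi>R: "\<pi> (R b) = R b" if "b \<in> B" for b
  proof -
    have "\<pi> (R b) = restrict_mat X (R b)"
    proof (intro ext)
      fix x y
      show "\<pi> (R b) x y = restrict_mat X (R b) x y"
        using q1[OF that, of "(x, y)"] by (auto simp: \<pi>_def restrict_mat_def case_prod_beta)
    qed
    then show ?thesis by (simp add: R[OF that])
  qed
  have \<pi>_fix: "\<pi> F = F" if F: "F \<in> mat_span B R" for F
  proof -
    obtain t where "F = lin_comb B t R" using F unfolding mat_span_def by blast
    moreover have "lin_comb B t (\<lambda>b. \<pi> (R b)) = lin_comb B t R" by (rule lin_comb_cong) (rule \<pi>R)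
    ultimately show ?thesis by (simp only: \<pi>_lin_comb)
  qed
  have \<pi>_span: "\<pi> M \<in> mat_span B R" for M
  proof -
    have "restrict_mat X (\<lambda>x y. q z' (x, y)) \<in> mat_span B R" if z': "z' \<in> X \<times> X" for z'
    proof -
      obtain w where w: "\<And>x y. x \<in> X \<Longrightarrow> y \<in> X \<Longrightarrow> q z' (x, y) = (\<Sum>b\<in>B. w b * R b x y)"
        using bspec[OF q2 z'] by auto
      have "restrict_mat X (\<lambda>x y. q z' (x, y)) = lin_comb B w (\<lambda>b. restrict_mat X (R b))"
        by (auto simp: restrict_mat_def lin_comb_def fun_eq_iff w)
      also have "\<dots> = lin_comb B w R" by (rule lin_comb_cong) (rule R)
      finally show ?thesis unfolding mat_span_def by blast
    qed
    then have "lin_comb (X \<times> X) (\<lambda>z'. M (fst z') (snd z')) (\<lambda>z'. restrict_mat X (\<lambda>x y. q z' (x, y))) \<in> mat_span B R"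
      by (rule mat_span_lin_comb)
    also have "lin_comb (X \<times> X) (\<lambda>z'. M (fst z') (snd z')) (\<lambda>z'. restrict_mat X (\<lambda>x y. q z' (x, y))) = \<pi> M"
      by (auto simp: lin_comb_def restrict_mat_def \<pi>_def fun_eq_iff)
    finally show ?thesis .
  qed
  have entries: "lin_comb J s (\<lambda>j. mat_mult X (\<pi> (mat_mult X M (Xm j))) (Ym j)) x y = (\<Sum>s'\<in>X. mat_mult X M (avg (Q s' x)) s' y)"
    if x: "x \<in> X" and y: "y \<in> X" for M x y
  proof -
    have e: "mat_mult X (\<pi> F) G x y = (\<Sum>s'\<in>X. mat_mult X F (mat_mult X (Q s' x) G) s' y)" for F G
    proof -
      have "mat_mult X (\<pi> F) G x y
          = (\<Sum>z\<in>X. (\<Sum>s'\<in>X. \<Sum>y'\<in>X. F s' y' * q (s', y') (x, z)) * G z y)"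
        using x y by (simp add: mat_mult_def \<pi>_def restrict_mat_def sum.cartesian_product case_prod_beta)
      also have "\<dots> = (\<Sum>z\<in>X. (\<Sum>s'\<in>X. mat_mult X F (Q s' x) s' z) * G z y)"
        using x y by (simp add: mat_mult_def Q_def)
      also have "\<dots> = (\<Sum>s'\<in>X. mat_mult X (mat_mult X F (Q s' x)) G s' y)"
        unfolding sum_distrib_right using y by (subst sum.swap) (simp add: mat_mult_def)
      finally show ?thesis by (simp only: mat_mult_assoc)
    qed
    have "lin_comb J s (\<lambda>j. mat_mult X (\<pi> (mat_mult X M (Xm j))) (Ym j)) x y
        = (\<Sum>s'\<in>X. lin_comb J s (\<lambda>j. mat_mult X (mat_mult X M (Xm j)) (mat_mult X (Q s' x) (Ym j))) s' y)"
      unfolding lin_comb_def e sum_distrib_left by (rule sum.swap)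
    then show ?thesis by (simp only: avg_def mat_mult_lin_comb_right mat_mult_assoc)
  qed
  \<comment> \<open>\<open>\<pi>\<close> fixes every \<open>Xm j\<close>, so the averaged projection
    sends the identity to the weighted sum of the products of \<open>Xm j\<close> and
    \<open>Ym j\<close>, which is the identity.\<close>
  have unit: "(\<Sum>s'\<in>X. avg (Q s' x) s' y) = id_mat X x y" if x: "x \<in> X" and y: "y \<in> X" for x y
  proof -
    have "restrict_mat X (avg G) = avg G" for G
      by (auto simp: avg_def restrict_mat_def lin_comb_def fun_eq_iff mat_mult_def)
    then have "(\<Sum>s'\<in>X. avg (Q s' x) s' y) = (\<Sum>s'\<in>X. mat_mult X (id_mat X) (avg (Q s' x)) s' y)"
      by (simp add: mat_mult_id_mat[OF X])
    also have "\<dots> = lin_comb J s (\<lambda>j. mat_mult X (\<pi> (mat_mult X (id_mat X) (Xm j))) (Ym j)) x y"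
      by (rule entries[OF x y, symmetric])
    also have "lin_comb J s (\<lambda>j. mat_mult X (\<pi> (mat_mult X (id_mat X) (Xm j))) (Ym j)) = lin_comb J s (\<lambda>j. mat_mult X (Xm j) (Ym j))"
    proof (rule lin_comb_cong)
      fix j assume j: "j \<in> J"
      obtain t where "Xm j = lin_comb B t R" using Xj[OF j] unfolding mat_span_def by blast
      moreover have "restrict_mat X (lin_comb B t R) = lin_comb B t (\<lambda>b. restrict_mat X (R b))"
        by (auto simp: restrict_mat_def lin_comb_def fun_eq_iff)
      moreover have "lin_comb B t (\<lambda>b. restrict_mat X (R b)) = lin_comb B t R"
        by (rule lin_comb_cong) (rule R)
      ultimately show "mat_mult X (\<pi> (mat_mult X (id_mat X) (Xm j))) (Ym j) = mat_mult X (Xm j) (Ym j)"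
        using \<pi>_fix[OF Xj[OF j]] by (simp add: mat_mult_id_mat[OF X])
    qed
    finally show ?thesis by (simp only: one)
  qed
  have "\<Phi> x y = lin_comb J s (\<lambda>j. mat_mult X (\<pi> (mat_mult X \<Phi> (Xm j))) (Ym j)) x y" for x y
  proof (cases "x \<in> X \<and> y \<in> X")
    case True
    \<comment> \<open>Commuting \<open>\<Phi>\<close> past each averaged block leaves the image of
      the identity, followed by \<open>\<Phi>\<close>.\<close>
    then have "lin_comb J s (\<lambda>j. mat_mult X (\<pi> (mat_mult X \<Phi> (Xm j))) (Ym j)) x y = (\<Sum>s'\<in>X. mat_mult X (avg (Q s' x)) \<Phi> s' y)"
      using entries cent by (simp add: avg_def)
    also have "\<dots> = (\<Sum>z\<in>X. (\<Sum>s'\<in>X. avg (Q s' x) s' z) * \<Phi> z y)"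
      unfolding sum_distrib_right using True by (subst sum.swap) (simp add: mat_mult_def)
    also have "\<dots> = mat_mult X (id_mat X) \<Phi> x y"
      using True unit by (simp add: mat_mult_def)
    finally show ?thesis by (simp add: mat_mult_id_mat[OF X] \<Phi>)
  next
    case False
    have "\<Phi> x y = restrict_mat X \<Phi> x y" by (simp only: \<Phi>)
    then have "\<Phi> x y = 0" using False by (auto simp: restrict_mat_def)
    then show ?thesis using False by (auto simp: lin_comb_def mat_mult_def)
  qed
  then have "\<Phi> = lin_comb J s (\<lambda>j. mat_mult X (\<pi> (mat_mult X \<Phi> (Xm j))) (Ym j))" by (intro ext)
  also have "\<dots> \<in> mat_span B R"
    by (rule mat_span_lin_comb) (intro Yj \<pi>_span)
  finally show ?thesis .
qed

section \<open>The wreath product acting on tensor space\<close>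

definition scale_mat :: "'a \<Rightarrow> ('x \<Rightarrow> 'x \<Rightarrow> 'a::comm_ring_1) \<Rightarrow> 'x \<Rightarrow> 'x \<Rightarrow> 'a" where
  "scale_mat c F = (\<lambda>x y. c * F x y)"

lemma mat_mult_scale_mat_left: "mat_mult X (scale_mat c F) G = scale_mat c (mat_mult X F G)"
  by (auto simp: mat_mult_def scale_mat_def fun_eq_iff sum_distrib_left mult.assoc)

lemma mat_mult_scale_mat_right: "mat_mult X F (scale_mat c G) = scale_mat c (mat_mult X F G)"
  by (auto simp: mat_mult_def scale_mat_def fun_eq_iff sum_distrib_left mult_ac)

lemma scale_mat_scale_mat: "scale_mat c (scale_mat e F) = scale_mat (c * e) F"
  by (auto simp: scale_mat_def mult.assoc)

lemma scale_mat_1 [simp]: "scale_mat 1 F = F"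
  by (simp add: scale_mat_def)

locale wreath_tensor =
  fixes m :: "'b::finite \<Rightarrow> 'b \<Rightarrow> 'b \<Rightarrow> 'a::field_char_0" and u :: "'b \<Rightarrow> 'a"
    and p :: "'b \<Rightarrow> bool" and n d :: nat
  assumes as: "assoc_on UNIV m" and parity_additive: "parity_additive p p p m"
    and ev: "\<And>b. u b \<noteq> 0 \<Longrightarrow> \<not> p b"
    and unit_right: "\<And>b c. (\<Sum>a\<in>UNIV. u a * m b a c) = (if b = c then 1 else 0)"
    and unit_left: "\<And>b c. (\<Sum>a\<in>UNIV. u a * m a b c) = (if b = c then 1 else 0)"
begin

abbreviation "X \<equiv> tuples (rows n :: (nat \<times> 'b) set) d"
abbreviation "D \<equiv> tuples (UNIV :: 'b set) d"
abbreviation "perms \<equiv> {\<tau>. \<tau> permutes {..<d}}"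
abbreviation "pv \<equiv> \<lambda>x :: nat \<times> 'b. p (snd x)"
abbreviation "pm \<equiv> \<lambda>x :: nat \<times> nat \<times> 'b. p (snd (snd x))"

definition "Pm \<tau> = restrict_mat X (\<lambda>xs ys. if ys = plist \<tau> xs then lsgn pv \<tau> xs else (0 :: 'a))"
definition "Rm bs = restrict_mat X (\<lambda>xs ys. tensor_coeff pv p (rmul m) xs bs ys)"
definition "Lm ms = restrict_mat X (\<lambda>xs ys. tensor_coeff pm pv (lmul m) ms xs ys)"

lemma finite_X: "finite X" and finite_D: "finite D" and finite_perms: "finite perms"
  by (simp_all add: finite_tuples finite_permutations)

lemma mat_mult_Pm_left:
  assumes "\<tau> \<in> perms" "xs \<in> X" "ys \<in> X"
  shows "mat_mult X (Pm \<tau>) F xs ys = lsgn pv \<tau> xs * F (plist \<tau> xs) ys"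
proof -
  have "(\<Sum>z\<in>X. Pm \<tau> xs z * F z ys) = (\<Sum>z\<in>X. (if z = plist \<tau> xs then 1 else 0) * (lsgn pv \<tau> xs * F z ys))"
    by (rule sum.cong[OF refl]) (use assms in \<open>auto simp: Pm_def restrict_mat_def\<close>)
  also have "\<dots> = lsgn pv \<tau> xs * F (plist \<tau> xs) ys"
    by (rule sum_mult_delta(3)[OF finite_X plist_tuples]) (use assms in auto)
  finally show ?thesis using assms by (simp add: mat_mult_def)
qed

text \<open>Columns are taken in the form \<open>plist \<tau> ys\<close>, which exhausts
  \<open>X\<close> and avoids the inverse permutation.\<close>

lemma mat_mult_Pm_right:
  assumes \<tau>: "\<tau> \<in> perms" and "xs \<in> X" and ys: "ys \<in> X"
  shows "mat_mult X F (Pm \<tau>) xs (plist \<tau> ys) = F xs ys * lsgn pv \<tau> ys"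
proof -
  have inj: "plist \<tau> ys = plist \<tau> z \<longleftrightarrow> z = ys" if "z \<in> X" for z
    using bij_betw_imp_inj_on[OF bij_plist[of \<tau> d "rows n"]] \<tau> ys that by (auto simp: inj_on_def)
  have "(\<Sum>z\<in>X. F xs z * Pm \<tau> z (plist \<tau> ys)) = (\<Sum>z\<in>X. (F xs z * lsgn pv \<tau> z) * (if z = ys then 1 else 0))"
    by (rule sum.cong[OF refl]) (use \<tau> ys plist_tuples[of \<tau> d ys "rows n"] inj in \<open>auto simp: Pm_def restrict_mat_def\<close>)
  also have "\<dots> = F xs ys * lsgn pv \<tau> ys"
    by (rule sum_mult_delta(1)[OF finite_X ys])
  finally show ?thesis using assms plist_tuples[of \<tau> d ys "rows n"] by (simp add: mat_mult_def)
qed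

lemma plist_surj:
  assumes "\<tau> \<in> perms" "ys \<in> X"
  obtains zs where "zs \<in> X" "ys = plist \<tau> zs"
  using bij_betw_imp_surj_on[OF bij_plist[of \<tau> d "rows n"]] assms by blast

lemma mat_eqI:
  assumes "restrict_mat X F = F" "restrict_mat X G = G" "\<And>xs ys. xs \<in> X \<Longrightarrow> ys \<in> X \<Longrightarrow> F xs ys = G xs ys"
  shows "F = G"
proof -
  have "restrict_mat X F = restrict_mat X G" using assms(3) by (auto simp: restrict_mat_def fun_eq_iff)
  then show ?thesis using assms(1,2) by simp
qed

lemma restrict_mat_mats [simp]:
  "restrict_mat X (Pm \<tau>) = Pm \<tau>" "restrict_mat X (Rm bs) = Rm bs" "restrict_mat X (Lm ms) = Lm ms"
  by (simp_all add: Pm_def Rm_def Lm_def)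

lemma restrict_mat_scale_mat: "restrict_mat X (scale_mat c F) = scale_mat c (restrict_mat X F)"
  by (auto simp: restrict_mat_def scale_mat_def fun_eq_iff)

lemma restrict_mat_lin_comb: "restrict_mat X (lin_comb J s F) = lin_comb J s (\<lambda>j. restrict_mat X (F j))"
  by (auto simp: restrict_mat_def lin_comb_def fun_eq_iff)

lemma Pm_comp:
  assumes "\<tau> \<in> perms" "\<sigma> \<in> perms"
  shows "mat_mult X (Pm \<tau>) (Pm \<sigma>) = Pm (\<tau> \<circ> \<sigma>)"
proof (rule mat_eqI)
  fix xs ys assume xs: "xs \<in> X" and ys: "ys \<in> X"
  have "mat_mult X (Pm \<tau>) (Pm \<sigma>) xs ys = lsgn pv \<tau> xs * Pm \<sigma> (plist \<tau> xs) ys"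
    by (rule mat_mult_Pm_left[OF assms(1) xs ys])
  then show "mat_mult X (Pm \<tau>) (Pm \<sigma>) xs ys = Pm (\<tau> \<circ> \<sigma>) xs ys"
    using xs ys assms plist_tuples[of \<tau> d xs "rows n"]
    by (auto simp: Pm_def restrict_mat_def plist_plist lsgn_comp tuples_length[OF xs])
qed simp_all

lemma Pm_id: "Pm id = id_mat X"
  by (auto simp: Pm_def restrict_mat_def plist_id lsgn_id fun_eq_iff)

lemma Rm_comp:
  assumes a: "a \<in> D" and b: "b \<in> D"
  shows "mat_mult X (Rm a) (Rm b) = lin_comb D (tensor_coeff p p m a b) Rm"
proof (rule mat_eqI)
  fix xs ys assume xs: "xs \<in> X" and ys: "ys \<in> X"
  have "(\<Sum>ws\<in>X. tensor_coeff pv p (rmul m) xs a ws * tensor_coeff pv p (rmul m) ws b ys)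
      = (\<Sum>ws\<in>D. tensor_coeff p p m a b ws * tensor_coeff pv p (rmul m) xs ws ys)"
  proof (rule tensor_coeff_assoc[OF parity_additive_rmul[OF parity_additive] parity_additive tuples_length[OF xs] tuples_length[OF a]])
    fix r assume "r < d"
    then have "fst (xs ! r) < n" using tuples_nth[OF xs, of r] by auto
    then show "(\<Sum>w\<in>rows n. rmul m (xs ! r) (a ! r) w * rmul m w (b ! r) (ys ! r))
        = (\<Sum>w\<in>UNIV. m (a ! r) (b ! r) w * rmul m (xs ! r) w (ys ! r))"
      by (rule rmul_comp[OF as])
  qed
  then show "mat_mult X (Rm a) (Rm b) xs ys = lin_comb D (tensor_coeff p p m a b) Rm xs ys"
    using xs ys by (simp add: mat_mult_def lin_comb_def Rm_def restrict_mat_def)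
qed (simp_all add: restrict_mat_lin_comb)

lemma Rm_unit: "lin_comb D (\<lambda>bs. \<Prod>r<d. u (bs ! r)) Rm = id_mat X"
proof (rule mat_eqI)
  fix xs ys assume xs: "xs \<in> X" and ys: "ys \<in> X"
  have "(\<Sum>b\<in>UNIV. u b * rmul m x b y) = (if x = y then 1 else 0)" for x y :: "nat \<times> 'b"
  proof (cases "fst x = fst y")
    case True
    then show ?thesis using unit_right[of "snd x" "snd y"] by (simp add: rmul_def prod_eq_iff)
  qed (auto simp: rmul_def)
  then show "lin_comb D (\<lambda>bs. \<Prod>r<d. u (bs ! r)) Rm xs ys = id_mat X xs ys"
    using xs ys tensor_right_unit[of u p "rows n" "rmul m" xs d ys pv, OF ev]
    by (simp add: lin_comb_def Rm_def restrict_mat_def)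
qed (simp_all add: restrict_mat_lin_comb)

text \<open>Evaluation at columns \<open>plist \<tau> zs\<close> turns this commutation relation of
  the wreath product into \<open>tensor_coeff_plist\<close>.\<close>

lemma Rm_Pm:
  assumes \<tau>: "\<tau> \<in> perms" and b: "b \<in> D"
  shows "mat_mult X (Rm b) (Pm \<tau>) = scale_mat (lsgn p \<tau> b) (mat_mult X (Pm \<tau>) (Rm (plist \<tau> b)))"
proof (rule mat_eqI)
  fix xs ys assume xs: "xs \<in> X" and "ys \<in> X"
  then obtain zs where zs: "zs \<in> X" and ys: "ys = plist \<tau> zs" using plist_surj[OF \<tau>] by blast
  have "plist \<tau> xs \<in> X" "plist \<tau> zs \<in> X" using \<tau> xs zs by (auto intro: plist_tuples)
  then show "mat_mult X (Rm b) (Pm \<tau>) xs ys = scale_mat (lsgn p \<tau> b) (mat_mult X (Pm \<tau>) (Rm (plist \<tau> b))) xs ys"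
    using tensor_coeff_plist[OF parity_additive_rmul[OF parity_additive], of \<tau> d xs b zs] \<tau> xs zs
    by (simp add: ys mat_mult_Pm_right mat_mult_Pm_left scale_mat_def Rm_def restrict_mat_def tuples_length[OF xs] tuples_length[OF b]
        tuples_length[OF zs] mult_ac)
qed (simp_all add: restrict_mat_scale_mat)

text \<open>Read as a conjugation formula: conjugating by \<open>Pm \<tau>\<close> realizes the
  signed place permutation of a tensor of matrices.\<close>

lemma Lm_Pm:
  assumes \<tau>: "\<tau> \<in> perms" and ms: "length ms = d"
  shows "mat_mult X (Lm ms) (Pm \<tau>) = scale_mat (lsgn pm \<tau> ms) (mat_mult X (Pm \<tau>) (Lm (plist \<tau> ms)))"
proof (rule mat_eqI)
  fix xs ys assume xs: "xs \<in> X" and "ys \<in> X"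
  then obtain zs where zs: "zs \<in> X" and ys: "ys = plist \<tau> zs" using plist_surj[OF \<tau>] by blast
  have "plist \<tau> xs \<in> X" "plist \<tau> zs \<in> X" using \<tau> xs zs by (auto intro: plist_tuples)
  then show "mat_mult X (Lm ms) (Pm \<tau>) xs ys = scale_mat (lsgn pm \<tau> ms) (mat_mult X (Pm \<tau>) (Lm (plist \<tau> ms))) xs ys"
    using tensor_coeff_plist[OF parity_additive_lmul[OF parity_additive], of \<tau> d ms xs zs] \<tau> xs zs
    by (simp add: ys mat_mult_Pm_right mat_mult_Pm_left scale_mat_def Lm_def restrict_mat_def tuples_length[OF xs] ms
        tuples_length[OF zs] mult_ac)
qed (simp_all add: restrict_mat_scale_mat)

lemma perms_inv: "\<tau> \<in> perms \<Longrightarrow> inv \<tau> \<in> perms"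
  by (simp add: permutes_inv)

lemma perms_comp: "\<tau> \<in> perms \<Longrightarrow> \<sigma> \<in> perms \<Longrightarrow> \<tau> \<circ> \<sigma> \<in> perms"
  by (simp add: permutes_compose)

lemma Pm_inv:
  assumes "\<tau> \<in> perms"
  shows "mat_mult X (Pm \<tau>) (Pm (inv \<tau>)) = id_mat X" "mat_mult X (Pm (inv \<tau>)) (Pm \<tau>) = id_mat X"
  using assms by (simp_all only: Pm_comp[OF assms perms_inv[OF assms]] Pm_comp[OF perms_inv[OF assms] assms]
      permutes_inv_o[of \<tau> "{..<d}"] mem_Collect_eq Pm_id)

end

section \<open>Averaging over the wreath product\<close>

locale wreath_semisimple = wreath_tensor m u p n d
  for m :: "'b::finite \<Rightarrow> 'b \<Rightarrow> 'b \<Rightarrow> 'a::field_char_0" and u p n d +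
  fixes g :: "'b \<Rightarrow> 'b \<Rightarrow> 'a"
  assumes g: "\<And>a c. (\<Sum>b\<in>UNIV. gram UNIV m a b * g b c) = (if a = c then 1 else 0)"
begin

abbreviation "cD \<equiv> tensor_coeff p p m"

text \<open>Coefficients of the Casimir element of the tensor power of A, with the sign required by
  \<open>gram_tensor_inverse\<close>.\<close>

definition gD :: "'b list \<Rightarrow> 'b list \<Rightarrow> 'a" where
  "gD ys zs = ksgn d (\<lambda>r. p (ys ! r)) (\<lambda>r. p (ys ! r)) * (\<Prod>r<d. g (ys ! r) (zs ! r))"

lemma gD_inverse: "xs \<in> D \<Longrightarrow> zs \<in> D \<Longrightarrow> (\<Sum>ys\<in>D. gram D cD xs ys * gD ys zs) = (if xs = zs then 1 else 0)"
  unfolding gD_def by (rule gram_tensor_inverse[OF parity_additive g])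

definition avgD :: "((nat \<times> 'b) list \<Rightarrow> (nat \<times> 'b) list \<Rightarrow> 'a) \<Rightarrow> (nat \<times> 'b) list \<Rightarrow> (nat \<times> 'b) list \<Rightarrow> 'a" where
  "avgD Q = lin_comb D (\<lambda>_. 1) (\<lambda>x. lin_comb D (gD x) (\<lambda>y. mat_mult X (Rm x) (mat_mult X Q (Rm y))))"

text \<open>Multiplying \<open>Rm z\<close> into the adjacent leg of the Casimir element, on the
  left or on the right, produces the two sides of \<open>casimir_central\<close>.\<close>

lemma avgD_commute:
  assumes z: "z \<in> D"
  shows "mat_mult X (Rm z) (avgD Q) = mat_mult X (avgD Q) (Rm z)"
proof (intro ext)
  fix s t
  define T where "T x y = mat_mult X (Rm x) (mat_mult X Q (Rm y)) s t" for x y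
  have "mat_mult X (Rm z) (avgD Q)
      = lin_comb D (\<lambda>_. 1) (\<lambda>x. lin_comb D (gD x) (\<lambda>y. lin_comb D (cD z x) (\<lambda>x'. mat_mult X (Rm x') (mat_mult X Q (Rm y)))))"
    unfolding avgD_def mat_mult_lin_comb_right
    by (intro lin_comb_cong) (simp add: mat_mult_assoc[symmetric] Rm_comp[OF z] mat_mult_lin_comb_left)
  then have "mat_mult X (Rm z) (avgD Q) s t = (\<Sum>x\<in>D. \<Sum>y\<in>D. \<Sum>x'\<in>D. cD z x x' * gD x y * T x' y)"
    by (simp add: lin_comb_def T_def sum_distrib_left mult_ac)
  also have "\<dots> = (\<Sum>y\<in>D. \<Sum>x\<in>D. \<Sum>x'\<in>D. cD z x x' * gD x y * T x' y)"
    by (rule sum.swap)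
  also have "\<dots> = (\<Sum>y\<in>D. \<Sum>x'\<in>D. (\<Sum>x\<in>D. cD z x x' * gD x y) * T x' y)"
    unfolding sum_distrib_right by (rule sum.cong[OF refl], rule sum.swap)
  also have "\<dots> = (\<Sum>y\<in>D. \<Sum>x'\<in>D. (\<Sum>y'\<in>D. gD x' y' * cD y' z y) * T x' y)"
    by (intro sum.cong[OF refl], subst casimir_central[OF finite_D assoc_on_tensor[OF as parity_additive] gD_inverse z])
      simp_all
  also have "\<dots> = (\<Sum>x'\<in>D. \<Sum>y\<in>D. \<Sum>y'\<in>D. gD x' y' * cD y' z y * T x' y)"
    unfolding sum_distrib_right by (rule sum.swap)
  also have "\<dots> = (\<Sum>x'\<in>D. \<Sum>y'\<in>D. \<Sum>y\<in>D. gD x' y' * cD y' z y * T x' y)"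
    by (rule sum.cong[OF refl], rule sum.swap)
  also have "\<dots> = lin_comb D (\<lambda>_. 1) (\<lambda>x. lin_comb D (gD x) (\<lambda>y'. lin_comb D (cD y' z) (\<lambda>y. mat_mult X (Rm x) (mat_mult X Q (Rm y))))) s t"
    by (simp add: lin_comb_def T_def sum_distrib_left mult_ac)
  also have "lin_comb D (\<lambda>_. 1) (\<lambda>x. lin_comb D (gD x) (\<lambda>y'. lin_comb D (cD y' z) (\<lambda>y. mat_mult X (Rm x) (mat_mult X Q (Rm y)))))
      = mat_mult X (avgD Q) (Rm z)"
    unfolding avgD_def mat_mult_lin_comb_left
    by (intro lin_comb_cong) (simp add: mat_mult_assoc Rm_comp[OF _ z] mat_mult_lin_comb_right)
  finally show "mat_mult X (Rm z) (avgD Q) s t = mat_mult X (avgD Q) (Rm z) s t" .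
qed

lemma avgD_id_mat: "avgD (id_mat X) = id_mat X"
proof -
  have "avgD (id_mat X) = lin_comb D (\<lambda>_. 1) (\<lambda>x. lin_comb D (gD x) (\<lambda>y. lin_comb D (cD x y) Rm))"
    unfolding avgD_def by (intro lin_comb_cong) (simp add: mat_mult_id_mat[OF finite_X] Rm_comp)
  also have "\<dots> = lin_comb D (\<lambda>w. \<Sum>x\<in>D. \<Sum>y\<in>D. gD x y * cD x y w) Rm"
  proof (intro ext)
    fix s t
    have "(\<Sum>x\<in>D. \<Sum>y\<in>D. \<Sum>w\<in>D. gD x y * cD x y w * Rm w s t)
        = (\<Sum>x\<in>D. \<Sum>w\<in>D. \<Sum>y\<in>D. gD x y * cD x y w * Rm w s t)"
      by (rule sum.cong[OF refl], rule sum.swap)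
    also have "\<dots> = (\<Sum>w\<in>D. \<Sum>x\<in>D. \<Sum>y\<in>D. gD x y * cD x y w * Rm w s t)"
      by (rule sum.swap)
    finally show "lin_comb D (\<lambda>_. 1) (\<lambda>x. lin_comb D (gD x) (\<lambda>y. lin_comb D (cD x y) Rm)) s t
        = lin_comb D (\<lambda>w. \<Sum>x\<in>D. \<Sum>y\<in>D. gD x y * cD x y w) Rm s t"
      by (simp add: lin_comb_def sum_distrib_left sum_distrib_right mult.assoc)
  qed
  also have "\<dots> = lin_comb D (\<lambda>bs. \<Prod>r<d. u (bs ! r)) Rm"
  proof -
    have "(\<Sum>x\<in>D. \<Sum>y\<in>D. gD x y * cD x y w) = (\<Prod>r<d. u (w ! r))" if w: "w \<in> D" for w
      by (rule casimir_unit[OF finite_D assoc_on_tensor[OF as parity_additive] gD_inverse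
            tensor_right_unit[of u p UNIV m, OF ev unit_right] w])
    then show ?thesis by (simp add: lin_comb_def)
  qed
  finally show ?thesis by (simp only: Rm_unit)
qed

definition avgS :: "((nat \<times> 'b) list \<Rightarrow> (nat \<times> 'b) list \<Rightarrow> 'a) \<Rightarrow> (nat \<times> 'b) list \<Rightarrow> (nat \<times> 'b) list \<Rightarrow> 'a" where
  "avgS N = lin_comb perms (\<lambda>_. 1 / fact d) (\<lambda>\<tau>. mat_mult X (Pm \<tau>) (mat_mult X N (Pm (inv \<tau>))))"

lemma avgS_Pm:
  assumes \<sigma>: "\<sigma> \<in> perms"
  shows "mat_mult X (Pm \<sigma>) (avgS N) = mat_mult X (avgS N) (Pm \<sigma>)"
proof -
  have "mat_mult X (Pm \<sigma>) (avgS N) = lin_comb perms (\<lambda>_. 1 / fact d) (\<lambda>\<tau>. mat_mult X (Pm (\<sigma> \<circ> \<tau>)) (mat_mult X N (Pm (inv \<tau>))))"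
    unfolding avgS_def mat_mult_lin_comb_right by (rule lin_comb_cong) (simp add: mat_mult_assoc[symmetric] Pm_comp \<sigma>[simplified])
  also have "\<dots> = lin_comb perms (\<lambda>_. 1 / fact d) (\<lambda>\<rho>. mat_mult X (Pm \<rho>) (mat_mult X N (Pm (inv \<rho> \<circ> \<sigma>))))"
  proof (intro ext)
    fix s t
    have bij: "bij_betw (\<lambda>\<tau>. \<sigma> \<circ> \<tau>) perms perms"
      by (rule bij_betw_byWitness[where f' = "\<lambda>\<tau>. inv \<sigma> \<circ> \<tau>"])
        (use \<sigma> in \<open>auto simp: o_assoc permutes_inv_o permutes_inv permutes_compose\<close>)
    have "inv (\<sigma> \<circ> \<tau>) \<circ> \<sigma> = inv \<tau>" if "\<tau> \<in> perms" for \<tau>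
      using that \<sigma> by (simp add: o_inv_distrib permutes_bij o_assoc[symmetric] permutes_inv_o)
    then show "lin_comb perms (\<lambda>_. 1 / fact d) (\<lambda>\<tau>. mat_mult X (Pm (\<sigma> \<circ> \<tau>)) (mat_mult X N (Pm (inv \<tau>)))) s t
        = lin_comb perms (\<lambda>_. 1 / fact d) (\<lambda>\<rho>. mat_mult X (Pm \<rho>) (mat_mult X N (Pm (inv \<rho> \<circ> \<sigma>)))) s t"
      unfolding lin_comb_def sum.reindex_bij_betw[OF bij, symmetric,
        of "\<lambda>\<rho>. 1 / fact d * mat_mult X (Pm \<rho>) (mat_mult X N (Pm (inv \<rho> \<circ> \<sigma>))) s t"] by simp
  qed
  also have "\<dots> = mat_mult X (avgS N) (Pm \<sigma>)"
    unfolding avgS_def mat_mult_lin_comb_left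
    by (rule lin_comb_cong) (use \<sigma> in \<open>simp add: mat_mult_assoc Pm_comp permutes_inv\<close>)
  finally show ?thesis .
qed

text \<open>\<open>Rm z\<close> passes \<open>Pm \<tau>\<close> at the price of a sign and a
  permutation of z, and then passes the inverse permutation. Both changes cancel because
  \<open>\<tau> \<circ> inv \<tau>\<close> is the identity.\<close>

lemma avgS_Rm:
  assumes N: "\<And>z. z \<in> D \<Longrightarrow> mat_mult X (Rm z) N = mat_mult X N (Rm z)" and z: "z \<in> D"
  shows "mat_mult X (Rm z) (avgS N) = mat_mult X (avgS N) (Rm z)"
  unfolding avgS_def mat_mult_lin_comb_left mat_mult_lin_comb_right
proof (rule lin_comb_cong)
  fix \<tau> assume \<tau>: "\<tau> \<in> perms"
  note \<tau>' = perms_inv[OF \<tau>]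
  have z': "plist \<tau> z \<in> D" using \<tau> z by (auto intro: plist_tuples)
  have zz: "plist (inv \<tau>) (plist \<tau> z) = z"
    using plist_inv(1)[of \<tau> z] \<tau> by (simp add: tuples_length[OF z])
  have "(1 :: 'a) = lsgn p (\<tau> \<circ> inv \<tau>) z"
    using \<tau> by (simp add: permutes_inv_o lsgn_id)
  also have "\<dots> = lsgn p \<tau> z * lsgn p (inv \<tau>) (plist \<tau> z)"
    by (rule lsgn_comp) (use \<tau> \<tau>' in \<open>simp_all add: tuples_length[OF z]\<close>)
  finally have e: "lsgn p \<tau> z * lsgn p (inv \<tau>) (plist \<tau> z) = (1 :: 'a)" by simp
  have "mat_mult X (Rm z) (mat_mult X (Pm \<tau>) (mat_mult X N (Pm (inv \<tau>))))
      = scale_mat (lsgn p \<tau> z) (mat_mult X (Pm \<tau>) (mat_mult X (mat_mult X (Rm (plist \<tau> z)) N) (Pm (inv \<tau>))))"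
    by (simp only: mat_mult_assoc[symmetric] Rm_Pm[OF \<tau> z] mat_mult_scale_mat_left)
  also have "\<dots> = scale_mat (lsgn p \<tau> z) (mat_mult X (Pm \<tau>) (mat_mult X N (mat_mult X (Rm (plist \<tau> z)) (Pm (inv \<tau>)))))"
    by (simp only: N[OF z'] mat_mult_assoc)
  also have "\<dots> = mat_mult X (Pm \<tau>) (mat_mult X N (mat_mult X (Pm (inv \<tau>)) (Rm z)))"
    by (simp only: Rm_Pm[OF \<tau>' z'] mat_mult_scale_mat_right scale_mat_scale_mat e scale_mat_1 zz)
  finally show "mat_mult X (Rm z) (mat_mult X (Pm \<tau>) (mat_mult X N (Pm (inv \<tau>))))
      = mat_mult X (mat_mult X (Pm \<tau>) (mat_mult X N (Pm (inv \<tau>)))) (Rm z)"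
    by (simp only: mat_mult_assoc)
qed

lemma avgS_fix:
  assumes N: "\<And>\<tau>. \<tau> \<in> perms \<Longrightarrow> mat_mult X (Pm \<tau>) N = mat_mult X N (Pm \<tau>)" and "restrict_mat X N = N"
  shows "avgS N = N"
proof -
  have "avgS N = lin_comb perms (\<lambda>_. 1 / fact d) (\<lambda>\<tau>. N)"
    unfolding avgS_def
    by (rule lin_comb_cong) (simp only: mat_mult_assoc[symmetric] N, simp only: mat_mult_assoc Pm_inv mat_mult_id_mat[OF finite_X] assms(2))
  also have "\<dots> = N"
    by (auto simp: lin_comb_def fun_eq_iff card_permutations[OF card_lessThan finite_lessThan])
  finally show ?thesis .
qed

section \<open>The image of the wreath product and its double centralizer\<close>

abbreviation "Bw \<equiv> perms \<times> D"
abbreviation "Wm \<equiv> \<lambda>(\<tau>, b). mat_mult X (Pm \<tau>) (Rm b)"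

text \<open>Products are straightened to the form permutation first, algebra part second: the two
  algebra parts are multiplied, and \<open>\<sigma>\<close> is moved left through the
  result.\<close>

lemma Wm_closed:
  assumes F: "F \<in> mat_span Bw Wm" and y: "y \<in> D" and \<sigma>: "\<sigma> \<in> perms"
  shows "mat_mult X F (mat_mult X (Rm y) (Pm \<sigma>)) \<in> mat_span Bw Wm"
proof -
  obtain s where s: "F = lin_comb Bw s Wm" using F unfolding mat_span_def by blast
  have "mat_mult X (Wm k) (mat_mult X (Rm y) (Pm \<sigma>)) \<in> mat_span Bw Wm" if k: "k \<in> Bw" for k
  proof -
    obtain \<tau> b where kk: "k = (\<tau>, b)" and \<tau>: "\<tau> \<in> perms" and b: "b \<in> D" using k by blast
    have "mat_mult X (Wm k) (mat_mult X (Rm y) (Pm \<sigma>)) = mat_mult X (Pm \<tau>) (mat_mult X (mat_mult X (Rm b) (Rm y)) (Pm \<sigma>))"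
      by (simp add: kk mat_mult_assoc)
    also have "\<dots> = lin_comb D (cD b y) (\<lambda>c. mat_mult X (Pm \<tau>) (mat_mult X (Rm c) (Pm \<sigma>)))"
      by (simp only: Rm_comp[OF b y] mat_mult_lin_comb_left mat_mult_lin_comb_right)
    also have "\<dots> \<in> mat_span Bw Wm"
    proof (rule mat_span_lin_comb)
      fix c assume c: "c \<in> D"
      have "mat_mult X (Pm \<tau>) (mat_mult X (Rm c) (Pm \<sigma>)) = scale_mat (lsgn p \<sigma> c) (Wm (\<tau> \<circ> \<sigma>, plist \<sigma> c))"
        by (simp add: Rm_Pm[OF \<sigma> c] mat_mult_scale_mat_right mat_mult_assoc[symmetric] Pm_comp[OF \<tau> \<sigma>])
      moreover have "Wm (\<tau> \<circ> \<sigma>, plist \<sigma> c) \<in> mat_span Bw Wm"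
        by (rule mat_span_base[OF _ SigmaI[OF perms_comp[OF \<tau> \<sigma>] plist_tuples]])
          (use \<sigma> c in \<open>simp_all add: finite_perms finite_D\<close>)
      ultimately show "mat_mult X (Pm \<tau>) (mat_mult X (Rm c) (Pm \<sigma>)) \<in> mat_span Bw Wm"
        using mat_span_scale unfolding scale_mat_def by metis
    qed
    finally show ?thesis .
  qed
  then show ?thesis unfolding s mat_mult_lin_comb_left by (rule mat_span_lin_comb)
qed

lemma commuting_in_span:
  assumes \<Phi>: "restrict_mat X \<Phi> = \<Phi>"
    and comm: "\<And>\<Psi>. restrict_mat X \<Psi> = \<Psi> \<Longrightarrow> (\<And>z. z \<in> D \<Longrightarrow> mat_mult X (Rm z) \<Psi> = mat_mult X \<Psi> (Rm z))
      \<Longrightarrow> (\<And>\<tau>. \<tau> \<in> perms \<Longrightarrow> mat_mult X (Pm \<tau>) \<Psi> = mat_mult X \<Psi> (Pm \<tau>)) \<Longrightarrow> mat_mult X \<Phi> \<Psi> = mat_mult X \<Psi> \<Phi>"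
  shows "\<Phi> \<in> mat_span Bw Wm"
proof -
  \<comment> \<open>Index set, weights and factors of a separability idempotent of the wreath
    product: the Casimir element of the tensor power flanked by each permutation and its inverse,
    divided by d!.\<close>
  define J where "J = perms \<times> (D \<times> D)"
  define s :: "(nat \<Rightarrow> nat) \<times> 'b list \<times> 'b list \<Rightarrow> 'a" where "s = (\<lambda>(\<tau>, x, y). 1 / fact d * gD x y)"
  define Xj where "Xj = (\<lambda>(\<tau>, x :: 'b list, y :: 'b list). mat_mult X (Pm \<tau>) (Rm x))"
  define Yj where "Yj = (\<lambda>(\<tau> :: nat \<Rightarrow> nat, x :: 'b list, y). mat_mult X (Rm y) (Pm (inv \<tau>)))"
  have avg: "lin_comb J s (\<lambda>j. mat_mult X (Xj j) (mat_mult X Q (Yj j))) = avgS (avgD Q)" for Q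
  proof -
    have "avgS (avgD Q) = lin_comb perms (\<lambda>_. 1 / fact d) (\<lambda>\<tau>. lin_comb D (\<lambda>_. 1) (\<lambda>x. lin_comb D (gD x)
        (\<lambda>y. mat_mult X (mat_mult X (Pm \<tau>) (Rm x)) (mat_mult X Q (mat_mult X (Rm y) (Pm (inv \<tau>)))))))"
      unfolding avgS_def avgD_def by (simp only: mat_mult_lin_comb_left mat_mult_lin_comb_right mat_mult_assoc)
    also have "\<dots> = lin_comb J s (\<lambda>j. mat_mult X (Xj j) (mat_mult X Q (Yj j)))"
      unfolding lin_comb_lin_comb J_def s_def Xj_def Yj_def by (simp add: lin_comb_def case_prod_beta)
    finally show ?thesis by simp
  qed
  have restrict_mat_avgS: "restrict_mat X (avgS N) = avgS N" for N
    by (simp add: avgS_def restrict_mat_lin_comb)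
  show ?thesis
  proof (rule double_centralizer[where J = J and s = s and Xm = Xj and Ym = Yj, OF finite_X])
    show "finite Bw" by (simp add: finite_perms finite_D)
    show "restrict_mat X (Wm b) = Wm b" for b by (simp add: case_prod_beta)
    show "Xj j \<in> mat_span Bw Wm" if "j \<in> J" for j
    proof -
      have "Wm (fst j, fst (snd j)) \<in> mat_span Bw Wm"
        by (rule mat_span_base) (use that in \<open>auto simp: J_def finite_perms finite_D\<close>)
      then show ?thesis by (simp add: Xj_def case_prod_beta)
    qed
    show "mat_mult X F (Yj j) \<in> mat_span Bw Wm" if "j \<in> J" "F \<in> mat_span Bw Wm" for j F
      using that Wm_closed[OF that(2), of "snd (snd j)" "inv (fst j)"]
      by (auto simp: J_def Yj_def permutes_inv)
    have "restrict_mat X (Yj j) = Yj j" for j by (simp add: Yj_def case_prod_beta)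
    then have "lin_comb J s (\<lambda>j. mat_mult X (Xj j) (Yj j)) = avgS (avgD (id_mat X))"
      unfolding avg[symmetric] by (simp add: mat_mult_id_mat[OF finite_X])
    also have "\<dots> = id_mat X"
      unfolding avgD_id_mat by (rule avgS_fix) (simp_all add: mat_mult_id_mat[OF finite_X])
    finally show "lin_comb J s (\<lambda>j. mat_mult X (Xj j) (Yj j)) = id_mat X" .
    show "mat_mult X \<Phi> (lin_comb J s (\<lambda>j. mat_mult X (Xj j) (mat_mult X Q (Yj j))))
        = mat_mult X (lin_comb J s (\<lambda>j. mat_mult X (Xj j) (mat_mult X Q (Yj j)))) \<Phi>" for Q
      unfolding avg by (rule comm) (auto intro: restrict_mat_avgS avgS_Pm avgS_Rm avgD_commute)
    show "restrict_mat X \<Phi> = \<Phi>" by (rule \<Phi>)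
  qed
qed

end

section \<open>Endomorphisms of the wreath product module\<close>

context wreath_semisimple
begin

abbreviation "Ml \<equiv> tuples ({..<n} \<times> (rows n :: (nat \<times> 'b) set)) d"

text \<open>Matrix units with rows and entries from \<open>zs\<close>; their column indices are the
  rows of \<open>xs\<close>, as needed for a nonzero action on \<open>xs\<close>.\<close>

definition with_columns :: "(nat \<times> 'b) list \<Rightarrow> (nat \<times> 'b) list \<Rightarrow> (nat \<times> nat \<times> 'b) list" where
  "with_columns zs xs = map2 (\<lambda>z x. (fst z, fst x, snd z)) zs xs"

lemma nth_with_columns: "length zs = d \<Longrightarrow> length xs = d \<Longrightarrow> r < d \<Longrightarrow>
    with_columns zs xs ! r = (fst (zs ! r), fst (xs ! r), snd (zs ! r))"
  by (simp add: with_columns_def)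

lemma length_with_columns: "length zs = d \<Longrightarrow> length xs = d \<Longrightarrow> length (with_columns zs xs) = d"
  by (simp add: with_columns_def)

lemma with_columns_Ml:
  assumes "zs \<in> X" "xs \<in> X"
  shows "with_columns zs xs \<in> Ml"
proof (rule tuples_I)
  fix r assume "r < d"
  then show "with_columns zs xs ! r \<in> {..<n} \<times> rows n"
    using tuples_nth[OF assms(1), of r] tuples_nth[OF assms(2), of r] assms
    by (auto simp: nth_with_columns tuples_length mem_Times_iff)
qed (use assms in \<open>simp add: length_with_columns tuples_length\<close>)

lemma zip_X:
  assumes "xs \<in> X" "us \<in> D"
  shows "zip (map fst xs) us \<in> X"
proof (rule tuples_I)
  fix r assume "r < d"
  then show "zip (map fst xs) us ! r \<in> rows n"
    using tuples_nth[OF assms(1), of r] assms by (auto simp: tuples_length mem_Times_iff)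
qed (use assms in \<open>simp add: tuples_length\<close>)

definition "drop_columns = (\<lambda>ms :: (nat \<times> nat \<times> 'b) list. map (\<lambda>(i, j, b). (i, b)) ms)"

lemma drop_columns_with_columns: "length zs = d \<Longrightarrow> length xs = d \<Longrightarrow> drop_columns (with_columns zs xs) = zs"
  by (rule nth_equalityI) (simp_all add: drop_columns_def length_with_columns nth_with_columns)

lemma mids_with_columns:
  "length zs = d \<Longrightarrow> length xs = d \<Longrightarrow> map (\<lambda>k. fst (snd k)) (with_columns zs xs) = map fst xs"
  by (rule nth_equalityI) (simp_all add: length_with_columns nth_with_columns)

lemma with_columns_drop_columns:
  assumes "length ms = d" "length xs = d" "\<And>r. r < d \<Longrightarrow> fst (snd (ms ! r)) = fst (xs ! r)"
  shows "with_columns (drop_columns ms) xs = ms"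
proof (rule nth_equalityI)
  show "length (with_columns (drop_columns ms) xs) = length ms" using assms by (simp add: length_with_columns drop_columns_def)
  fix r assume "r < length (with_columns (drop_columns ms) xs)"
  then have "r < d" using assms by (simp add: length_with_columns drop_columns_def)
  then show "with_columns (drop_columns ms) xs ! r = ms ! r"
    using assms by (simp add: nth_with_columns drop_columns_def case_prod_beta prod_eq_iff)
qed

lemma drop_columns_X: "ms \<in> Ml \<Longrightarrow> drop_columns ms \<in> X"
  by (auto simp: tuples_def drop_columns_def)

text \<open>A matrix unit in row i with entry b sends a vector with entry a to row i with entry ba,
  which is also (i, b) times a. Parities agree letter by letter, so the Koszul signs
  coincide.\<close>

lemma tensor_coeff_with_columns:
  assumes "length zs = d" "length xs = d"
  shows "tensor_coeff pm pv (lmul m) (with_columns zs xs) xs ys = tensor_coeff pv p (rmul m) zs (map snd xs) ys"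
proof -
  have "(ksgn d (\<lambda>r. pm (with_columns zs xs ! r)) (\<lambda>r. pv (xs ! r)) :: 'a)
      = ksgn d (\<lambda>r. pv (zs ! r)) (\<lambda>r. p (map snd xs ! r))"
    by (rule ksgn_cong) (simp_all add: assms nth_with_columns)
  moreover have "(\<Prod>r<d. lmul m (with_columns zs xs ! r) (xs ! r) (ys ! r)) = (\<Prod>r<d. rmul m (zs ! r) (map snd xs ! r) (ys ! r))"
    by (rule prod.cong[OF refl]) (simp add: assms nth_with_columns lmul_def rmul_def)
  ultimately show ?thesis by (simp add: tensor_coeff_def length_with_columns assms)
qed

text \<open>A basis tensor is the tensor of unit entries in the same rows, multiplied on the right
  by its own entries; the unit is even and costs no sign.\<close>

lemma unit_generates:
  assumes xs: "xs \<in> X" and zs: "zs \<in> X"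
  shows "(\<Sum>us\<in>D. (\<Prod>r<d. u (us ! r)) * Rm (map snd xs) (zip (map fst xs) us) zs)
      = (if xs = zs then 1 else 0)"
proof -
  note l = tuples_length[OF xs] tuples_length[OF zs]
    note zip_X = zip_X[OF xs]
  have "Rm (map snd xs) (zip (map fst xs) us) zs = ksgn d (\<lambda>r. p (us ! r)) (\<lambda>r. p (map snd xs ! r))
      * (\<Prod>r<d. rmul m (fst (xs ! r), us ! r) (snd (xs ! r)) (zs ! r))" if us: "us \<in> D" for us
  proof -
    have "(ksgn d (\<lambda>r. pv (zip (map fst xs) us ! r)) (\<lambda>r. p (map snd xs ! r)) :: 'a)
        = ksgn d (\<lambda>r. p (us ! r)) (\<lambda>r. p (map snd xs ! r))"
      by (rule ksgn_cong) (simp_all add: l tuples_length[OF us])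
    moreover have "(\<Prod>r<d. rmul m (zip (map fst xs) us ! r) (map snd xs ! r) (zs ! r))
        = (\<Prod>r<d. rmul m (fst (xs ! r), us ! r) (snd (xs ! r)) (zs ! r))"
      by (rule prod.cong[OF refl]) (simp add: l tuples_length[OF us])
    ultimately show ?thesis
      using zip_X[OF us] zs by (simp add: Rm_def restrict_mat_def tensor_coeff_def l tuples_length[OF us])
  qed
  then have "(\<Sum>us\<in>D. (\<Prod>r<d. u (us ! r)) * Rm (map snd xs) (zip (map fst xs) us) zs)
      = (\<Sum>us\<in>D. (\<Prod>r<d. u (us ! r)) * (ksgn d (\<lambda>r. p (us ! r)) (\<lambda>r. p (map snd xs ! r))
      * (\<Prod>r<d. rmul m (fst (xs ! r), us ! r) (snd (xs ! r)) (zs ! r))))"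
    by (intro sum.cong[OF refl]) simp
  also have "\<dots> = (\<Prod>r<d. \<Sum>a\<in>UNIV. u a * rmul m (fst (xs ! r), a) (snd (xs ! r)) (zs ! r))"
    by (rule sum_unit_ksgn(1)[where F = "\<lambda>r a. rmul m (fst (xs ! r), a) (snd (xs ! r)) (zs ! r)", OF ev])
  also have "\<dots> = (\<Prod>r<d. if xs ! r = zs ! r then 1 else 0)"
  proof (rule prod.cong[OF refl])
    fix r
    show "(\<Sum>a\<in>UNIV. u a * rmul m (fst (xs ! r), a) (snd (xs ! r)) (zs ! r)) = (if xs ! r = zs ! r then 1 else 0)"
    proof (cases "fst (xs ! r) = fst (zs ! r)")
      case True
      then show ?thesis
        using unit_left[of "snd (xs ! r)" "snd (zs ! r)"] by (simp add: rmul_def prod_eq_iff)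
    qed (auto simp: rmul_def)
  qed
  finally show ?thesis by (simp add: prod_delta_list[OF l])
qed

text \<open>The tensors \<open>e\<^sub>j\<close> with all entries \<open>1 \<in> A\<close> generate the right module, so \<open>\<Psi>\<close> is determined by its
  values there; these are even, so reading off the matrix coefficients involves no Koszul sign.\<close>

lemma commuting_is_left_mult:
  assumes R: "\<And>z. z \<in> D \<Longrightarrow> mat_mult X (Rm z) \<Psi> = mat_mult X \<Psi> (Rm z)" and \<Psi>: "restrict_mat X \<Psi> = \<Psi>"
  shows "\<Psi> \<in> mat_span Ml Lm"
proof -
  \<comment> \<open>\<open>\<eta> j\<close> holds the coordinates of the image of the tensor of unit
    entries in rows \<open>j\<close>; \<open>\<xi>\<close> uses them as coefficients of the matrix
    units with column indices \<open>j\<close>.\<close>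
  define \<eta> where "\<eta> j zs = (\<Sum>us\<in>D. (\<Prod>r<d. u (us ! r)) * \<Psi> (zip j us) zs)" for j zs
  define \<xi> where "\<xi> ms = \<eta> (map (\<lambda>k. fst (snd k)) ms) (drop_columns ms)" for ms
  have "\<Psi> = lin_comb Ml \<xi> Lm"
  proof (rule mat_eqI)
    fix xs ys assume xs: "xs \<in> X" and ys: "ys \<in> X"
    note l = tuples_length[OF xs]
    have sn: "map snd xs \<in> D" using xs by (simp add: tuples_def)
    note zip_X = zip_X[OF xs]
    have "\<Psi> xs ys = (\<Sum>zs\<in>X. (if xs = zs then 1 else 0) * \<Psi> zs ys)"
      by (simp only: sum_mult_delta(4)[OF finite_X xs])
    also have "\<dots> = (\<Sum>zs\<in>X. (\<Sum>us\<in>D. (\<Prod>r<d. u (us ! r)) * Rm (map snd xs) (zip (map fst xs) us) zs) * \<Psi> zs ys)"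
      by (rule sum.cong[OF refl]) (simp only: unit_generates[OF xs])
    also have "\<dots> = (\<Sum>us\<in>D. (\<Prod>r<d. u (us ! r)) * mat_mult X (Rm (map snd xs)) \<Psi> (zip (map fst xs) us) ys)"
      unfolding sum_distrib_right using zip_X ys
      by (subst sum.swap) (simp add: mat_mult_def sum_distrib_left mult.assoc)
    also have "\<dots> = (\<Sum>us\<in>D. \<Sum>zs\<in>X. (\<Prod>r<d. u (us ! r)) * \<Psi> (zip (map fst xs) us) zs * Rm (map snd xs) zs ys)"
      unfolding R[OF sn] using zip_X ys
      by (simp add: mat_mult_def sum_distrib_left mult.assoc)
    also have "\<dots> = (\<Sum>zs\<in>X. \<eta> (map fst xs) zs * Rm (map snd xs) zs ys)"
      unfolding \<eta>_def sum_distrib_right by (rule sum.swap)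
    also have "\<dots> = (\<Sum>zs\<in>X. \<xi> (with_columns zs xs) * tensor_coeff pm pv (lmul m) (with_columns zs xs) xs ys)"
      by (rule sum.cong[OF refl])
        (simp add: \<xi>_def mids_with_columns drop_columns_with_columns tuples_length l tensor_coeff_with_columns Rm_def restrict_mat_def ys)
    also have "\<dots> = (\<Sum>ms\<in>(\<lambda>zs. with_columns zs xs) ` X. \<xi> ms * tensor_coeff pm pv (lmul m) ms xs ys)"
    proof -
      have "inj_on (\<lambda>zs. with_columns zs xs) X"
        by (rule inj_on_inverseI[where g = drop_columns]) (simp add: drop_columns_with_columns tuples_length l)
      then show ?thesis by (simp add: sum.reindex)
    qed
    \<comment> \<open>The added matrix units have columns that do not match the rows of
      \<open>xs\<close>, so they annihilate it.\<close>
    also have "\<dots> = (\<Sum>ms\<in>Ml. \<xi> ms * tensor_coeff pm pv (lmul m) ms xs ys)"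
    proof (rule sum.mono_neutral_left)
      show "finite Ml" by (simp add: finite_tuples) 
      show "(\<lambda>zs. with_columns zs xs) ` X \<subseteq> Ml" using with_columns_Ml xs by blast
      show "\<forall>ms\<in>Ml - (\<lambda>zs. with_columns zs xs) ` X. \<xi> ms * tensor_coeff pm pv (lmul m) ms xs ys = 0"
      proof
        fix ms assume ms: "ms \<in> Ml - (\<lambda>zs. with_columns zs xs) ` X"
        then have lm: "length ms = d" by (simp add: tuples_def)
        have "with_columns (drop_columns ms) xs \<noteq> ms"
        proof
          assume "with_columns (drop_columns ms) xs = ms"
          moreover have "drop_columns ms \<in> X" using ms by (intro drop_columns_X) simp
          ultimately have "ms \<in> (\<lambda>zs. with_columns zs xs) ` X" by (metis image_eqI)
          then show False using ms by simp
        qed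
        then obtain r where "r < d" "fst (snd (ms ! r)) \<noteq> fst (xs ! r)"
          using with_columns_drop_columns[OF lm l] by blast
        then have "(\<Prod>r<d. lmul m (ms ! r) (xs ! r) (ys ! r)) = 0"
          by (intro prod_zero) (auto simp: lmul_def)
        then show "\<xi> ms * tensor_coeff pm pv (lmul m) ms xs ys = 0" by (simp add: tensor_coeff_def lm)
      qed
    qed
    finally show "\<Psi> xs ys = lin_comb Ml \<xi> Lm xs ys"
      using xs ys by (simp add: lin_comb_def Lm_def restrict_mat_def)
  qed (simp_all add: restrict_mat_lin_comb \<Psi>)
  then show ?thesis unfolding mat_span_def by blast
qed

text \<open>Summing the conjugates of \<open>\<Psi>\<close> multiplies it by d!, since it commutes
  with permutations, and turns each matrix unit in its expansion into a signed sum over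
  permutations. Testing against those sums therefore suffices.\<close>

lemma invariants_determine:
  assumes \<Phi>: "\<And>ms. ms \<in> Ml \<Longrightarrow> mat_mult X \<Phi> (lin_comb perms (\<lambda>\<tau>. lsgn pm \<tau> ms) (\<lambda>\<tau>. Lm (plist \<tau> ms)))
                  = mat_mult X (lin_comb perms (\<lambda>\<tau>. lsgn pm \<tau> ms) (\<lambda>\<tau>. Lm (plist \<tau> ms))) \<Phi>"
    and \<Psi>: "restrict_mat X \<Psi> = \<Psi>" and R: "\<And>z. z \<in> D \<Longrightarrow> mat_mult X (Rm z) \<Psi> = mat_mult X \<Psi> (Rm z)"
    and P: "\<And>\<tau>. \<tau> \<in> perms \<Longrightarrow> mat_mult X (Pm \<tau>) \<Psi> = mat_mult X \<Psi> (Pm \<tau>)"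
  shows "mat_mult X \<Phi> \<Psi> = mat_mult X \<Psi> \<Phi>"
proof -
  define L where "L ms = lin_comb perms (\<lambda>\<tau>. lsgn pm \<tau> ms) (\<lambda>\<tau>. Lm (plist \<tau> ms))" for ms
  obtain \<xi> where \<xi>: "\<Psi> = lin_comb Ml \<xi> Lm"
    using commuting_is_left_mult[OF R \<Psi>] unfolding mat_span_def by blast
  have conj: "mat_mult X (Pm (inv \<tau>)) (mat_mult X (Lm ms) (Pm \<tau>)) = scale_mat (lsgn pm \<tau> ms) (Lm (plist \<tau> ms))"
    if \<tau>: "\<tau> \<in> perms" and ms: "ms \<in> Ml" for \<tau> ms
    by (simp only: Lm_Pm[OF \<tau> tuples_length[OF ms]] mat_mult_scale_mat_right mat_mult_assoc[symmetric] Pm_inv[OF \<tau>]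
        mat_mult_id_mat[OF finite_X] restrict_mat_mats)
  have "scale_mat (fact d) \<Psi> = lin_comb perms (\<lambda>_. 1) (\<lambda>\<tau>. \<Psi>)"
    by (auto simp: scale_mat_def lin_comb_def card_permutations[OF card_lessThan finite_lessThan])
  also have "\<dots> = lin_comb perms (\<lambda>_. 1) (\<lambda>\<tau>. mat_mult X (Pm (inv \<tau>)) (mat_mult X \<Psi> (Pm \<tau>)))"
    by (rule lin_comb_cong) (simp only: P[symmetric], simp only: mat_mult_assoc[symmetric] Pm_inv mat_mult_id_mat[OF finite_X] \<Psi>)
  also have "\<dots> = lin_comb perms (\<lambda>_. 1) (\<lambda>\<tau>. lin_comb Ml \<xi> (\<lambda>ms. scale_mat (lsgn pm \<tau> ms) (Lm (plist \<tau> ms))))"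
    unfolding \<xi> mat_mult_lin_comb_left mat_mult_lin_comb_right by (intro lin_comb_cong) (rule conj)
  also have "\<dots> = lin_comb Ml \<xi> (\<lambda>ms. lin_comb perms (\<lambda>_. 1) (\<lambda>\<tau>. scale_mat (lsgn pm \<tau> ms) (Lm (plist \<tau> ms))))"
    by (rule lin_comb_lin_comb_swap)
  also have "\<dots> = lin_comb Ml \<xi> L"
    by (rule lin_comb_cong) (simp add: L_def lin_comb_def scale_mat_def)
  finally have e: "scale_mat (fact d) \<Psi> = lin_comb Ml \<xi> L" .
  have "mat_mult X \<Phi> (lin_comb Ml \<xi> L) = mat_mult X (lin_comb Ml \<xi> L) \<Phi>"
    unfolding mat_mult_lin_comb_left mat_mult_lin_comb_right by (rule lin_comb_cong) (simp only: L_def \<Phi>)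
  then have "scale_mat (fact d) (mat_mult X \<Phi> \<Psi>) = scale_mat (fact d) (mat_mult X \<Psi> \<Phi>)"
    unfolding e[symmetric] mat_mult_scale_mat_left mat_mult_scale_mat_right .
  then show ?thesis by (simp add: scale_mat_def fun_eq_iff)
qed

end

section \<open>Passage from the base ring\<close>

lemma lsgn_pinv: "(- 1) ^ pinv q \<tau> xs = lsgn q \<tau> xs"
  by (simp add: psgn_pinv lsgn_def)

lemma amul_bvec_left: "amul m (bvec a) y c = (\<Sum>b\<in>UNIV. y b * m a b c)"
proof -
  have "amul m (bvec a) y c = (\<Sum>a'\<in>UNIV. (if a' = a then 1 else 0) * (\<Sum>b\<in>UNIV. y b * m a' b c))"
    by (simp add: amul_def bvec_def sum_distrib_left mult.assoc)
  then show ?thesis by (simp only: sum_mult_delta(3)[OF finite UNIV_I])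
qed

lemma amul_bvec_right: "amul m x (bvec b) c = (\<Sum>a\<in>UNIV. x a * m a b c)"
proof -
  have "amul m x (bvec b) c = (\<Sum>a\<in>UNIV. \<Sum>b'\<in>UNIV. (x a * m a b' c) * (if b' = b then 1 else 0))"
    by (simp add: amul_def bvec_def mult_ac)
  then show ?thesis by (simp only: sum_mult_delta(1)[OF finite UNIV_I])
qed

lemma super_algebra_structure_constants:
  assumes "super_algebra m u p"
  shows "assoc_on UNIV m" "parity_additive p p p m" "\<And>b. u b \<noteq> 0 \<Longrightarrow> \<not> p b"
    "\<And>b c. (\<Sum>a\<in>UNIV. u a * m b a c) = (if b = c then 1 else 0)"
    "\<And>b c. (\<Sum>a\<in>UNIV. u a * m a b c) = (if b = c then 1 else 0)"
proof -
  have a: "amul m (amul m x y) z v = amul m x (amul m y z) v" for x y z v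
    using assms unfolding super_algebra_def by simp
  show "assoc_on UNIV m"
    unfolding assoc_on_def
  proof (intro ballI)
    fix x y z v
    have m: "amul m (bvec a) (bvec b) w = m a b w" for a b w
      unfolding amul_bvec_left unfolding bvec_def by (rule sum_mult_delta(3)[OF finite UNIV_I])
    show "(\<Sum>w\<in>UNIV. m x y w * m w z v) = (\<Sum>w\<in>UNIV. m y z w * m x w v)"
      using a[of "bvec x" "bvec y" "bvec z" v] by (simp add: amul_bvec_left[of _ x "amul _ _ _"] amul_bvec_right[of _ "amul _ _ _"] m)
  qed
  show "parity_additive p p p m" "\<And>b. u b \<noteq> 0 \<Longrightarrow> \<not> p b"
    using assms unfolding super_algebra_def parity_additive_def by blast+
  have "amul m x u = x" "amul m u x = x" for x using assms unfolding super_algebra_def by auto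
  then have "amul m (bvec b) u c = bvec b c" "amul m u (bvec b) c = bvec b c" for b c by simp_all
  then show "(\<Sum>a\<in>UNIV. u a * m b a c) = (if b = c then 1 else 0)"
    "(\<Sum>a\<in>UNIV. u a * m a b c) = (if b = c then 1 else 0)" for b c
    unfolding amul_bvec_left amul_bvec_right by (auto simp: bvec_def)
qed

lemma unital_ring_hom_props:
  assumes "unital_ring_hom h"
  shows "h 0 = 0" "h 1 = 1" "h (x + y) = h x + h y" "h (x * y) = h x * h y" "h (- x) = - h x"
proof -
  show *: "h 1 = 1" "\<And>x y. h (x + y) = h x + h y" "h (x * y) = h x * h y"
    using assms unfolding unital_ring_hom_def by auto
  show 0: "h 0 = 0" using *(2)[of 0 0] by simp
  show "h (- x) = - h x" using *(2)[of x "- x"] 0 by (simp add: eq_neg_iff_add_eq_0 add.commute)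
qed

lemma unital_ring_hom_sum:
  assumes "unital_ring_hom h"
  shows "h (\<Sum>x\<in>S. f x) = (\<Sum>x\<in>S. h (f x))"
  by (induction S rule: infinite_finite_induct) (simp_all add: unital_ring_hom_props[OF assms])

lemma unital_ring_hom_sign:
  assumes "unital_ring_hom h"
  shows "h ((- 1) ^ k) = (- 1) ^ k"
  by (induction k) (simp_all add: unital_ring_hom_props[OF assms])

text \<open>The axioms are polynomial identities with integer coefficients and vanishing conditions;
  both survive a unital ring homomorphism.\<close>

lemma structure_constants_hom:
  assumes h: "unital_ring_hom h" and "assoc_on UNIV m" "parity_additive p p p m" "\<And>b. u b \<noteq> 0 \<Longrightarrow> \<not> p b"
    "\<And>b c. (\<Sum>a\<in>UNIV. u a * m b a c) = (if b = c then 1 else 0)"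
    "\<And>b c. (\<Sum>a\<in>UNIV. u a * m a b c) = (if b = c then 1 else 0)"
  shows "wreath_tensor (\<lambda>a b c. h (m a b c) :: 'a::field_char_0) (\<lambda>b. h (u b)) p"
proof
  note hp = unital_ring_hom_props[OF h]
  show "assoc_on UNIV (\<lambda>a b c. h (m a b c))"
    unfolding assoc_on_def
  proof (intro ballI)
    fix x y z v
    have "(\<Sum>w\<in>UNIV. m x y w * m w z v) = (\<Sum>w\<in>UNIV. m y z w * m x w v)"
      using assms(2) unfolding assoc_on_def by blast
    then show "(\<Sum>w\<in>UNIV. h (m x y w) * h (m w z v)) = (\<Sum>w\<in>UNIV. h (m y z w) * h (m x w v))"
      by (simp only: hp(4)[symmetric] unital_ring_hom_sum[OF h, symmetric])
  qed
  show "parity_additive p p p (\<lambda>a b c. h (m a b c))"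
    using assms(3) hp(1) unfolding parity_additive_def by metis
  show "h (u b) \<noteq> 0 \<Longrightarrow> \<not> p b" for b using assms(4) hp(1) by metis
  show "(\<Sum>a\<in>UNIV. h (u a) * h (m b a c)) = (if b = c then 1 else 0)" for b c
    by (simp only: hp(4)[symmetric] unital_ring_hom_sum[OF h, symmetric] assms(5)) (simp add: hp)
  show "(\<Sum>a\<in>UNIV. h (u a) * h (m a b c)) = (if b = c then 1 else 0)" for b c
    by (simp only: hp(4)[symmetric] unital_ring_hom_sum[OF h, symmetric] assms(6)) (simp add: hp)
qed

text \<open>A multiple of the signed orbit sum: every orbit element is counted once per stabilizing permutation.\<close>

definition orbit_sum :: "('x \<Rightarrow> bool) \<Rightarrow> 'x list \<Rightarrow> 'x list \<Rightarrow> 'a::comm_ring_1" where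
  "orbit_sum q ms ys = (\<Sum>\<tau>\<in>{\<tau>. \<tau> permutes {..<length ms}}. if ys = plist \<tau> ms then lsgn q \<tau> ms else 0)"

lemma bij_betw_comp_permutes:
  assumes "\<sigma> permutes S"
  shows "bij_betw (\<lambda>\<tau>. \<tau> \<circ> \<sigma>) {\<tau>. \<tau> permutes S} {\<tau>. \<tau> permutes S}"
  by (rule bij_betw_byWitness[where f' = "\<lambda>\<tau>. \<tau> \<circ> inv \<sigma>"])
    (use assms in \<open>auto simp: o_assoc[symmetric] permutes_inv_o permutes_inv permutes_compose\<close>)

text \<open>Composition with \<open>\<sigma>\<close> on the right permutes the summation index, and
  the signs multiply by \<open>lsgn_comp\<close>.\<close>

lemma place_act_orbit_sum:
  assumes fin: "finite S" and ms: "ms \<in> tuples S d" and \<sigma>: "\<sigma> permutes {..<d}"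
  shows "place_act q (tuples S d) \<sigma> (orbit_sum q ms) = (orbit_sum q ms :: _ \<Rightarrow> 'a::comm_ring_1)"
proof
  fix ys
  let ?P = "{\<tau>. \<tau> permutes {..<d}}"
  let ?f = "\<lambda>\<rho>. if ys = plist \<rho> ms then lsgn q \<rho> ms else (0 :: 'a)"
  have l: "length ms = d" using ms by (rule tuples_length)
  have "place_act q (tuples S d) \<sigma> (orbit_sum q ms) ys
      = (\<Sum>xs\<in>tuples S d. \<Sum>\<tau>\<in>?P. (if xs = plist \<tau> ms then 1 else 0) *
          (if ys = plist \<sigma> xs then lsgn q \<sigma> xs * lsgn q \<tau> ms else (0 :: 'a)))"
    unfolding place_act_def orbit_sum_def lsgn_pinv l sum_distrib_left
    by (rule sum.cong[OF refl]) (auto intro!: sum.cong simp: sum_distrib_left)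
  also have "\<dots> = (\<Sum>\<tau>\<in>?P. \<Sum>xs\<in>tuples S d. (if xs = plist \<tau> ms then 1 else 0) *
          (if ys = plist \<sigma> xs then lsgn q \<sigma> xs * lsgn q \<tau> ms else (0 :: 'a)))"
    by (rule sum.swap)
  also have "\<dots> = (\<Sum>\<tau>\<in>?P. ?f (\<tau> \<circ> \<sigma>))"
  proof (rule sum.cong[OF refl])
    fix \<tau> assume "\<tau> \<in> ?P"
    then have \<tau>: "\<tau> permutes {..<d}" by simp
    have "(\<Sum>xs\<in>tuples S d. (if xs = plist \<tau> ms then 1 else 0) *
          (if ys = plist \<sigma> xs then lsgn q \<sigma> xs * lsgn q \<tau> ms else (0 :: 'a)))
        = (if ys = plist \<sigma> (plist \<tau> ms) then lsgn q \<sigma> (plist \<tau> ms) * lsgn q \<tau> ms else 0)"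
      by (rule sum_mult_delta(3)[OF finite_tuples[OF fin] plist_tuples[OF \<tau> ms]])
    then show "(\<Sum>xs\<in>tuples S d. (if xs = plist \<tau> ms then 1 else 0) *
          (if ys = plist \<sigma> xs then lsgn q \<sigma> xs * lsgn q \<tau> ms else (0 :: 'a))) = ?f (\<tau> \<circ> \<sigma>)"
      using \<sigma> \<tau> by (simp add: l plist_plist lsgn_comp mult.commute)
  qed
  also have "\<dots> = (\<Sum>\<rho>\<in>?P. ?f \<rho>)"
    by (rule sum.reindex_bij_betw[OF bij_betw_comp_permutes[OF \<sigma>]])
  finally show "place_act q (tuples S d) \<sigma> (orbit_sum q ms) ys = (orbit_sum q ms ys :: 'a)"
    by (simp only: orbit_sum_def l)
qed

lemma orbit_sum_schur_alg:
  fixes ms :: "(nat \<times> nat \<times> 'b::finite) list"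
  assumes "ms \<in> Midx n d"
  shows "orbit_sum (\<lambda>x. p (snd (snd x))) ms \<in> schur_alg p n d"
proof -
  have ms: "ms \<in> tuples ({..<n} \<times> rows n) d" using assms by (simp only: Midx_tuples)
  have "orbit_sum (\<lambda>x. p (snd (snd x))) ms \<in> supported (Midx n d)"
    unfolding supported_def orbit_sum_def Midx_tuples
    using plist_tuples[OF _ ms] tuples_length[OF ms] by (auto intro!: sum.neutral)
  then show ?thesis
    unfolding schur_alg_def using place_act_orbit_sum[of "{..<n} \<times> rows n" ms d] ms
    by (auto simp: Midx_tuples)
qed


section \<open>Translation of the actions into matrices\<close>

context wreath_tensor
begin

lemma lact_eq:
  assumes "out \<in> X"
  shows "lact m p n d \<xi> v out = (\<Sum>ts\<in>X. v ts * lin_comb (Midx n d) \<xi> Lm ts out)"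
proof -
  have "lact m p n d \<xi> v out = (\<Sum>ms\<in>Midx n d. \<Sum>ts\<in>X. v ts * (\<xi> ms * Lm ms ts out))"
    using assms by (simp add: lact_def Tidx_tuples lcoef_tensor_coeff Lm_def restrict_mat_def mult_ac)
  also have "\<dots> = (\<Sum>ts\<in>X. \<Sum>ms\<in>Midx n d. v ts * (\<xi> ms * Lm ms ts out))"
    by (rule sum.swap)
  finally show ?thesis by (simp add: lin_comb_def sum_distrib_left)
qed

lemma ract_place_act:
  assumes out: "out \<in> X" and \<tau>: "\<tau> \<in> perms" and bs: "bs \<in> D"
  shows "ract m p n d bs (place_act pv X \<tau> v) out = (\<Sum>xs\<in>X. v xs * mat_mult X (Pm \<tau>) (Rm bs) xs out)"
proof -
  have 1: "place_act pv X \<tau> v ts = (\<Sum>xs\<in>X. v xs * Pm \<tau> xs ts)" if "ts \<in> X" for ts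
    unfolding place_act_def lsgn_pinv
    by (rule sum.cong[OF refl]) (use that in \<open>simp add: Pm_def restrict_mat_def\<close>)
  have 2: "rcoef m p bs ts out = Rm bs ts out" if "ts \<in> X" for ts
    using that out by (simp add: rcoef_tensor_coeff tuples_length[OF that] tuples_length[OF bs] Rm_def restrict_mat_def)
  have "ract m p n d bs (place_act pv X \<tau> v) out = (\<Sum>ts\<in>X. (\<Sum>xs\<in>X. v xs * Pm \<tau> xs ts) * Rm bs ts out)"
    using out by (simp add: ract_def Tidx_tuples 1 2)
  also have "\<dots> = (\<Sum>xs\<in>X. \<Sum>ts\<in>X. v xs * (Pm \<tau> xs ts * Rm bs ts out))"
    unfolding sum_distrib_right mult.assoc by (rule sum.swap)
  finally show ?thesis using out by (simp add: mat_mult_def sum_distrib_left)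
qed

lemma wact_eq:
  assumes out: "out \<in> X"
  shows "wact m p n d w v out
    = (\<Sum>xs\<in>X. v xs * lin_comb (perms \<times> D) w (\<lambda>(\<tau>, b). mat_mult X (Pm \<tau>) (Rm b)) xs out)"
proof -
  have pairs: "(\<Sum>\<tau>\<in>perms. \<Sum>bs\<in>D. F \<tau> bs) = (\<Sum>k\<in>perms \<times> D. F (fst k) (snd k))" for F :: "_ \<Rightarrow> _ \<Rightarrow> 'a"
    by (simp add: sum.cartesian_product case_prod_beta)
  have "wact m p n d w v out = (\<Sum>\<tau>\<in>perms. \<Sum>bs\<in>D. w (\<tau>, bs) * (\<Sum>xs\<in>X. v xs * mat_mult X (Pm \<tau>) (Rm bs) xs out))"
    unfolding wact_def Bidx_tuples Tidx_tuples
    by (intro sum.cong[OF refl]) (simp add: ract_place_act[OF out])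
  also have "\<dots> = (\<Sum>k\<in>perms \<times> D. \<Sum>xs\<in>X. v xs * (w k * mat_mult X (Pm (fst k)) (Rm (snd k)) xs out))"
    unfolding pairs[of "\<lambda>\<tau> bs. w (\<tau>, bs) * (\<Sum>xs\<in>X. v xs * mat_mult X (Pm \<tau>) (Rm bs) xs out)"]
    by (simp add: sum_distrib_left mult.left_commute)
  also have "\<dots> = (\<Sum>xs\<in>X. \<Sum>k\<in>perms \<times> D. v xs * (w k * mat_mult X (Pm (fst k)) (Rm (snd k)) xs out))"
    by (rule sum.swap)
  finally show ?thesis by (simp add: lin_comb_def case_prod_beta sum_distrib_left)
qed

end

lemma linear_on_supported:
  fixes \<phi> :: "('x \<Rightarrow> 'a::field) \<Rightarrow> 'x \<Rightarrow> 'a"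
  assumes add: "\<forall>v \<in> supported X. \<forall>v' \<in> supported X. \<phi> (\<lambda>x. v x + v' x) = (\<lambda>x. \<phi> v x + \<phi> v' x)"
    and scal: "\<forall>c. \<forall>v \<in> supported X. \<phi> (\<lambda>x. c * v x) = (\<lambda>x. c * \<phi> v x)"
    and X: "finite X" and v: "v \<in> supported X"
  shows "\<phi> v y = (\<Sum>x\<in>X. v x * \<phi> (bvec x) y)"
proof -
  have "S \<subseteq> X \<Longrightarrow> \<phi> (\<lambda>x. if x \<in> S then v x else 0) = (\<lambda>y. \<Sum>x\<in>S. v x * \<phi> (bvec x) y)"
    if "finite S" for S
    using that
  proof (induction S rule: finite_induct)
    case empty
    \<comment> \<open>Scaling by 0 gives the value of \<phi> at the zero vector.\<close>
    show ?case using spec[OF scal, of 0] v by auto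
  next
    case (insert a S)
    have b: "bvec a \<in> supported X" using insert.prems by (auto simp: bvec_def supported_def)
    have s: "(\<lambda>x. if x \<in> S then v x else 0) \<in> supported X" using v by (auto simp: supported_def)
    have t: "(\<lambda>x. v a * bvec a x) \<in> supported X" using b by (auto simp: supported_def)
    note bspec[OF bspec[OF add s] t]
    moreover have "(\<lambda>x. (if x \<in> S then v x else 0) + v a * bvec a x)
        = (\<lambda>x. if x \<in> insert a S then v x else 0)"
      using insert.hyps by (auto simp: bvec_def)
    moreover have "\<phi> (\<lambda>x. v a * bvec a x) = (\<lambda>x. v a * \<phi> (bvec a) x)" using scal b by blast
    ultimately show ?case
      using insert.IH insert.prems insert.hyps by (simp add: add.commute)
  qed
  from this[OF X] have "\<phi> (\<lambda>x. if x \<in> X then v x else 0) y = (\<Sum>x\<in>X. v x * \<phi> (bvec x) y)" by simp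
  moreover have "(\<lambda>x. if x \<in> X then v x else 0) = v" using v by (auto simp: supported_def)
  ultimately show ?thesis by simp
qed

theorem mainTheorem12:
  fixes h :: "'k::{idom,ring_char_0} \<Rightarrow> 'K::field_char_0"
    and m :: "'b::finite \<Rightarrow> 'b \<Rightarrow> 'b \<Rightarrow> 'k" and u :: "'b \<Rightarrow> 'k" and p :: "'b \<Rightarrow> bool"
    and I :: "'i set" and e :: "'i \<Rightarrow> 'b \<Rightarrow> 'k" and blk :: "'b \<Rightarrow> 'i \<times> 'i"
    and n d :: nat
    and \<phi> :: "((nat \<times> 'b) list \<Rightarrow> 'K) \<Rightarrow> ((nat \<times> 'b) list \<Rightarrow> 'K)"
  assumes acl: "alg_closed TYPE('K)"
    and hom: "unital_ring_hom h"
    and alg: "super_algebra m u p"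
    and idem: "idempotent_decomp m u p I e blk"
    and ss: "semisimple_super (\<lambda>a b c. h (m a b c)) p"
    and maps: "\<forall>v \<in> supported (Tidx n d). \<phi> v \<in> supported (Tidx n d)"
    and add: "\<forall>v \<in> supported (Tidx n d). \<forall>v' \<in> supported (Tidx n d).
                \<phi> (\<lambda>x. v x + v' x) = (\<lambda>x. \<phi> v x + \<phi> v' x)"
    and scal: "\<forall>c. \<forall>v \<in> supported (Tidx n d). \<phi> (\<lambda>x. c * v x) = (\<lambda>x. c * \<phi> v x)"
    and comm: "\<forall>\<xi> \<in> schur_alg p n d. \<forall>v \<in> supported (Tidx n d).
                \<phi> (lact (\<lambda>a b c. h (m a b c)) p n d (h \<circ> \<xi>) v)
                  = lact (\<lambda>a b c. h (m a b c)) p n d (h \<circ> \<xi>) (\<phi> v)"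
  shows "\<exists>w. \<forall>v \<in> supported (Tidx n d). \<phi> v = wact (\<lambda>a b c. h (m a b c)) p n d w v"
proof -
  let ?m = "\<lambda>a b c. h (m a b c)"
  let ?u = "\<lambda>b. h (u b)"
  interpret wreath_tensor ?m ?u p n d
    by (rule structure_constants_hom[OF hom super_algebra_structure_constants[OF alg]])
  obtain g where "\<And>a c. (\<Sum>b\<in>UNIV. gram UNIV ?m a b * g b c) = (if a = c then 1 else 0)"
    using gram_inverse_exists[OF as parity_additive unit_right ss] by blast
  then interpret wreath_semisimple ?m ?u p n d g
    by unfold_locales
  note add = add[unfolded Tidx_tuples] and scal = scal[unfolded Tidx_tuples] and maps = maps[unfolded Tidx_tuples]
  note lin = linear_on_supported[OF add scal finite_X]
  \<comment> \<open>Row x holds the image of basis tensor x, so applying \<phi> is multiplying a row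
    vector by \<open>\<Phi>\<close>.\<close>
  define \<Phi> where "\<Phi> = restrict_mat X (\<lambda>x y. \<phi> (bvec x) y)"
  have bv: "bvec x \<in> supported X" if "x \<in> X" for x
    using that by (auto simp: bvec_def supported_def)
  have \<phi>\<Phi>: "\<phi> v y = (\<Sum>x\<in>X. v x * \<Phi> x y)" if "v \<in> supported X" "y \<in> X" for v y
    using lin[OF that(1), of y] that(2) by (simp add: \<Phi>_def restrict_mat_def)
  have "\<Phi> \<in> mat_span Bw Wm"
  proof (rule commuting_in_span)
    show "restrict_mat X \<Phi> = \<Phi>" by (simp add: \<Phi>_def)
    fix \<Psi> assume \<Psi>: "restrict_mat X \<Psi> = \<Psi>" "\<And>z. z \<in> D \<Longrightarrow> mat_mult X (Rm z) \<Psi> = mat_mult X \<Psi> (Rm z)"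
      "\<And>\<tau>. \<tau> \<in> perms \<Longrightarrow> mat_mult X (Pm \<tau>) \<Psi> = mat_mult X \<Psi> (Pm \<tau>)"
    show "mat_mult X \<Phi> \<Psi> = mat_mult X \<Psi> \<Phi>"
    proof (rule invariants_determine[OF _ \<Psi>])
      fix ms assume ms: "ms \<in> Ml"
      \<comment> \<open>The orbit sum has integer coefficients, so it exists over the base ring,
        where the hypothesis on \<phi> applies, and \<open>h\<close> preserves its signs.\<close>
      define \<xi> where "\<xi> = h \<circ> orbit_sum pm ms"
      define L where "L = lin_comb perms (\<lambda>\<tau>. lsgn pm \<tau> ms) (\<lambda>\<tau>. Lm (plist \<tau> ms))"
      have h_sgn: "h (lsgn pm \<tau> ms) = lsgn pm \<tau> ms" for \<tau>
        unfolding lsgn_pinv[symmetric] by (rule unital_ring_hom_sign[OF hom])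
      have L: "lin_comb (Midx n d) \<xi> Lm = L"
      proof (intro ext)
        fix s t
        have "lin_comb (Midx n d) \<xi> Lm s t
            = (\<Sum>ks\<in>Ml. \<Sum>\<tau>\<in>perms. (if ks = plist \<tau> ms then 1 else 0) * (lsgn pm \<tau> ms * Lm ks s t))"
          unfolding lin_comb_def Midx_tuples \<xi>_def o_def orbit_sum_def unital_ring_hom_sum[OF hom] sum_distrib_right
            tuples_length[OF ms]
          by (intro sum.cong[OF refl]) (simp add: h_sgn unital_ring_hom_props(1)[OF hom])
        also have "\<dots> = (\<Sum>\<tau>\<in>perms. \<Sum>ks\<in>Ml. (if ks = plist \<tau> ms then 1 else 0) * (lsgn pm \<tau> ms * Lm ks s t))"
          by (rule sum.swap)
        also have "\<dots> = (\<Sum>\<tau>\<in>perms. lsgn pm \<tau> ms * Lm (plist \<tau> ms) s t)"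
          by (rule sum.cong[OF refl], rule sum_mult_delta(3))
            (use ms in \<open>auto simp: finite_tuples intro: plist_tuples\<close>)
        finally show "lin_comb (Midx n d) \<xi> Lm s t = L s t" by (simp add: L_def lin_comb_def)
      qed
      have lact: "lact ?m p n d \<xi> v y = (\<Sum>z\<in>X. v z * L z y)" if "y \<in> X" for v y
        using lact_eq[OF that] by (simp only: L)
      have supp: "lact ?m p n d \<xi> v \<in> supported X" for v
        by (simp add: lact_def supported_def Tidx_tuples)
      \<comment> \<open>In row-vector order, \<open>L\<close> followed by \<open>\<Phi>\<close> is
        \<phi> after the action, and \<open>\<Phi>\<close> followed by \<open>L\<close> is the
        action after \<phi>; both are compared on basis tensors.\<close>
      have "mat_mult X L \<Phi> = mat_mult X \<Phi> L"
      proof (rule mat_eqI)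
        fix x y assume x: "x \<in> X" and y: "y \<in> X"
        have b: "(\<Sum>z\<in>X. bvec x z * f z) = f x" for f :: "_ \<Rightarrow> 'K"
          unfolding bvec_def by (rule sum_mult_delta(3)[OF finite_X x])
        have "orbit_sum pm ms \<in> schur_alg p n d"
          by (rule orbit_sum_schur_alg) (use ms in \<open>simp only: Midx_tuples\<close>)
        then have "\<phi> (lact ?m p n d \<xi> (bvec x)) y = lact ?m p n d \<xi> (\<phi> (bvec x)) y"
          using comm bv[OF x] unfolding \<xi>_def Tidx_tuples by metis
        also have "\<dots> = (\<Sum>z\<in>X. \<Phi> x z * L z y)"
          unfolding lact[OF y] by (rule sum.cong[OF refl]) (simp add: \<Phi>_def restrict_mat_def x)
        also have "\<phi> (lact ?m p n d \<xi> (bvec x)) y = (\<Sum>z\<in>X. L x z * \<Phi> z y)"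
          unfolding \<phi>\<Phi>[OF supp y] by (rule sum.cong[OF refl]) (simp only: lact b)
        finally show "mat_mult X L \<Phi> x y = mat_mult X \<Phi> L x y" using x y by (simp add: mat_mult_def)
      qed simp_all
      then show "mat_mult X \<Phi> (lin_comb perms (\<lambda>\<tau>. lsgn pm \<tau> ms) (\<lambda>\<tau>. Lm (plist \<tau> ms)))
          = mat_mult X (lin_comb perms (\<lambda>\<tau>. lsgn pm \<tau> ms) (\<lambda>\<tau>. Lm (plist \<tau> ms))) \<Phi>"
        by (simp add: L_def)
    qed
  qed
  then obtain w where w: "\<Phi> = lin_comb Bw w Wm" unfolding mat_span_def by blast
  have "\<phi> v = wact ?m p n d w v" if v: "v \<in> supported (Tidx n d)" for v
  proof
    fix y
    show "\<phi> v y = wact ?m p n d w v y"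
    proof (cases "y \<in> X")
      case True
      then show ?thesis using \<phi>\<Phi> v by (simp add: wact_eq w Tidx_tuples)
    next
      case False
      then have "\<phi> v y = 0" using maps v unfolding Tidx_tuples supported_def by blast
      then show ?thesis using False by (simp add: wact_def ract_def Tidx_tuples)
    qed
  qed
  then show ?thesis by blast
qed

end
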